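(* Let $X$ and $Y$ be Hausdorff sequentially complete locally convex spaces over $\mathbb{C}$. Suppose that $\mathcal{A}$ is a closed MLO in $X$, $C_{1}\in L(Y,X)$, $C_{2}\in L(X)$, that $|a(t)|$ and $k(t)$ satisfy (P1), and that $(R_{1}(t),R_{2}(t))_{t\geq 0}\subseteq L(Y,X)\times L(X)$ is strongly continuous. Let $\omega\geq\max(0,\mathrm{abs}(|a|),\mathrm{abs}(k))$ be such that the operator family $\{e^{-\omega t}R_{i}(t):t\geq 0\}$ is equicontinuous for $i=1,2$. Consider the conditions $$ (\mathrm{E})\qquad \tilde{a}(\lambda)\tilde{k}(\lambda)C_{1}y\in\bigl(\tilde{a}(\lambda)-\mathcal{A}\bigr)\int_{0}^{\infty}e^{-\lambda t}\bigl[k(t)C_{1}y-R_{1}(t)y\bigr]\,dt,\quad y\in Y, $$ $$ (\mathrm{U})\qquad \tilde{k}(\lambda)C_{2}x=\int_{0}^{\infty}e^{-\lambda t}\bigl[R_{2}(t)x-(a\ast R_{2})(t)y\bigr]\,dt\quad\text{whenever }(y,x)\in\mathcal{A}. $$ Then the following holds. (i) $(R_{1}(t),R_{2}(t))_{t\geq 0}$ is a mild $(a,k)$-regularized $(C_{1},C_{2})$-existence and uniqueness family with a subgenerator $\mathcal{A}^{-1}$ if and only if for every $\lambda\in\mathbb{C}$ with $\Re\lambda>\omega$ and $\tilde{a}(\lambda)\tilde{k}(\lambda)\neq 0$ we have $R(C_{1})\subseteq R(\tilde{a}(\lambda)-\mathcal{A})$, (E) and (U). (ii) $(R_{1}(t))_{t\geq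 0}$ is a mild $(a,k)$-regularized $C_{1}$-existence family with a subgenerator $\mathcal{A}^{-1}$ if and only if for every $\lambda\in\mathbb{C}$ with $\Re\lambda>\omega$ and $\tilde{a}(\lambda)\tilde{k}(\lambda)\neq 0$ we have $R(C_{1})\subseteq R(\tilde{a}(\lambda)-\mathcal{A})$ and (E). (iii) $(R_{2}(t))_{t\geq 0}$ is a mild $(a,k)$-regularized $C_{2}$-uniqueness family with a subgenerator $\mathcal{A}^{-1}$ if and only if (U) holds for all $\lambda\in\mathbb{C}$ with $\Re\lambda>\omega$.
   Context: MLOs: a map $\mathcal{A}:X\to P(X)$ is a multivalued linear operator (MLO) in $X$ if $D(\mathcal{A}):=\{x:\mathcal{A}x\neq\emptyset\}$ is a linear subspace, $\mathcal{A}x+\mathcal{A}y\subseteq\mathcal{A}(x+y)$ and $\lambda\mathcal{A}x\subseteq\mathcal{A}(\lambda x)$ for $x,y\in D(\mathcal{A})$, $\lambda\in\mathbb{C}$; it is identified with its graph in $X\times X$ (a linear subspace), and it is closed if the graph is closed. $\mathcal{A}^{-1}=\{(y,x):(x,y)\in\mathcal{A}\}$. $R(\cdot)$ denotes range; sums and products are those of linear relations. (P1) for a scalar function $k$ on $[0,\infty)$: $k$ is locally integrable and there is $\beta\in\mathbb{R}$ such that $\tilde{k}(\lambda):=\lim_{b\to\infty}\int_{0}^{b}e^{-\lambda t}k(t)\,dt$ exists for all $\Re\lambda>\beta$; $\mathrm{abs}(k):=\inf\{\Re\lambda:\tilde{k}(\lambda)\text{ exists}\}$. The tilde denotes the Laplace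 transform and $\ast$ the finite convolution, $(a\ast R)(t)x=\int_0^t a(t-s)R(s)x\,ds$. A family of operators in $L(Y,X)$ is strongly continuous if $t\mapsto R(t)y$ is continuous for each $y$. Families: throughout $k\in C([0,\infty))$, $k\neq 0$, $a\in L^{1}_{loc}([0,\infty))$, $a\neq 0$. Let $\mathcal{M}$ be an MLO in $X$. A strongly continuous $(R_{1}(t))_{t\ge 0}\subseteq L(Y,X)$ is a mild $(a,k)$-regularized $C_{1}$-existence family with a subgenerator $\mathcal{M}$ if $\bigl(\int_{0}^{t}a(t-s)R_{1}(s)y\,ds,\ R_{1}(t)y-k(t)C_{1}y\bigr)\in\mathcal{M}$ for all $t\geq 0$, $y\in Y$. A strongly continuous $(R_{2}(t))_{t\ge 0}\subseteq L(X)$ is a mild $(a,k)$-regularized $C_{2}$-uniqueness family with a subgenerator $\mathcal{M}$ if $\int_{0}^{t}a(t-s)R_{2}(s)y\,ds=R_{2}(t)x-k(t)C_{2}x$ for all $t\geq 0$ and $(x,y)\in\mathcal{M}$. The pair $(R_{1}(t),R_{2}(t))_{t\ge0}$ is a mild $(a,k)$-regularized $(C_{1},C_{2})$-existence and uniqueness family with a subgenerator $\mathcal{M}$ if both conditions hold. No injectivity of $C_1,C_2$ is assumed. *)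

theory Defs
  imports "HOL-Analysis.Analysis"
begin

section \<open>Sequentially complete locally convex spaces over the complex field\<close>

text \<open>
  The real scalar multiplication is carried along, so that complex spaces are instances of
  the library class \<open>real_vector\<close> (needed for integrals of simple functions).
\<close>

class scaleC = scaleR +
  fixes scaleC :: "complex \<Rightarrow> 'a \<Rightarrow> 'a" (infixr \<open>*\<^sub>C\<close> 75)
  assumes scaleR_scaleC: "scaleR r = scaleC (complex_of_real r)"

class complex_vector = scaleC + ab_group_add +
  assumes scaleC_add_right: "a *\<^sub>C (x + y) = a *\<^sub>C x + a *\<^sub>C y"
    and scaleC_add_left: "(a + b) *\<^sub>C x = a *\<^sub>C x + b *\<^sub>C x"
    and scaleC_scaleC: "a *\<^sub>C b *\<^sub>C x = (a * b) *\<^sub>C x"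
    and scaleC_one: "1 *\<^sub>C x = x"

subclass (in complex_vector) real_vector
  by standard (simp_all add: scaleR_scaleC scaleC_add_right scaleC_add_left scaleC_scaleC scaleC_one)

global_interpretation complex_vector: vector_space "scaleC :: complex \<Rightarrow> 'a \<Rightarrow> 'a::complex_vector"
  by unfold_locales (simp_all add: scaleC_add_right scaleC_add_left scaleC_scaleC scaleC_one)

definition (in complex_vector) cseminorm :: "('a \<Rightarrow> real) \<Rightarrow> bool" where
  "cseminorm p \<longleftrightarrow>
     (\<forall>x y. p (x + y) \<le> p x + p y) \<and> (\<forall>c x. p (c *\<^sub>C x) = cmod c * p x)"

text \<open>Hausdorff locally convex spaces: the topology is generated by some family of seminorms.\<close>

class complex_lcs = complex_vector + t2_space +
  assumes seminorm_topology:
    "\<exists>P. (\<forall>p\<in>P. cseminorm p) \<and>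
         (\<forall>U. open U \<longleftrightarrow>
            (\<forall>x\<in>U. \<exists>F e. finite F \<and> F \<subseteq> P \<and> e > 0 \<and> {y. \<forall>p\<in>F. p (y - x) < e} \<subseteq> U))"

definition (in complex_lcs) lcs_Cauchy :: "(nat \<Rightarrow> 'a) \<Rightarrow> bool" where
  "lcs_Cauchy s \<longleftrightarrow> (\<forall>U. open U \<and> 0 \<in> U \<longrightarrow> (\<exists>N. \<forall>m\<ge>N. \<forall>n\<ge>N. s m - s n \<in> U))"

class seq_complete_lcs = complex_lcs +
  assumes lcs_Cauchy_convergent: "lcs_Cauchy s \<Longrightarrow> convergent s"


section \<open>Continuous linear operators\<close>

definition continuous_linear_ops :: "('y::complex_lcs \<Rightarrow> 'x::complex_lcs) set" where
  "continuous_linear_ops = {T. Vector_Spaces.linear scaleC scaleC T \<and> continuous_on UNIV T}"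

definition equicontinuous_ops :: "('y::complex_lcs \<Rightarrow> 'x::complex_lcs) set \<Rightarrow> bool" where
  "equicontinuous_ops \<F> \<longleftrightarrow>
     (\<forall>U. open U \<and> 0 \<in> U \<longrightarrow> (\<exists>V. open V \<and> 0 \<in> V \<and> (\<forall>T\<in>\<F>. T ` V \<subseteq> U)))"

text \<open>Operator families are indexed by \<open>real\<close>; only the values at \<open>t \<ge> 0\<close> are ever used.\<close>

definition strongly_continuous_family :: "(real \<Rightarrow> 'y::complex_lcs \<Rightarrow> 'x::complex_lcs) \<Rightarrow> bool" where
  "strongly_continuous_family R \<longleftrightarrow>
     (\<forall>t\<ge>0. R t \<in> continuous_linear_ops) \<and> (\<forall>y. continuous_on {0..} (\<lambda>t. R t y))"


section \<open>Multivalued linear operators\<close>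

text \<open>
  A multivalued map \<open>\<A>\<close> is identified with its graph, so \<open>\<A> x\<close> is \<open>\<A> `` {x}\<close>, and domain, range
  and inverse are \<^const>\<open>Domain\<close>, \<^const>\<open>Range\<close> and \<^const>\<open>converse\<close>. It is closed if it is a
  closed subset of the product space.
\<close>

definition MLO :: "('x::complex_vector \<times> 'x) set \<Rightarrow> bool" where
  "MLO \<A> \<longleftrightarrow>
     module.subspace scaleC (Domain \<A>) \<and>
     (\<forall>x\<in>Domain \<A>. \<forall>y\<in>Domain \<A>. {u + v |u v. u \<in> \<A> `` {x} \<and> v \<in> \<A> `` {y}} \<subseteq> \<A> `` {x + y}) \<and>
     (\<forall>c. \<forall>x\<in>Domain \<A>. scaleC c ` (\<A> `` {x}) \<subseteq> \<A> `` {c *\<^sub>C x})"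

text \<open>The relation \<open>c - \<A>\<close>, i.e. \<open>(c - \<A>) x = {c x - u | u \<in> \<A> x}\<close>.\<close>

definition scalar_minus :: "complex \<Rightarrow> ('x::complex_vector \<times> 'x) set \<Rightarrow> ('x \<times> 'x) set" where
  "scalar_minus c \<A> = {(x, c *\<^sub>C x - u) |x u. (x, u) \<in> \<A>}"


section \<open>Integration in locally convex spaces\<close>

text \<open>
  The Bochner integral as in \<^const>\<open>has_bochner_integral\<close>, with all continuous seminorms in
  place of the norm: one sequence of simple functions approximates the function in the mean with
  respect to every continuous seminorm.
\<close>

definition has_lcs_integral :: "'m measure \<Rightarrow> ('m \<Rightarrow> 'x::complex_lcs) \<Rightarrow> 'x \<Rightarrow> bool" where
  "has_lcs_integral M f z \<longleftrightarrow>
     (\<exists>s. (\<forall>n. Bochner_Integration.simple_bochner_integrable M (s n)) \<and>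
          (\<forall>p. cseminorm p \<and> continuous_on UNIV p \<longrightarrow>
             (\<forall>n. (\<lambda>t. p (f t - s n t)) \<in> borel_measurable M) \<and>
             (\<lambda>n. \<integral>\<^sup>+ t. ennreal (p (f t - s n t)) \<partial>M) \<longlonglongrightarrow> 0) \<and>
          (\<lambda>n. Bochner_Integration.simple_bochner_integral M (s n)) \<longlonglongrightarrow> z)"

definition lcs_integral :: "'m measure \<Rightarrow> ('m \<Rightarrow> 'x::complex_lcs) \<Rightarrow> 'x" where
  "lcs_integral M f = (if \<exists>z. has_lcs_integral M f z then THE z. has_lcs_integral M f z else 0)"

definition convolution :: "(real \<Rightarrow> complex) \<Rightarrow> (real \<Rightarrow> 'x::complex_lcs) \<Rightarrow> real \<Rightarrow> 'x" where
  "convolution a f t = lcs_integral (lebesgue_on {0..t}) (\<lambda>s. a (t - s) *\<^sub>C f s)"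

text \<open>
  The integral over \<open>[0, \<infinity>)\<close> is improper, because \<open>\<integral> e\<^sup>-\<^sup>\<mu>\<^sup>t k(t) dt\<close> need not converge absolutely.
\<close>

definition lcs_laplace :: "(real \<Rightarrow> 'x::complex_lcs) \<Rightarrow> complex \<Rightarrow> 'x" where
  "lcs_laplace f \<mu> =
     Lim at_top (\<lambda>b. lcs_integral (lebesgue_on {0..b}) (\<lambda>t. exp (- (\<mu> * of_real t)) *\<^sub>C f t))"


section \<open>The scalar Laplace transform\<close>

definition locally_integrable :: "(real \<Rightarrow> complex) \<Rightarrow> bool" where
  "locally_integrable k \<longleftrightarrow> (\<forall>b\<ge>0. integrable (lebesgue_on {0..b}) k)"

definition laplace_partial :: "(real \<Rightarrow> complex) \<Rightarrow> complex \<Rightarrow> real \<Rightarrow> complex" where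
  "laplace_partial k \<mu> b = (\<integral>t. exp (- (\<mu> * of_real t)) * k t \<partial>(lebesgue_on {0..b}))"

definition laplace_exists :: "(real \<Rightarrow> complex) \<Rightarrow> complex \<Rightarrow> bool" where
  "laplace_exists k \<mu> \<longleftrightarrow> (\<exists>L. (laplace_partial k \<mu> \<longlongrightarrow> L) at_top)"

definition laplace :: "(real \<Rightarrow> complex) \<Rightarrow> complex \<Rightarrow> complex" where
  "laplace k \<mu> = Lim at_top (laplace_partial k \<mu>)"

definition P1 :: "(real \<Rightarrow> complex) \<Rightarrow> bool" where
  "P1 k \<longleftrightarrow> locally_integrable k \<and> (\<exists>\<beta>::real. \<forall>\<mu>. Re \<mu> > \<beta> \<longrightarrow> laplace_exists k \<mu>)"

text \<open>The abscissa of convergence; it may be \<open>-\<infinity>\<close>.\<close>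

definition laplace_abs :: "(real \<Rightarrow> complex) \<Rightarrow> ereal" where
  "laplace_abs k = (INF \<mu>\<in>{\<mu>. laplace_exists k \<mu>}. ereal (Re \<mu>))"


section \<open>Regularized existence and uniqueness families\<close>

definition mild_existence_family ::
  "(real \<Rightarrow> complex) \<Rightarrow> (real \<Rightarrow> complex) \<Rightarrow> ('y::complex_lcs \<Rightarrow> 'x::complex_lcs) \<Rightarrow>
   (real \<Rightarrow> 'y \<Rightarrow> 'x) \<Rightarrow> ('x \<times> 'x) set \<Rightarrow> bool" where
  "mild_existence_family a k C\<^sub>1 R\<^sub>1 \<M> \<longleftrightarrow>
     strongly_continuous_family R\<^sub>1 \<and>
     (\<forall>t\<ge>0. \<forall>y. (convolution a (\<lambda>s. R\<^sub>1 s y) t, R\<^sub>1 t y - k t *\<^sub>C C\<^sub>1 y) \<in> \<M>)"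

definition mild_uniqueness_family ::
  "(real \<Rightarrow> complex) \<Rightarrow> (real \<Rightarrow> complex) \<Rightarrow> ('x::complex_lcs \<Rightarrow> 'x) \<Rightarrow>
   (real \<Rightarrow> 'x \<Rightarrow> 'x) \<Rightarrow> ('x \<times> 'x) set \<Rightarrow> bool" where
  "mild_uniqueness_family a k C\<^sub>2 R\<^sub>2 \<M> \<longleftrightarrow>
     strongly_continuous_family R\<^sub>2 \<and>
     (\<forall>t\<ge>0. \<forall>(x, y)\<in>\<M>. convolution a (\<lambda>s. R\<^sub>2 s y) t = R\<^sub>2 t x - k t *\<^sub>C C\<^sub>2 x)"

definition mild_existence_uniqueness_family ::
  "(real \<Rightarrow> complex) \<Rightarrow> (real \<Rightarrow> complex) \<Rightarrow> ('y::complex_lcs \<Rightarrow> 'x::complex_lcs) \<Rightarrow> ('x \<Rightarrow> 'x) \<Rightarrow>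
   (real \<Rightarrow> 'y \<Rightarrow> 'x) \<Rightarrow> (real \<Rightarrow> 'x \<Rightarrow> 'x) \<Rightarrow> ('x \<times> 'x) set \<Rightarrow> bool" where
  "mild_existence_uniqueness_family a k C\<^sub>1 C\<^sub>2 R\<^sub>1 R\<^sub>2 \<M> \<longleftrightarrow>
     mild_existence_family a k C\<^sub>1 R\<^sub>1 \<M> \<and> mild_uniqueness_family a k C\<^sub>2 R\<^sub>2 \<M>"

definition cond_E ::
  "(real \<Rightarrow> complex) \<Rightarrow> (real \<Rightarrow> complex) \<Rightarrow> ('y::complex_lcs \<Rightarrow> 'x::complex_lcs) \<Rightarrow>
   (real \<Rightarrow> 'y \<Rightarrow> 'x) \<Rightarrow> ('x \<times> 'x) set \<Rightarrow> complex \<Rightarrow> bool" where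
  "cond_E a k C\<^sub>1 R\<^sub>1 \<A> \<mu> \<longleftrightarrow>
     (\<forall>y. (laplace a \<mu> * laplace k \<mu>) *\<^sub>C C\<^sub>1 y
            \<in> scalar_minus (laplace a \<mu>) \<A> `` {lcs_laplace (\<lambda>t. k t *\<^sub>C C\<^sub>1 y - R\<^sub>1 t y) \<mu>})"

definition cond_U ::
  "(real \<Rightarrow> complex) \<Rightarrow> (real \<Rightarrow> complex) \<Rightarrow> ('x::complex_lcs \<Rightarrow> 'x) \<Rightarrow>
   (real \<Rightarrow> 'x \<Rightarrow> 'x) \<Rightarrow> ('x \<times> 'x) set \<Rightarrow> complex \<Rightarrow> bool" where
  "cond_U a k C\<^sub>2 R\<^sub>2 \<A> \<mu> \<longleftrightarrow>
     (\<forall>(y, x)\<in>\<A>. laplace k \<mu> *\<^sub>C C\<^sub>2 x =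
        lcs_laplace (\<lambda>t. R\<^sub>2 t x - convolution a (\<lambda>s. R\<^sub>2 s y) t) \<mu>)"

end

theory Submission
  imports Defs "HOL-Complex_Analysis.Complex_Analysis"
begin

text \<open>
  By the Hahn-Banach theorem, membership in a closed multivalued linear operator and equality of
  vectors can be tested with continuous linear functionals, and these commute with the integral.
  For functionals \<open>\<phi>\<close>, \<open>\<psi>\<close> with \<open>\<phi> x + \<psi> y = 0\<close> on \<open>\<A>\<close>, the scalar function
  \<open>d(t) = \<phi> (R\<^sub>1(t)y - k(t)C\<^sub>1y) + \<psi> ((a * R\<^sub>1 y)(t))\<close> vanishes for all such pairs exactly if the
  existence identity holds at \<open>t\<close>, and its Laplace transform vanishes for all such pairs exactly if (E)
  holds; (U) is treated in the same way. Since \<open>a\<close> and \<open>k\<close> are not zero, their transforms have only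
  countably many real zeros in the half-plane, so (E) and (U) are available along some arithmetic
  progression \<open>c, c + 1, c + 2, \<dots>\<close>, and by Weierstrass approximation (Lerch) a continuous function
  whose transform vanishes there is zero.
\<close>

section \<open>The Hahn-Banach theorem\<close>

text \<open>The transform of \<open>k\<close> may converge only conditionally, so neither dominated
  convergence nor Fubini applies to it directly. Integration by parts rewrites it through an
  absolutely convergent transform of the bounded continuous function
  \<open>laplace_partial k \<mu>\<^sub>0\<close>, and there holomorphy and the Lerch argument become
  available. The other data behave better: equicontinuity bounds the orbits by multiples of
  \<open>exp (\<omega> * t)\<close>, and (P1) for the modulus of \<open>a\<close> makes its
  transform absolutely convergent to the right of \<omega>, so the product formula for convolutions
  is Fubini. For (E), let Z be the transform of
  \<open>k t *\<^sub>C C\<^sub>1 y - R\<^sub>1 t y\<close> and W = \<open>laplace a \<mu> *\<^sub>C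
  Z - (laplace a \<mu> * laplace k \<mu>) *\<^sub>C C\<^sub>1 y\<close>. Then (E) says (Z, W) \<in>
  \<A>, and d has the transform -(\<phi> Z + \<psi> W); hence the same pairs test both sides. The
  range condition follows from (E) on dividing by the nonzero scalar. At zeros of the transforms,
  (U) is recovered by passing through the family itself.\<close>

definition sublinear :: "('a::real_vector \<Rightarrow> real) \<Rightarrow> bool" where
  "sublinear p \<longleftrightarrow> (\<forall>x y. p (x + y) \<le> p x + p y) \<and> (\<forall>c\<ge>0. \<forall>x. p (c *\<^sub>R x) = c * p x)"

lemma sublinear_zero: "sublinear p \<Longrightarrow> p 0 = 0"
  unfolding sublinear_def by (metis mult_zero_left order_refl scaleR_zero_left)

lemma sublinear_add: "sublinear p \<Longrightarrow> p (x + y) \<le> p x + p y"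
  by (simp add: sublinear_def)

lemma sublinear_neg: "sublinear p \<Longrightarrow> - p (- x) \<le> p x"
  using sublinear_zero[of p] sublinear_add[of p x "- x"] by simp

text \<open>A pointwise infimum of sublinear functionals need not be subadditive. In a chain,
  near-minimisers at x and at y have a common member below both, and its subadditivity gives the
  estimate. The bound q x \<ge> - q (- x) \<ge> - p (- x) keeps the infimum finite.\<close>

lemma sublinear_Inf_chain:
  assumes "C \<noteq> {}" and sub: "\<And>q. q \<in> C \<Longrightarrow> sublinear q"
    and chain: "\<And>q r. q \<in> C \<Longrightarrow> r \<in> C \<Longrightarrow> (\<forall>x. q x \<le> r x) \<or> (\<forall>x. r x \<le> q x)"
    and below: "\<And>q x. q \<in> C \<Longrightarrow> q x \<le> p x"
  shows "sublinear (\<lambda>x. INF q\<in>C. q x)" "\<And>q x. q \<in> C \<Longrightarrow> (INF q\<in>C. q x) \<le> q x"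
proof -
  have bdd: "bdd_below ((\<lambda>q. q x) ` C)" for x
  proof (rule bdd_belowI[of _ "- p (- x)"])
    fix v assume "v \<in> (\<lambda>q. q x) ` C"
    then obtain q where "q \<in> C" "v = q x" by auto
    then show "- p (- x) \<le> v"
      using sublinear_neg[OF sub, of q x] below[of q "- x"] by simp
  qed
  show le: "(INF q\<in>C. q x) \<le> q x" if "q \<in> C" for q x
    by (rule cINF_lower[OF bdd that])
  have add: "(INF q\<in>C. q (x + y)) \<le> (INF q\<in>C. q x) + (INF q\<in>C. q y)" for x y
  proof (rule field_le_epsilon)
    fix e :: real assume "e > 0"
    then obtain q r where q: "q \<in> C" "q x < (INF q\<in>C. q x) + e/2"
      and r: "r \<in> C" "r y < (INF q\<in>C. q y) + e/2"
      using cINF_less_iff[OF \<open>C \<noteq> {}\<close> bdd, of x "(INF q\<in>C. q x) + e/2"]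
        cINF_less_iff[OF \<open>C \<noteq> {}\<close> bdd, of y "(INF q\<in>C. q y) + e/2"] by auto
    obtain s where s: "s \<in> C" "s x \<le> q x" "s y \<le> r y"
      using chain[OF q(1) r(1)] q(1) r(1) by (metis order_refl)
    have "(INF q\<in>C. q (x + y)) \<le> s x + s y"
      using le[OF s(1), of "x + y"] sub[OF s(1)] unfolding sublinear_def by (meson order_trans)
    with s q r show "(INF q\<in>C. q (x + y)) \<le> (INF q\<in>C. q x) + (INF q\<in>C. q y) + e"
      by linarith
  qed
  have scale_le: "(INF q\<in>C. q (c *\<^sub>R x)) \<ge> c * (INF q\<in>C. q x)" if "c \<ge> 0" for c x
  proof (rule cINF_greatest[OF \<open>C \<noteq> {}\<close>])
    fix q assume "q \<in> C"
    then show "c * (INF q\<in>C. q x) \<le> q (c *\<^sub>R x)"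
      using le[of q x] sub[of q] that by (simp add: sublinear_def mult_left_mono)
  qed
  have "(INF q\<in>C. q (c *\<^sub>R x)) = c * (INF q\<in>C. q x)" if "c \<ge> 0" for c x
  proof (cases "c = 0")
    case True
    then show ?thesis using \<open>C \<noteq> {}\<close> by (simp add: sublinear_zero[OF sub] cong: INF_cong)
  next
    case False
    \<comment> \<open>\<open>scale_le\<close> is one inequality; used with \<open>inverse c\<close>
      at the point \<open>c *\<^sub>R x\<close> it yields the reverse one.\<close>
    then have "(INF q\<in>C. q x) \<ge> inverse c * (INF q\<in>C. q (c *\<^sub>R x))"
      using scale_le[of "inverse c" "c *\<^sub>R x"] that by simp
    then have "(INF q\<in>C. q (c *\<^sub>R x)) \<le> c * (INF q\<in>C. q x)"
      using False that by (simp add: field_simps)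
    then show ?thesis using scale_le[OF that, of x] by simp
  qed
  then show "sublinear (\<lambda>x. INF q\<in>C. q x)"
    using add by (simp add: sublinear_def)
qed

text \<open>This lowers p as far as possible without losing any linear f \<le> p with f z = p z:
  such an f satisfies f y = f (y + t z) - t p z, which is at most every term of the infimum. Taking
  t = 1 at - z gives the bound - p z.\<close>

lemma sublinear_shift:
  fixes p :: "'a::real_vector \<Rightarrow> real" and z :: 'a
  assumes p: "sublinear p"
  defines "p' \<equiv> \<lambda>y. INF t\<in>{0..}. p (y + t *\<^sub>R z) - t * p z"
  shows "sublinear p'" "p' x \<le> p x" "p' (- z) \<le> - p z"
proof -
  have bdd: "bdd_below ((\<lambda>t. p (y + t *\<^sub>R z) - t * p z) ` {0..})" for y
  proof (rule bdd_belowI[of _ "- p (- y)"])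
    fix v assume "v \<in> (\<lambda>t. p (y + t *\<^sub>R z) - t * p z) ` {0..}"
    then obtain t where t: "t \<ge> 0" "v = p (y + t *\<^sub>R z) - t * p z" by auto
    have "p (t *\<^sub>R z) \<le> p (y + t *\<^sub>R z) + p (- y)"
      using p[unfolded sublinear_def, THEN conjunct1, rule_format, of "y + t *\<^sub>R z" "- y"] by simp
    then show "- p (- y) \<le> v" using p t by (simp add: sublinear_def)
  qed
  have p'_eq: "p' y = (INF t\<in>{0..}. p (y + t *\<^sub>R z) - t * p z)" for y
    by (simp add: p'_def)
  have le: "p' y \<le> p (y + t *\<^sub>R z) - t * p z" if "t \<ge> 0" for t y
    unfolding p'_def using that by (intro cINF_lower[OF bdd]) auto
  show "p' x \<le> p x" using le[of 0 x] by simp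
  show "p' (- z) \<le> - p z" using le[of 1 "- z"] sublinear_zero[OF p] by simp
  have less: "\<exists>t\<ge>0. p (y + t *\<^sub>R z) - t * p z < p' y + e" if "e > 0" for y e
    using cINF_less_iff[OF _ bdd, of y "p' y + e"] that by (auto simp: p'_def)
  have add: "p' (x + y) \<le> p' x + p' y" for x y
  proof (rule field_le_epsilon)
    fix e :: real assume "e > 0"
    then obtain s t where s: "s \<ge> 0" "p (x + s *\<^sub>R z) - s * p z < p' x + e/2"
      and t: "t \<ge> 0" "p (y + t *\<^sub>R z) - t * p z < p' y + e/2"
      using less[of "e/2" x] less[of "e/2" y] by auto
    have "(x + s *\<^sub>R z) + (y + t *\<^sub>R z) = x + y + (s + t) *\<^sub>R z"
      by (simp add: scaleR_add_left)
    then have "p (x + y + (s + t) *\<^sub>R z) \<le> p (x + s *\<^sub>R z) + p (y + t *\<^sub>R z)"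
      using p unfolding sublinear_def by metis
    then show "p' (x + y) \<le> p' x + p' y + e"
      using le[of "s + t" "x + y"] s t by (simp add: algebra_simps)
  qed
  have scale_le: "p' (c *\<^sub>R y) \<ge> c * p' y" if "c > 0" for c y
    unfolding p'_eq[of "c *\<^sub>R y"]
  proof (rule cINF_greatest)
    show "{0::real..} \<noteq> {}" by simp
    fix t :: real assume t: "t \<in> {0..}"
    have eq: "c *\<^sub>R y + t *\<^sub>R z = c *\<^sub>R (y + (t / c) *\<^sub>R z)"
      using that by (simp add: scaleR_add_right)
    have "p (c *\<^sub>R y + t *\<^sub>R z) - t * p z = c * (p (y + (t / c) *\<^sub>R z) - (t / c) * p z)"
      unfolding eq using p that by (simp add: sublinear_def right_diff_distrib)
    then show "c * p' y \<le> p (c *\<^sub>R y + t *\<^sub>R z) - t * p z"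
      using le[of "t / c" y] that t by simp
  qed
  have "p' (c *\<^sub>R y) = c * p' y" if "c \<ge> 0" for c y
  proof (cases "c = 0")
    case True
    have "p' 0 \<le> 0" using le[of 0 0] sublinear_zero[OF p] by simp
    moreover have "p' 0 \<ge> 0"
      unfolding p'_def by (rule cINF_greatest) (use p in \<open>auto simp: sublinear_def\<close>)
    ultimately show ?thesis using True by simp
  next
    case False
    then have "p' y \<ge> inverse c * p' (c *\<^sub>R y)"
      using scale_le[of "inverse c" "c *\<^sub>R y"] that by simp
    then have "p' (c *\<^sub>R y) \<le> c * p' y"
      using False that by (simp add: field_simps)
    then show ?thesis using scale_le[of c y] that False by simp
  qed
  then show "sublinear p'" using add by (simp add: sublinear_def)
qed

text \<open>By \<open>sublinear_shift\<close>, a minimal sublinear functional \<open>q\<close> satisfies \<open>q (- z) \<le> - q z\<close> and is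
  therefore linear; Zorn's lemma provides minimal elements.\<close>

theorem hahn_banach:
  assumes p: "sublinear p"
  obtains f where "linear f" "\<And>x. f x \<le> p x" "f z = p z"
proof -
  \<comment> \<open>Running Zorn below \<open>p0\<close> instead of p fixes the value at z: f \<le>
    \<open>p0\<close> gives f (- z) \<le> - p z, that is, f z \<ge> p z for linear f.\<close>
  define p0 where "p0 = (\<lambda>y. INF t\<in>{0..}. p (y + t *\<^sub>R z) - t * p z)"
  have p0: "sublinear p0" "\<And>x. p0 x \<le> p x" "p0 (- z) \<le> - p z"
    unfolding p0_def by (fact sublinear_shift[OF p])+
  define A where "A = {q. sublinear q \<and> (\<forall>x. q x \<le> p0 x)}"
  \<comment> \<open>The order is reversed, so that the maximal element delivered by Zorn is a
    minimal functional.\<close>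
  define P where "P = (\<lambda>q r :: 'a \<Rightarrow> real. \<forall>x. r x \<le> q x)"
  have "\<exists>m\<in>A. \<forall>a\<in>A. P m a \<longrightarrow> a = m"
  proof (rule predicate_Zorn)
    show "partial_order_on A (relation_of P A)"
      by (rule partial_order_on_relation_ofI)
        (auto simp: P_def fun_eq_iff intro: order_trans antisym)
    fix C assume C: "C \<in> Chains (relation_of P A)"
    then have CA: "C \<subseteq> A" by (auto simp: Chains_def relation_of_def)
    show "\<exists>u\<in>A. \<forall>a\<in>C. P a u"
    proof (cases "C = {}")
      case True
      then show ?thesis using p0(1) by (auto simp: A_def)
    next
      case False
      have ch: "(\<forall>x. q x \<le> r x) \<or> (\<forall>x. r x \<le> q x)" if "q \<in> C" "r \<in> C" for q r
        using C that by (auto simp: Chains_def relation_of_def P_def)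
      have sub: "sublinear q" if "q \<in> C" for q using that CA by (auto simp: A_def)
      have bel: "q x \<le> p0 x" if "q \<in> C" for q x using that CA by (auto simp: A_def)
      have inf: "sublinear (\<lambda>x. INF q\<in>C. q x)"
        by (rule sublinear_Inf_chain(1)[of C p0]) (use False sub ch bel in blast)+
      have inf_le: "(INF q\<in>C. q x) \<le> q x" if "q \<in> C" for q x
        by (rule sublinear_Inf_chain(2)[of C p0]) (use False sub ch bel that in blast)+
      show ?thesis
      proof (rule bexI[of _ "\<lambda>x. INF q\<in>C. q x"])
        show "\<forall>a\<in>C. P a (\<lambda>x. INF q\<in>C. q x)" using inf_le by (auto simp: P_def)
        obtain q where "q \<in> C" using False by auto
        then show "(\<lambda>x. INF q\<in>C. q x) \<in> A"
          using inf inf_le bel unfolding A_def by (blast intro: order_trans)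
      qed
    qed
  qed
  then obtain f where f: "f \<in> A" "\<And>a. a \<in> A \<Longrightarrow> P f a \<Longrightarrow> a = f" by blast
  have sub: "sublinear f" using f by (simp add: A_def)
  have neg: "f (- x) = - f x" for x
  proof -
    define f' where "f' = (\<lambda>y. INF t\<in>{0..}. f (y + t *\<^sub>R x) - t * f x)"
    have f': "sublinear f'" "\<And>x. f' x \<le> f x" "f' (- x) \<le> - f x"
      unfolding f'_def by (fact sublinear_shift[OF sub])+
    have "f' = f"
      using f' f(1) by (intro f(2)) (auto simp: A_def P_def intro: order_trans)
    then show ?thesis using f'(3) sublinear_neg[OF sub, of x] by simp
  qed
  have add: "f (x + y) = f x + f y" for x y
  proof (rule antisym)
    show "f (x + y) \<le> f x + f y" using sub by (simp add: sublinear_def)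
    have "f (- x + - y) \<le> f (- x) + f (- y)" using sub unfolding sublinear_def by blast
    then show "f x + f y \<le> f (x + y)" using neg[of x] neg[of y] neg[of "x + y"] by simp
  qed
  have "linear f"
  proof (rule linearI[OF add])
    fix r x
    show "f (r *\<^sub>R x) = r *\<^sub>R f x"
    proof (cases "r \<ge> 0")
      case True
      then show ?thesis using sub by (simp add: sublinear_def)
    next
      case False
      then have "f ((- r) *\<^sub>R x) = (- r) * f x" using sub unfolding sublinear_def by (metis neg_0_le_iff_le le_cases)
      then show ?thesis using neg[of "r *\<^sub>R x"] by simp
    qed
  qed
  moreover have "f x \<le> p x" for x
    using f(1) p0(2) by (auto simp: A_def intro: order_trans)
  moreover have "f z = p z"
  proof -
    have "f (- z) \<le> - p z" using f(1) p0(3) by (auto simp: A_def intro: order_trans)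
    then show ?thesis using neg[of z] calculation(2)[of z] by simp
  qed
  ultimately show thesis by (rule that)
qed

section \<open>Complex functionals and seminorms; the complex Hahn-Banach theorem\<close>

definition cfunctional :: "('a::complex_vector \<Rightarrow> complex) \<Rightarrow> bool" where
  "cfunctional \<phi> \<longleftrightarrow> (\<forall>x y. \<phi> (x + y) = \<phi> x + \<phi> y) \<and> (\<forall>c x. \<phi> (c *\<^sub>C x) = c * \<phi> x)"

lemma cfunctional_add: "cfunctional \<phi> \<Longrightarrow> \<phi> (x + y) = \<phi> x + \<phi> y"
  and cfunctional_scaleC: "cfunctional \<phi> \<Longrightarrow> \<phi> (c *\<^sub>C x) = c * \<phi> x"
  by (auto simp: cfunctional_def)

lemma cfunctional_zero: "cfunctional \<phi> \<Longrightarrow> \<phi> 0 = 0"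
  using cfunctional_add[of \<phi> 0 0] by simp

lemma cfunctional_minus: "cfunctional \<phi> \<Longrightarrow> \<phi> (- x) = - \<phi> x"
  using cfunctional_add[of \<phi> x "- x"] by (simp add: cfunctional_zero add_eq_0_iff)

lemma cfunctional_diff: "cfunctional \<phi> \<Longrightarrow> \<phi> (x - y) = \<phi> x - \<phi> y"
  using cfunctional_add[of \<phi> x "- y"] by (simp add: cfunctional_minus)

lemma cfunctional_linear: "cfunctional \<phi> \<Longrightarrow> linear \<phi>"
  by (intro linearI) (auto simp: cfunctional_add cfunctional_scaleC scaleR_scaleC scaleR_conv_of_real)

lemma cseminorm_triangle: "cseminorm p \<Longrightarrow> p (x + y) \<le> p x + p y"
  and cseminorm_scaleC: "cseminorm p \<Longrightarrow> p (c *\<^sub>C x) = cmod c * p x"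
  by (auto simp: cseminorm_def)

lemma cseminorm_scaleR: "cseminorm p \<Longrightarrow> p (r *\<^sub>R x) = \<bar>r\<bar> * p x"
  by (simp add: scaleR_scaleC cseminorm_scaleC)

lemma cseminorm_zero: "cseminorm p \<Longrightarrow> p 0 = 0"
  using cseminorm_scaleC[of p 0 0] by simp

lemma cseminorm_minus: "cseminorm p \<Longrightarrow> p (- x) = p x"
  using cseminorm_scaleR[of p "-1" x] by simp

lemma cseminorm_minus_commute: "cseminorm p \<Longrightarrow> p (x - y) = p (y - x)"
  using cseminorm_minus[of p "x - y"] by simp

lemma cseminorm_nonneg: "cseminorm p \<Longrightarrow> 0 \<le> p x"
  using cseminorm_triangle[of p x "- x"] by (simp add: cseminorm_zero cseminorm_minus)

lemma cseminorm_diff_triangle: "cseminorm p \<Longrightarrow> \<bar>p x - p y\<bar> \<le> p (x - y)"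
  using cseminorm_triangle[of p "x - y" y] cseminorm_triangle[of p "y - x" x]
  by (simp add: cseminorm_minus_commute[of p x y])

lemma cseminorm_cmod_cfunctional: "cfunctional \<phi> \<Longrightarrow> cseminorm (\<lambda>x. cmod (\<phi> x))"
  by (auto simp: cseminorm_def cfunctional_add cfunctional_scaleC norm_triangle_ineq norm_mult)

text \<open>A complex functional is determined by its real part f through \<phi> x = f x - \<i> f
  (\<i> x). The bound on f passes to the modulus of \<phi> by rotating x, which does not change p
  x.\<close>

theorem hahn_banach_complex:
  fixes p :: "'a::complex_vector \<Rightarrow> real"
  assumes p: "cseminorm p"
  obtains \<phi> where "cfunctional \<phi>" "\<And>x. cmod (\<phi> x) \<le> p x" "\<phi> z = p z"
proof -
  have "sublinear p"
    using p by (auto simp: sublinear_def cseminorm_triangle cseminorm_scaleR)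
  then obtain f where f: "linear f" "\<And>x. f x \<le> p x" "f z = p z"
    using hahn_banach[of p z] by blast
  interpret f: linear f by fact
  define \<phi> where "\<phi> x = Complex (f x) (- f (\<i> *\<^sub>C x))" for x
  have scale: "f (c *\<^sub>C x) = Re c * f x + Im c * f (\<i> *\<^sub>C x)" for c x
  proof -
    have "c *\<^sub>C x = Re c *\<^sub>R x + Im c *\<^sub>R (\<i> *\<^sub>C x)"
      by (subst complex_eq[of c]) (simp only: scaleR_scaleC scaleC_scaleC scaleC_add_left mult.commute)
    then show ?thesis by (simp add: f.add f.scale)
  qed
  have "cfunctional \<phi>"
    unfolding cfunctional_def
  proof (intro conjI allI)
    show "\<phi> (x + y) = \<phi> x + \<phi> y" for x y
      by (simp add: \<phi>_def complex_eq_iff f.add scaleC_add_right)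
    show "\<phi> (c *\<^sub>C x) = c * \<phi> x" for c x
      using scale[of c x] scale[of "\<i> * c" x]
      by (simp add: \<phi>_def complex_eq_iff scaleC_scaleC)
  qed
  moreover have bound: "cmod (\<phi> x) \<le> p x" for x
  proof (cases "\<phi> x = 0")
    case True
    then show ?thesis using cseminorm_nonneg[OF p] by simp
  next
    case False
    \<comment> \<open>Unimodular c that rotates \<phi> x onto the nonnegative real axis, where
      \<phi> and f agree.\<close>
    define c where "c = cnj (\<phi> x) / cmod (\<phi> x)"
    have c: "cmod c = 1" using False by (simp add: c_def norm_divide)
    have "\<phi> (c *\<^sub>C x) = c * \<phi> x" using calculation by (rule cfunctional_scaleC)
    also have "\<dots> = cmod (\<phi> x)"
      using False complex_norm_square[of "\<phi> x"] by (simp add: c_def field_simps power2_eq_square)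
    finally have "cmod (\<phi> x) = f (c *\<^sub>C x)" by (simp add: \<phi>_def complex_eq_iff)
    also have "\<dots> \<le> p x" using f(2)[of "c *\<^sub>C x"] p c by (simp add: cseminorm_scaleC)
    finally show ?thesis .
  qed
  moreover have "\<phi> z = p z"
  proof -
    \<comment> \<open>The real part of \<phi> z is already p z, so the bound p z on the modulus
      leaves no room for an imaginary part.\<close>
    have "(p z)\<^sup>2 + (f (\<i> *\<^sub>C z))\<^sup>2 \<le> (p z)\<^sup>2"
      using power_mono[OF bound[of z], of 2] by (simp add: cmod_power2 \<phi>_def f(3))
    then show ?thesis by (simp add: \<phi>_def f(3) complex_eq_iff)
  qed
  ultimately show thesis by (rule that)
qed


section \<open>Seminorms and duality in locally convex spaces\<close>

abbreviation ccseminorm :: "('a::complex_lcs \<Rightarrow> real) \<Rightarrow> bool" where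
  "ccseminorm p \<equiv> cseminorm p \<and> continuous_on UNIV p"

text \<open>Continuity of subtraction is derived from this lemma later, so it cannot be used here.
  Instead a ball about 0, open by continuity of p, is moved to z through the translation-invariant
  form of the basic neighbourhoods.\<close>

lemma open_cseminorm_ball:
  fixes p :: "'a::complex_lcs \<Rightarrow> real"
  assumes p: "ccseminorm p"
  shows "open {y. p (y - x) < e}"
proof -
  from seminorm_topology[where 'a = 'a] obtain P :: "('a \<Rightarrow> real) set" where
    P': "(\<forall>p\<in>P. cseminorm p) \<and> (\<forall>U. open U \<longleftrightarrow>
          (\<forall>x\<in>U. \<exists>F e. finite F \<and> F \<subseteq> P \<and> e > 0 \<and> {y. \<forall>p\<in>F. p (y - x) < e} \<subseteq> U))" ..
  note P = spec[OF conjunct2[OF P']]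
  show ?thesis unfolding P
  proof
    fix z assume z: "z \<in> {y. p (y - x) < e}"
    have op: "open {y. p y < e - p (z - x)}"
      using p by (intro open_Collect_less) auto
    have mem: "0 \<in> {y. p y < e - p (z - x)}"
      using z p by (simp add: cseminorm_zero)
    from bspec[OF iffD1[OF P op] mem]
    obtain F d where F: "finite F" "F \<subseteq> P" "d > 0" "{y. \<forall>r\<in>F. r (y - 0) < d} \<subseteq> {y. p y < e - p (z - x)}"
      by blast
    have "{y. \<forall>r\<in>F. r (y - z) < d} \<subseteq> {y. p (y - x) < e}"
    proof
      fix y assume "y \<in> {y. \<forall>r\<in>F. r (y - z) < d}"
      then have "p (y - z) < e - p (z - x)" using F(4) by auto
      then show "y \<in> {y. p (y - x) < e}"
        using cseminorm_triangle[of p "y - z" "z - x"] p by simp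
    qed
    with F(1-3) show "\<exists>F d. finite F \<and> F \<subseteq> P \<and> d > 0 \<and> {y. \<forall>r\<in>F. r (y - z) < d} \<subseteq> {y. p (y - x) < e}"
      by (intro exI[of _ F] exI[of _ d]) simp
  qed
qed

text \<open>The finitely many seminorms of a basic neighbourhood are added and divided by its
  radius, so that one seminorm with its unit ball suffices. After this the generating family
  disappears and all estimates are made for arbitrary continuous seminorms.\<close>

lemma open_contains_cseminorm_ball:
  fixes U :: "'a::complex_lcs set"
  assumes "open U" "x \<in> U"
  obtains p where "ccseminorm p" "{y. p (y - x) < 1} \<subseteq> U"
proof -
  from seminorm_topology[where 'a = 'a] obtain P :: "('a \<Rightarrow> real) set" where
    P': "(\<forall>p\<in>P. cseminorm p) \<and> (\<forall>U. open U \<longleftrightarrow>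
          (\<forall>x\<in>U. \<exists>F e. finite F \<and> F \<subseteq> P \<and> e > 0 \<and> {y. \<forall>p\<in>F. p (y - x) < e} \<subseteq> U))" ..
  note sn = bspec[OF conjunct1[OF P']] and P = spec[OF conjunct2[OF P']]
  have cont: "continuous_on UNIV p" if "p \<in> P" for p
    unfolding continuous_on_open_vimage[OF open_UNIV]
  proof (intro allI impI)
    fix B :: "real set" assume "open B"
    show "open (p -` B \<inter> UNIV)" unfolding P
    proof
      fix z assume "z \<in> p -` B \<inter> UNIV"
      then obtain e where e: "e > 0" "ball (p z) e \<subseteq> B"
        using \<open>open B\<close> by (auto simp: open_contains_ball)
      have "{y. \<forall>r\<in>{p}. r (y - z) < e} \<subseteq> p -` B \<inter> UNIV"
      proof
        fix y assume "y \<in> {y. \<forall>r\<in>{p}. r (y - z) < e}"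
        then have "p y \<in> ball (p z) e"
          using cseminorm_diff_triangle[OF sn[OF that], of y z] by (simp add: dist_real_def)
        then show "y \<in> p -` B \<inter> UNIV" using e by auto
      qed
      then show "\<exists>F e. finite F \<and> F \<subseteq> P \<and> e > 0 \<and> {y. \<forall>p\<in>F. p (y - z) < e} \<subseteq> p -` B \<inter> UNIV"
        using that e by (intro exI[of _ "{p}"] exI[of _ e]) auto
    qed
  qed
  obtain F e where F: "finite F" "F \<subseteq> P" "e > 0" "{y. \<forall>p\<in>F. p (y - x) < e} \<subseteq> U"
    using bspec[OF iffD1[OF P \<open>open U\<close>] \<open>x \<in> U\<close>] by blast
  define q where "q y = (\<Sum>p\<in>F. p y) / e" for y
  have "cseminorm q"
    unfolding cseminorm_def q_def
  proof (intro conjI allI)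
    fix y z
    have "(\<Sum>p\<in>F. p (y + z)) \<le> (\<Sum>p\<in>F. p y) + (\<Sum>p\<in>F. p z)"
      unfolding sum.distrib[symmetric] using F(2) by (intro sum_mono cseminorm_triangle sn) auto
    then show "(\<Sum>p\<in>F. p (y + z)) / e \<le> (\<Sum>p\<in>F. p y) / e + (\<Sum>p\<in>F. p z) / e"
      using F(3) by (simp add: field_simps)
  next
    fix c y
    have "(\<Sum>p\<in>F. p (c *\<^sub>C y)) = cmod c * (\<Sum>p\<in>F. p y)"
      unfolding sum_distrib_left using F(2) by (intro sum.cong cseminorm_scaleC sn) auto
    then show "(\<Sum>p\<in>F. p (c *\<^sub>C y)) / e = cmod c * ((\<Sum>p\<in>F. p y) / e)" by simp
  qed
  moreover have "continuous_on UNIV q"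
    unfolding q_def using F by (intro continuous_intros cont) auto
  moreover have "{y. q (y - x) < 1} \<subseteq> U"
  proof
    fix y assume "y \<in> {y. q (y - x) < 1}"
    then have "(\<Sum>p\<in>F. p (y - x)) < e" using F(3) by (simp add: q_def)
    then have "p (y - x) < e" if "p \<in> F" for p
      using member_le_sum[OF that _ F(1), of "\<lambda>p. p (y - x)"] sn F(2)
      by (force intro: cseminorm_nonneg)
    then show "y \<in> U" using F(4) by auto
  qed
  ultimately show thesis using that by blast
qed

lemma tendsto_lcs_iff:
  fixes l :: "'a::complex_lcs"
  shows "(f \<longlongrightarrow> l) F \<longleftrightarrow> (\<forall>p. ccseminorm p \<longrightarrow> ((\<lambda>x. p (f x - l)) \<longlongrightarrow> 0) F)"
proof (intro iffI allI impI)
  fix p :: "'a \<Rightarrow> real" assume f: "(f \<longlongrightarrow> l) F" and p: "ccseminorm p"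
  show "((\<lambda>x. p (f x - l)) \<longlongrightarrow> 0) F"
  proof (rule tendstoI)
    fix e :: real assume "e > 0"
    then have "eventually (\<lambda>x. f x \<in> {y. p (y - l) < e}) F"
      using p by (intro topological_tendstoD[OF f] open_cseminorm_ball) (auto simp: cseminorm_zero)
    then show "eventually (\<lambda>x. dist (p (f x - l)) 0 < e) F"
      using p by (simp add: dist_real_def cseminorm_nonneg)
  qed
next
  assume R: "\<forall>p. ccseminorm p \<longrightarrow> ((\<lambda>x. p (f x - l)) \<longlongrightarrow> 0) F"
  show "(f \<longlongrightarrow> l) F"
  proof (rule topological_tendstoI)
    fix S assume "open S" "l \<in> S"
    then obtain p where p: "ccseminorm p" "{y. p (y - l) < 1} \<subseteq> S"
      using open_contains_cseminorm_ball by blast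
    have "eventually (\<lambda>x. p (f x - l) < 1) F"
      using R p by (intro order_tendstoD(2)) auto
    then show "eventually (\<lambda>x. f x \<in> S) F"
      by eventually_elim (use p in auto)
  qed
qed

text \<open>The class only asks for a topology generated by seminorms; continuity of addition and
  negation is a consequence, and with it the general limit and continuity rules for sums and
  differences apply.\<close>

instance complex_lcs \<subseteq> topological_ab_group_add
proof
  fix a b :: 'a
  have *: "(fst \<longlongrightarrow> a) (nhds a \<times>\<^sub>F nhds b)" "(snd \<longlongrightarrow> b) (nhds a \<times>\<^sub>F nhds b)"
    by (auto intro: filterlim_fst filterlim_snd)
  show "((\<lambda>x. fst x + snd x) \<longlongrightarrow> a + b) (nhds a \<times>\<^sub>F nhds b)"
    unfolding tendsto_lcs_iff
  proof (intro allI impI)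
    fix p :: "'a \<Rightarrow> real" assume p: "ccseminorm p"
    have "((\<lambda>x. p (fst x - a) + p (snd x - b)) \<longlongrightarrow> 0 + 0) (nhds a \<times>\<^sub>F nhds b)"
      using * p unfolding tendsto_lcs_iff by (intro tendsto_add) auto
    then have lim: "((\<lambda>x. p (fst x - a) + p (snd x - b)) \<longlongrightarrow> 0) (nhds a \<times>\<^sub>F nhds b)" by simp
    have "p (fst x + snd x - (a + b)) \<le> p (fst x - a) + p (snd x - b)" for x
      using p cseminorm_triangle[of p "fst x - a" "snd x - b"] by (simp add: algebra_simps)
    then show "((\<lambda>x. p (fst x + snd x - (a + b))) \<longlongrightarrow> 0) (nhds a \<times>\<^sub>F nhds b)"
      using p by (intro tendsto_sandwich[OF _ _ tendsto_const lim]) (auto simp: cseminorm_nonneg)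
  qed
  show "(uminus \<longlongrightarrow> - a) (nhds a)"
    unfolding tendsto_lcs_iff
  proof (intro allI impI)
    fix p :: "'a \<Rightarrow> real" assume p: "ccseminorm p"
    have "((\<lambda>x. p (x - a)) \<longlongrightarrow> 0) (nhds a)"
      using filterlim_ident[of "nhds a"] p unfolding tendsto_lcs_iff by blast
    then show "((\<lambda>x. p (- x - - a)) \<longlongrightarrow> 0) (nhds a)"
      using p cseminorm_minus_commute[of p] by simp
  qed
qed

lemma tendsto_scaleC [tendsto_intros]:
  fixes f :: "'b \<Rightarrow> 'a::complex_lcs"
  assumes g: "(g \<longlongrightarrow> c) F" and f: "(f \<longlongrightarrow> x) F"
  shows "((\<lambda>t. g t *\<^sub>C f t) \<longlongrightarrow> c *\<^sub>C x) F"
  unfolding tendsto_lcs_iff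
proof (intro allI impI)
  fix p :: "'a \<Rightarrow> real" assume p: "ccseminorm p"
  have "((\<lambda>t. cmod (g t) * p (f t - x) + cmod (g t - c) * p x) \<longlongrightarrow> cmod c * 0 + cmod (c - c) * p x) F"
    using f p unfolding tendsto_lcs_iff by (intro tendsto_intros g) auto
  then have lim: "((\<lambda>t. cmod (g t) * p (f t - x) + cmod (g t - c) * p x) \<longlongrightarrow> 0) F" by simp
  have "p (g t *\<^sub>C f t - c *\<^sub>C x) \<le> cmod (g t) * p (f t - x) + cmod (g t - c) * p x" for t
  proof -
    have "g t *\<^sub>C f t - c *\<^sub>C x = g t *\<^sub>C (f t - x) + (g t - c) *\<^sub>C x"
      by (simp add: complex_vector.scale_right_diff_distrib complex_vector.scale_left_diff_distrib)
    then show ?thesis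
      using cseminorm_triangle[of p "g t *\<^sub>C (f t - x)" "(g t - c) *\<^sub>C x"] p
      by (simp add: cseminorm_scaleC)
  qed
  then show "((\<lambda>t. p (g t *\<^sub>C f t - c *\<^sub>C x)) \<longlongrightarrow> 0) F"
    using p by (intro tendsto_sandwich[OF _ _ tendsto_const lim]) (auto simp: cseminorm_nonneg)
qed

lemma continuous_on_scaleC [continuous_intros]:
  fixes f :: "'b::topological_space \<Rightarrow> 'a::complex_lcs"
  shows "continuous_on S g \<Longrightarrow> continuous_on S f \<Longrightarrow> continuous_on S (\<lambda>t. g t *\<^sub>C f t)"
  unfolding continuous_on_def by (auto intro: tendsto_scaleC)

lemma continuous_on_cseminorm:
  "ccseminorm p \<Longrightarrow> continuous_on S f \<Longrightarrow> continuous_on S (\<lambda>t. p (f t))"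
  by (rule continuous_on_compose2[of UNIV p]) auto

definition cdual :: "('a::complex_lcs \<Rightarrow> complex) set" where
  "cdual = {\<phi>. cfunctional \<phi> \<and> continuous_on UNIV \<phi>}"

lemma cdual_cfunctional: "\<phi> \<in> cdual \<Longrightarrow> cfunctional \<phi>"
  and cdual_continuous_on: "\<phi> \<in> cdual \<Longrightarrow> continuous_on UNIV \<phi>"
  by (auto simp: cdual_def)

lemmas cdual_add = cfunctional_add[OF cdual_cfunctional]
  and cdual_diff = cfunctional_diff[OF cdual_cfunctional]
  and cdual_scaleC = cfunctional_scaleC[OF cdual_cfunctional]
  and cdual_linear = cfunctional_linear[OF cdual_cfunctional]

lemma cdual_cseminorm: "\<phi> \<in> cdual \<Longrightarrow> ccseminorm (\<lambda>x. cmod (\<phi> x))"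
  by (auto simp: cdual_def cseminorm_cmod_cfunctional intro: continuous_intros)

lemma cdual_tendsto: "\<phi> \<in> cdual \<Longrightarrow> (f \<longlongrightarrow> l) F \<Longrightarrow> ((\<lambda>x. \<phi> (f x)) \<longlongrightarrow> \<phi> l) F"
  by (rule continuous_on_tendsto_compose[OF cdual_continuous_on]) auto

lemma cdual_continuous_on_compose: "\<phi> \<in> cdual \<Longrightarrow> continuous_on S f \<Longrightarrow> continuous_on S (\<lambda>x. \<phi> (f x))"
  by (rule continuous_on_compose2[OF cdual_continuous_on]) auto

lemma cdualI:
  assumes \<phi>: "cfunctional \<phi>" and p: "ccseminorm p" and le: "\<And>x. cmod (\<phi> x) \<le> p x"
  shows "\<phi> \<in> cdual"
proof -
  have "(\<phi> \<longlongrightarrow> \<phi> x) (at x)" for x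
  proof -
    have "((\<lambda>y. p (y - x)) \<longlongrightarrow> 0) (at x)"
      using tendsto_ident_at[of x UNIV] p unfolding tendsto_lcs_iff by blast
    then have "((\<lambda>y. \<phi> y - \<phi> x) \<longlongrightarrow> 0) (at x)"
      by (rule Lim_null_comparison[rotated]) (auto simp: cfunctional_diff[OF \<phi>, symmetric] le)
    then show ?thesis by (simp add: LIM_zero_iff)
  qed
  then show ?thesis using \<phi> by (auto simp: cdual_def continuous_on_def)
qed

text \<open>The device that reduces seminorm estimates of vector-valued integrals to scalar ones:
  choose the functional that norms the vector in question.\<close>

lemma cdual_norming:
  assumes "ccseminorm p"
  obtains \<phi> where "\<phi> \<in> cdual" "\<And>x. cmod (\<phi> x) \<le> p x" "\<phi> z = p z"
proof -
  obtain \<phi> where \<phi>: "cfunctional \<phi>" "\<And>x. cmod (\<phi> x) \<le> p x" "\<phi> z = p z"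
    using hahn_banach_complex[of p z] assms by blast
  show thesis by (rule that[OF cdualI[OF \<phi>(1) assms \<phi>(2)] \<phi>(2,3)])
qed

text \<open>The Hausdorff property enters here: some continuous seminorm is at least 1 on y - x, and
  a norming functional detects it.\<close>

lemma cdual_separates:
  assumes "\<And>\<phi>. \<phi> \<in> cdual \<Longrightarrow> \<phi> x = \<phi> y"
  shows "x = y"
proof (rule ccontr)
  assume "x \<noteq> y"
  then obtain U where "open U" "x \<in> U" "y \<notin> U" using t1_space by blast
  then obtain p where p: "ccseminorm p" "{z. p (z - x) < 1} \<subseteq> U"
    using open_contains_cseminorm_ball by blast
  then obtain \<phi> where \<phi>: "\<phi> \<in> cdual" "\<phi> (y - x) = p (y - x)" using cdual_norming by blast
  have "p (y - x) \<ge> 1" using p(2) \<open>y \<notin> U\<close> by (metis (mono_tags, lifting) mem_Collect_eq not_less subsetD)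
  then show False using \<phi> assms[OF \<phi>(1)] by (simp add: cdual_diff)
qed

section \<open>Graphs of multivalued operators and their separation from points of the product
  space\<close>

instantiation prod :: (complex_vector, complex_vector) complex_vector
begin

definition scaleC_prod_def: "c *\<^sub>C z = (c *\<^sub>C fst z, c *\<^sub>C snd z)"

instance
  by standard (auto simp: scaleC_prod_def scaleR_prod_def scaleR_scaleC scaleC_add_right scaleC_add_left
      scaleC_scaleC scaleC_one fun_eq_iff)

end

lemma MLO_subspace:
  assumes "MLO \<A>"
  shows "0 \<in> \<A>" "z \<in> \<A> \<Longrightarrow> w \<in> \<A> \<Longrightarrow> z + w \<in> \<A>" "z \<in> \<A> \<Longrightarrow> c *\<^sub>C z \<in> \<A>"
proof -
  have add: "(x + y, u + v) \<in> \<A>" if "(x, u) \<in> \<A>" "(y, v) \<in> \<A>" for x y u v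
    using assms that unfolding MLO_def by (blast intro: DomainI)
  have scale: "(c *\<^sub>C x, c *\<^sub>C u) \<in> \<A>" if "(x, u) \<in> \<A>" for c x u
    using assms that unfolding MLO_def by (blast intro: DomainI)
  show "z \<in> \<A> \<Longrightarrow> w \<in> \<A> \<Longrightarrow> z + w \<in> \<A>" by (cases z; cases w) (simp add: add)
  show sc: "z \<in> \<A> \<Longrightarrow> c *\<^sub>C z \<in> \<A>" for z c by (cases z) (simp add: scaleC_prod_def scale)
  \<comment> \<open>A domain that is a subspace supplies some point (0, u) of the graph; scaling it
    by 0 gives the origin.\<close>
  have "0 \<in> Domain \<A>"
    using assms by (auto simp: MLO_def complex_vector.subspace_0)
  then obtain u where "(0, u) \<in> \<A>" by auto
  from scale[OF this, of 0] show "0 \<in> \<A>" by (simp add: zero_prod_def)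
qed

text \<open>Hahn-Banach for the seminorm \<open>z \<mapsto> inf {p (z - w) | w \<in> \<A>}\<close>, which vanishes exactly on the
  \<open>p\<close>-closure of \<open>\<A>\<close>.\<close>

lemma closed_MLO_memI:
  fixes \<A> :: "('x::complex_lcs \<times> 'x) set"
  assumes "MLO \<A>" "closed \<A>"
    and *: "\<And>\<phi> \<psi>. \<phi> \<in> cdual \<Longrightarrow> \<psi> \<in> cdual \<Longrightarrow> (\<And>u v. (u, v) \<in> \<A> \<Longrightarrow> \<phi> u + \<psi> v = 0) \<Longrightarrow> \<phi> x + \<psi> y = 0"
  shows "(x, y) \<in> \<A>"
proof (rule ccontr)
  note sub = MLO_subspace[OF \<open>MLO \<A>\<close>]
  assume "(x, y) \<notin> \<A>"
  then have "open (- \<A>)" "(x, y) \<in> - \<A>" using \<open>closed \<A>\<close> by auto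
  then obtain U V where UV: "open U" "open V" "x \<in> U" "y \<in> V" "U \<times> V \<subseteq> - \<A>"
    by (auto elim: open_prod_elim)
  obtain p where p: "ccseminorm p" "{u. p (u - x) < 1} \<subseteq> U"
    using open_contains_cseminorm_ball[OF UV(1,3)] by blast
  obtain q where q: "ccseminorm q" "{v. q (v - y) < 1} \<subseteq> V"
    using open_contains_cseminorm_ball[OF UV(2,4)] by blast
  \<comment> \<open>A point outside the closed graph has a box \<open>U \<times> V\<close> disjoint
    from it; r is the seminorm whose unit ball about (x, y) lies in that box.\<close>
  define r where "r z = p (fst z) + q (snd z)" for z
  have r: "cseminorm r"
    unfolding cseminorm_def
  proof (intro conjI allI)
    show "r (z + w) \<le> r z + r w" for z w
      using p q cseminorm_triangle[of p "fst z" "fst w"] cseminorm_triangle[of q "snd z" "snd w"]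
      by (simp add: r_def)
    show "r (c *\<^sub>C z) = cmod c * r z" for c z
      using p q by (simp add: r_def scaleC_prod_def cseminorm_scaleC distrib_left)
  qed
  define d where "d z = (INF w\<in>\<A>. r (z - w))" for z
  have ne: "\<A> \<noteq> {}" using sub(1) by auto
  have bdd: "bdd_below ((\<lambda>w. r (z - w)) ` \<A>)" for z
    by (rule bdd_belowI[of _ 0]) (auto simp: cseminorm_nonneg[OF r])
  have le: "d z \<le> r (z - w)" if "w \<in> \<A>" for z w
    unfolding d_def by (rule cINF_lower[OF bdd that])
  have nonneg: "0 \<le> d z" for z
    unfolding d_def by (rule cINF_greatest[OF ne]) (rule cseminorm_nonneg[OF r])
  have add: "d (z + w) \<le> d z + d w" for z w
  proof (rule field_le_epsilon)
    fix e :: real assume "e > 0"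
    then obtain s t where s: "s \<in> \<A>" "r (z - s) < d z + e/2" and t: "t \<in> \<A>" "r (w - t) < d w + e/2"
      using cINF_less_iff[OF ne bdd, of z "d z + e/2"] cINF_less_iff[OF ne bdd, of w "d w + e/2"]
      by (auto simp: d_def)
    have "d (z + w) \<le> r ((z + w) - (s + t))" by (intro le sub s t)
    also have "\<dots> \<le> r (z - s) + r (w - t)"
      using cseminorm_triangle[OF r, of "z - s" "w - t"] by (simp add: algebra_simps)
    finally show "d (z + w) \<le> d z + d w + e" using s t by linarith
  qed
  have scale_le: "d (c *\<^sub>C z) \<le> cmod c * d z" if "c \<noteq> 0" for c z
  proof -
    have "d (c *\<^sub>C z) / cmod c \<le> d z"
      unfolding d_def[of z]
    proof (rule cINF_greatest[OF ne])
      fix w assume w: "w \<in> \<A>"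
      have "d (c *\<^sub>C z) \<le> r (c *\<^sub>C z - c *\<^sub>C w)" by (intro le sub w)
      also have "\<dots> = cmod c * r (z - w)"
        using r by (simp add: complex_vector.scale_right_diff_distrib[symmetric] cseminorm_scaleC)
      finally show "d (c *\<^sub>C z) / cmod c \<le> r (z - w)" using that by (simp add: field_simps)
    qed
    then show ?thesis using that by (simp add: field_simps)
  qed
  have zero: "d z = 0" if "z \<in> \<A>" for z
    using le[OF that, of z] nonneg[of z] cseminorm_zero[OF r] by simp
  have scale: "d (c *\<^sub>C z) = cmod c * d z" for c z
  proof (cases "c = 0")
    case True
    then show ?thesis using zero[OF sub(1)] by simp
  next
    case False
    then have "d (inverse c *\<^sub>C c *\<^sub>C z) \<le> inverse (cmod c) * d (c *\<^sub>C z)"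
      using scale_le[of "inverse c" "c *\<^sub>C z"] by (simp add: norm_inverse)
    then have "cmod c * d z \<le> d (c *\<^sub>C z)"
      using False by (simp add: field_simps scaleC_scaleC scaleC_one)
    then show ?thesis using scale_le[OF False, of z] by simp
  qed
  have d: "cseminorm d" by (simp add: cseminorm_def add scale)
  then obtain \<theta> where \<theta>: "cfunctional \<theta>" "\<And>z. cmod (\<theta> z) \<le> d z" "\<theta> (x, y) = d (x, y)"
    using hahn_banach_complex[of d "(x, y)"] by blast
  \<comment> \<open>Restricting \<theta> to the two axes turns a functional on the product into a
    pair on the factors. On the axes r reduces to p and to q, whence the continuity of both.\<close>
  define \<phi> \<psi> where "\<phi> u = \<theta> (u, 0)" and "\<psi> v = \<theta> (0, v)" for u v
  have split: "\<theta> (u, v) = \<phi> u + \<psi> v" for u v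
    using cfunctional_add[OF \<theta>(1), of "(u, 0)" "(0, v)"] by (simp add: \<phi>_def \<psi>_def)
  have le_r: "cmod (\<theta> z) \<le> r z" for z
    using \<theta>(2)[of z] le[OF sub(1), of z] by simp
  have "\<phi> \<in> cdual"
  proof (rule cdualI[OF _ p(1)])
    show "cfunctional \<phi>"
      using cfunctional_add[OF \<theta>(1), of "(u, 0)" "(v, 0)" for u v] cfunctional_scaleC[OF \<theta>(1), of c "(u, 0)" for c u]
      by (auto simp: cfunctional_def \<phi>_def scaleC_prod_def)
    show "cmod (\<phi> u) \<le> p u" for u
      using le_r[of "(u, 0)"] q by (simp add: r_def \<phi>_def cseminorm_zero)
  qed
  moreover have "\<psi> \<in> cdual"
  proof (rule cdualI[OF _ q(1)])
    show "cfunctional \<psi>"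
      using cfunctional_add[OF \<theta>(1), of "(0, u)" "(0, v)" for u v] cfunctional_scaleC[OF \<theta>(1), of c "(0, u)" for c u]
      by (auto simp: cfunctional_def \<psi>_def scaleC_prod_def)
    show "cmod (\<psi> u) \<le> q u" for u
      using le_r[of "(0, u)"] p by (simp add: r_def \<psi>_def cseminorm_zero)
  qed
  moreover have "\<phi> u + \<psi> v = 0" if "(u, v) \<in> \<A>" for u v
    using \<theta>(2)[of "(u, v)"] zero[OF that] by (simp add: split)
  ultimately have "\<phi> x + \<psi> y = 0" by (rule *)
  then have "d (x, y) = 0" using \<theta>(3) by (simp add: split)
  \<comment> \<open>A point w of \<A> with r-distance below 1 from (x, y) would lie in the box. This
    contradicts \<open>d (x, y) = 0\<close>, which the annihilating pair has just produced.\<close>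
  moreover have "1 \<le> d (x, y)"
    unfolding d_def
  proof (rule cINF_greatest[OF ne])
    fix w assume w: "w \<in> \<A>"
    show "1 \<le> r ((x, y) - w)"
    proof (rule ccontr)
      assume "\<not> 1 \<le> r ((x, y) - w)"
      then have "p (x - fst w) + q (y - snd w) < 1" by (simp add: r_def)
      then have "p (fst w - x) < 1" "q (snd w - y) < 1"
        using p q cseminorm_nonneg[of p "x - fst w"] cseminorm_nonneg[of q "y - snd w"]
          cseminorm_minus_commute[of p x "fst w"] cseminorm_minus_commute[of q y "snd w"] by auto
      then have "w \<in> U \<times> V" using p q by (cases w) auto
      then show False using UV w by auto
    qed
  qed
  ultimately show False by simp
qed

section \<open>The integral in sequentially complete spaces\<close>

text \<open>The modulus of \<phi> is itself a continuous seminorm, so composing the approximating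
  simple functions with \<phi> gives an admissible approximation for the scalar Bochner
  integral.\<close>

lemma has_lcs_integral_cdual:
  assumes f: "has_lcs_integral M f z" and \<phi>: "\<phi> \<in> cdual"
    and meas: "(\<lambda>t. \<phi> (f t)) \<in> borel_measurable M"
  shows "has_bochner_integral M (\<lambda>t. \<phi> (f t)) (\<phi> z)"
proof -
  obtain s where s: "\<And>n. Bochner_Integration.simple_bochner_integrable M (s n)"
    "\<And>p. ccseminorm p \<Longrightarrow> (\<lambda>n. \<integral>\<^sup>+ t. ennreal (p (f t - s n t)) \<partial>M) \<longlonglongrightarrow> 0"
    "(\<lambda>n. Bochner_Integration.simple_bochner_integral M (s n)) \<longlonglongrightarrow> z"
    using f unfolding has_lcs_integral_def by blast
  show ?thesis
  proof (rule has_bochner_integral.intros[OF meas])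
    show "Bochner_Integration.simple_bochner_integrable M (\<lambda>t. \<phi> (s n t))" for n
      using \<phi> s(1)[of n]
      by (intro simple_bochner_integrable_compose2[where p = "\<lambda>x y. \<phi> x"])
        (auto simp: cfunctional_zero cdual_cfunctional)
    show "(\<lambda>n. \<integral>\<^sup>+ t. ennreal (norm (\<phi> (f t) - \<phi> (s n t))) \<partial>M) \<longlonglongrightarrow> 0"
      using s(2)[OF cdual_cseminorm[OF \<phi>]] by (simp add: cdual_diff[OF \<phi>])
    show "(\<lambda>n. Bochner_Integration.simple_bochner_integral M (\<lambda>t. \<phi> (s n t))) \<longlonglongrightarrow> \<phi> z"
      using cdual_tendsto[OF \<phi> s(3)] by (simp add: simple_bochner_integral_linear[OF cdual_linear[OF \<phi>] s(1)])
  qed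
qed

text \<open>The integral is a definite description, usable only once its value is known to be
  unique; scalar integrals are unique and functionals separate points.\<close>

lemma lcs_integral_eqI:
  fixes f :: "'a \<Rightarrow> 'b::complex_lcs"
  assumes f: "has_lcs_integral M f z"
    and meas: "\<And>\<phi>. \<phi> \<in> cdual \<Longrightarrow> (\<lambda>t. \<phi> (f t)) \<in> borel_measurable M"
  shows "lcs_integral M f = z"
proof -
  have "w = z" if "has_lcs_integral M f w" for w
  proof (rule cdual_separates)
    fix \<phi> :: "'b \<Rightarrow> complex" assume \<phi>: "\<phi> \<in> cdual"
    show "\<phi> w = \<phi> z"
      using has_lcs_integral_cdual[OF that \<phi> meas[OF \<phi>]] has_lcs_integral_cdual[OF f \<phi> meas[OF \<phi>]]
      by (rule has_bochner_integral_eq)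
  qed
  then have "(THE z. has_lcs_integral M f z) = z" by (rule the_equality[where P = "has_lcs_integral M f", OF f])
  then show ?thesis
    using f by (auto simp: lcs_integral_def)
qed

text \<open>Convergence in the mean for every continuous seminorm makes the integrals of the simple
  functions a Cauchy sequence, and sequential completeness supplies the value.\<close>

lemma has_lcs_integral_exists:
  fixes f :: "'m \<Rightarrow> 'x::seq_complete_lcs"
  assumes s: "\<And>n. Bochner_Integration.simple_bochner_integrable M (s n)"
    and meas: "\<And>p n. ccseminorm p \<Longrightarrow> (\<lambda>t. p (f t - s n t)) \<in> borel_measurable M"
    and lim: "\<And>p. ccseminorm p \<Longrightarrow> (\<lambda>n. \<integral>\<^sup>+ t. ennreal (p (f t - s n t)) \<partial>M) \<longlonglongrightarrow> 0"
    and \<phi>_meas: "\<And>\<phi>. \<phi> \<in> cdual \<Longrightarrow> (\<lambda>t. \<phi> (f t)) \<in> borel_measurable M"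
  obtains z where "has_lcs_integral M f z"
proof -
  let ?I = "\<lambda>n. Bochner_Integration.simple_bochner_integral M (s n)"
  have diff: "ennreal (p (?I m - ?I n)) \<le>
      (\<integral>\<^sup>+ t. ennreal (p (f t - s m t)) \<partial>M) + (\<integral>\<^sup>+ t. ennreal (p (f t - s n t)) \<partial>M)"
    if p: "ccseminorm p" for p m n
  proof -
    obtain \<phi> where \<phi>: "\<phi> \<in> cdual" "\<And>x. cmod (\<phi> x) \<le> p x" "\<phi> (?I m - ?I n) = p (?I m - ?I n)"
      using cdual_norming[OF p] by blast
    have simp: "Bochner_Integration.simple_bochner_integrable M (\<lambda>t. \<phi> (s n t))" for n
      using \<phi>(1) s[of n]
      by (intro simple_bochner_integrable_compose2[where p = "\<lambda>x y. \<phi> x"])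
        (auto simp: cfunctional_zero cdual_cfunctional)
    have "p (?I m - ?I n) = cmod (\<phi> (?I m - ?I n))"
      using \<phi>(3) p by (simp add: cseminorm_nonneg)
    also have "\<phi> (?I m - ?I n) =
        Bochner_Integration.simple_bochner_integral M (\<lambda>t. \<phi> (s m t)) - Bochner_Integration.simple_bochner_integral M (\<lambda>t. \<phi> (s n t))"
      by (simp add: cdual_diff[OF \<phi>(1)] simple_bochner_integral_linear[OF cdual_linear[OF \<phi>(1)] s])
    also have "ennreal (cmod \<dots>) \<le> (\<integral>\<^sup>+ t. ennreal (cmod (\<phi> (f t) - \<phi> (s m t))) \<partial>M)
        + (\<integral>\<^sup>+ t. ennreal (cmod (\<phi> (f t) - \<phi> (s n t))) \<partial>M)"
      by (rule simple_bochner_integral_bounded[OF \<phi>_meas[OF \<phi>(1)] simp simp])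
    also have "\<dots> \<le> (\<integral>\<^sup>+ t. ennreal (p (f t - s m t)) \<partial>M) + (\<integral>\<^sup>+ t. ennreal (p (f t - s n t)) \<partial>M)"
      using \<phi>(2) by (intro add_mono nn_integral_mono ennreal_leI) (simp_all add: cdual_diff[OF \<phi>(1), symmetric])
    finally show ?thesis .
  qed
  have "lcs_Cauchy ?I"
    unfolding lcs_Cauchy_def
  proof (intro allI impI)
    fix U :: "'x set" assume "open U \<and> 0 \<in> U"
    then obtain p where p: "ccseminorm p" "{y. p (y - 0) < 1} \<subseteq> U"
      using open_contains_cseminorm_ball by blast
    have "eventually (\<lambda>n. (\<integral>\<^sup>+ t. ennreal (p (f t - s n t)) \<partial>M) < ennreal (1/2)) sequentially"
      by (rule order_tendstoD(2)[OF lim[OF p(1)]]) (subst ennreal_less_zero_iff, simp)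
    then obtain N where N: "\<And>n. n \<ge> N \<Longrightarrow> (\<integral>\<^sup>+ t. ennreal (p (f t - s n t)) \<partial>M) < ennreal (1/2)"
      by (auto simp: eventually_sequentially)
    have "?I m - ?I n \<in> U" if "m \<ge> N" "n \<ge> N" for m n
    proof -
      have "ennreal (p (?I m - ?I n)) < ennreal (1/2) + ennreal (1/2)"
        using diff[OF p(1), of m n] add_strict_mono[OF N[OF that(1)] N[OF that(2)]] by (rule le_less_trans)
      also have "\<dots> = ennreal 1"
        by (subst ennreal_plus[symmetric]) auto
      finally have "p (?I m - ?I n) < 1"
        using p(1) by (simp add: ennreal_less_iff cseminorm_nonneg del: ennreal_1)
      then show ?thesis using p(2) by auto
    qed
    then show "\<exists>N. \<forall>m\<ge>N. \<forall>n\<ge>N. ?I m - ?I n \<in> U" by blast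
  qed
  then obtain z where "?I \<longlonglongrightarrow> z"
    using lcs_Cauchy_convergent by (auto simp: convergent_def)
  then have "has_lcs_integral M f z"
    unfolding has_lcs_integral_def using s meas lim by (intro exI[of _ s]) blast
  then show thesis by (rule that)
qed

text \<open>Freezing u at the endpoints extends it continuously to the whole line, where continuity
  gives Borel measurability.\<close>

lemma continuous_on_clamp:
  fixes b :: real
  assumes "b \<ge> 0" and "continuous_on {0..b} u"
  shows "continuous_on UNIV (\<lambda>t. u (max 0 (min b t)))"
  by (rule continuous_on_compose2[OF assms(2)]) (use assms(1) in \<open>auto intro!: continuous_intros\<close>)

text \<open>The target space need be neither metrizable nor separable, so no measurability of
  vector-valued maps is invoked. The expression factors through four scalar parameters, on which it
  is a continuous real function.\<close>

lemma borel_measurable_cseminorm_diff: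
  fixes U :: "real \<Rightarrow> 'x::complex_lcs"
  assumes p: "ccseminorm p" and U: "continuous_on UNIV U"
    and [measurable]: "v \<in> borel_measurable M" "r \<in> borel_measurable M" "w \<in> borel_measurable M" "s \<in> borel_measurable M"
  shows "(\<lambda>t. p (v t *\<^sub>C U (r t) - w t *\<^sub>C U (s t))) \<in> borel_measurable M"
proof -
  define G where "G = (\<lambda>(v, r, w, s). p (v *\<^sub>C U r - w *\<^sub>C U s))"
  have "continuous_on UNIV G"
    unfolding G_def case_prod_beta
    by (intro continuous_on_cseminorm[OF p] continuous_intros continuous_on_compose2[OF U]) auto
  then have G: "G \<in> borel_measurable borel" by (rule borel_measurable_continuous_onI)
  have "(\<lambda>t. G (v t, r t, w t, s t)) \<in> borel_measurable M"
    by (rule measurable_compose[OF _ G]) measurable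
  then show ?thesis by (simp add: G_def)
qed

text \<open>g is approximated by simple functions in the mean and u by its values on a grid; the
  products are simple. The error splits into \<open>cmod (g t) * p (U t - U (step n t))\<close>,
  handled by dominated convergence, and a bounded multiple of the mean error of g. The sequence is
  chosen before p, as the definition of the integral requires.\<close>

lemma has_lcs_integral_scaleC_exists:
  fixes u :: "real \<Rightarrow> 'x::seq_complete_lcs"
  assumes b: "b \<ge> 0" and g: "integrable (lebesgue_on {0..b}) g" and u: "continuous_on {0..b} u"
  obtains z where "has_lcs_integral (lebesgue_on {0..b}) (\<lambda>t. g t *\<^sub>C u t) z"
proof -
  let ?M = "lebesgue_on {0..b}"
  interpret finite_measure ?M by (rule finite_measure_lebesgue_on) auto
  define U where "U t = u (max 0 (min b t))" for t
  have U: "continuous_on UNIV U" unfolding U_def by (rule continuous_on_clamp[OF b u])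
  have U_eq: "U t = u t" if "t \<in> {0..b}" for t using that by (simp add: U_def)
  \<comment> \<open>Rounding down to a grid of mesh 1/(n + 1), which converges pointwise and keeps
    points of [0, b] inside it.\<close>
  define step :: "nat \<Rightarrow> real \<Rightarrow> real" where "step n t = of_int \<lfloor>t * real (Suc n)\<rfloor> / real (Suc n)" for n t
  have step_lim: "(\<lambda>n. step n t) \<longlonglongrightarrow> t" for t
  proof (rule Lim_null_comparison[where g = "\<lambda>n. 1 / Suc n", THEN LIM_zero_iff[THEN iffD1]])
    show "eventually (\<lambda>n. norm (step n t - t) \<le> 1 / Suc n) sequentially"
    proof (intro always_eventually allI)
      fix n
      have "step n t - t = - (frac (t * real (Suc n)) / Suc n)"
        by (simp add: step_def frac_def field_simps)
      moreover have "norm (- (frac (t * real (Suc n)) / real (Suc n))) = frac (t * real (Suc n)) / real (Suc n)"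
        by (simp add: abs_divide)
      ultimately show "norm (step n t - t) \<le> 1 / Suc n"
        using frac_lt_1[of "t * real (Suc n)"] by (simp only:) (intro divide_right_mono, auto)
    qed
    show "(\<lambda>n. 1 / real (Suc n)) \<longlonglongrightarrow> 0" by (rule LIMSEQ_inverse_real_of_nat[unfolded inverse_eq_divide])
  qed
  have floor_meas: "(\<lambda>t. \<lfloor>t * real (Suc n)\<rfloor>) \<in> measurable ?M (count_space UNIV)" for n
    by (rule measurable_restrict_space1) (rule measurable_completion, measurable)
  have step_meas: "step n \<in> borel_measurable ?M" for n
    using floor_meas[of n] unfolding step_def by measurable
  \<comment> \<open>Only finitely many grid indices occur on [0, b]; simplicity is thus a statement
    about the integer-valued floor and passes to any function of it.\<close>
  have step_simple: "simple_function ?M (\<lambda>t. U (step n t))" for n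
  proof -
    have "(\<lambda>t. \<lfloor>t * real (Suc n)\<rfloor>) ` {0..b} \<subseteq> {0..\<lfloor>b * real (Suc n)\<rfloor>}"
      using b by (auto intro!: floor_mono mult_right_mono)
    then have "simple_function ?M (\<lambda>t. \<lfloor>t * real (Suc n)\<rfloor>)"
      using floor_meas by (auto simp: simple_function_eq_measurable intro: finite_subset)
    then show ?thesis unfolding step_def by (rule simple_function_compose1)
  qed
  obtain \<sigma> where \<sigma>: "\<And>n. Bochner_Integration.simple_bochner_integrable ?M (\<sigma> n)"
    "(\<lambda>n. \<integral>\<^sup>+ t. norm (g t - \<sigma> n t) \<partial>?M) \<longlonglongrightarrow> 0"
  proof -
    have "\<exists>\<sigma>. (\<forall>n. Bochner_Integration.simple_bochner_integrable ?M (\<sigma> n)) \<and>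
        (\<lambda>n. \<integral>\<^sup>+ t. norm (g t - \<sigma> n t) \<partial>?M) \<longlonglongrightarrow> 0"
      using has_bochner_integral_integrable[OF g] unfolding has_bochner_integral.simps by blast
    then show thesis using that by blast
  qed
  have \<sigma>_simple: "simple_function ?M (\<sigma> n)" for n
    using \<sigma>(1)[of n] by (auto elim: simple_bochner_integrable.cases)
  note [measurable] = borel_measurable_integrable[OF g] borel_measurable_simple_function[OF \<sigma>_simple] step_meas
  have id_meas[measurable]: "(\<lambda>t. t) \<in> borel_measurable ?M"
    by (rule measurable_restrict_space1) (rule measurable_completion, measurable)
  show thesis
  proof (rule has_lcs_integral_exists)
    show "Bochner_Integration.simple_bochner_integrable ?M (\<lambda>t. \<sigma> n t *\<^sub>C U (step n t))" for n
      using emeasure_finite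
      by (intro simple_bochner_integrable.intros simple_function_compose2[of _ _ _ scaleC] \<sigma>_simple step_simple) auto
    show "(\<lambda>t. p (g t *\<^sub>C u t - \<sigma> n t *\<^sub>C U (step n t))) \<in> borel_measurable ?M" if p: "ccseminorm p" for p n
    proof -
      have "(\<lambda>t. p (g t *\<^sub>C U t - \<sigma> n t *\<^sub>C U (step n t))) \<in> borel_measurable ?M"
        by (rule borel_measurable_cseminorm_diff[OF p U]) measurable
      then show ?thesis
        by (rule measurable_cong[THEN iffD1, rotated]) (simp add: U_eq)
    qed
    show "(\<lambda>t. \<phi> (g t *\<^sub>C u t)) \<in> borel_measurable ?M" if \<phi>: "\<phi> \<in> cdual" for \<phi>
    proof -
      have "(\<lambda>t. \<phi> (U t)) \<in> borel_measurable ?M"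
        using borel_measurable_continuous_onI[OF cdual_continuous_on_compose[OF \<phi> U]]
        by (intro measurable_compose[OF id_meas])
      then have "(\<lambda>t. g t * \<phi> (U t)) \<in> borel_measurable ?M" by measurable
      then show ?thesis
        by (rule measurable_cong[THEN iffD1, rotated]) (simp add: cdual_scaleC[OF \<phi>] U_eq)
    qed
    show "(\<lambda>n. \<integral>\<^sup>+ t. ennreal (p (g t *\<^sub>C u t - \<sigma> n t *\<^sub>C U (step n t))) \<partial>?M) \<longlonglongrightarrow> 0" if p: "ccseminorm p" for p
    proof -
      have "bounded ((\<lambda>t. p (u t)) ` {0..b})"
        by (intro compact_imp_bounded compact_continuous_image continuous_on_cseminorm[OF p u]) auto
      then obtain B where B: "\<And>t. t \<in> {0..b} \<Longrightarrow> p (u t) \<le> B"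
        unfolding bounded_iff by (metis abs_le_D1 image_eqI real_norm_def)
      have UB: "p (U t) \<le> B" for t unfolding U_def using b by (intro B) auto
      have B0: "B \<ge> 0" using UB[of 0] cseminorm_nonneg[of p "U 0"] p by linarith
      have [measurable]: "(\<lambda>t. p (U t - U (step n t))) \<in> borel_measurable ?M" for n
        using borel_measurable_cseminorm_diff[OF p U, of "\<lambda>_. 1" ?M "\<lambda>t. t" "\<lambda>_. 1" "step n"] id_meas step_meas
        by (simp add: scaleC_one)
      have "(\<lambda>n. \<integral>\<^sup>+ t. ennreal (cmod (g t) * p (U t - U (step n t))) \<partial>?M) \<longlonglongrightarrow> (\<integral>\<^sup>+ t. 0 \<partial>?M)"
      proof (rule nn_integral_dominated_convergence[where w = "\<lambda>t. ennreal (cmod (g t) * (B + B))"])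
        have "(\<integral>\<^sup>+ t. ennreal (cmod (g t) * (B + B)) \<partial>?M) = ennreal (B + B) * (\<integral>\<^sup>+ t. ennreal (cmod (g t)) \<partial>?M)"
          using B0 by (subst nn_integral_cmult[symmetric]) (auto simp: ennreal_mult' mult.commute)
        also have "\<dots> < \<infinity>"
          using g by (simp add: ennreal_mult_less_top integrable_iff_bounded)
        finally show "(\<integral>\<^sup>+ t. ennreal (cmod (g t) * (B + B)) \<partial>?M) < \<infinity>" .
        have "p (U t - U s) \<le> B + B" for t s
          using cseminorm_triangle[of p "U t" "- U s"] UB[of t] UB[of s] p by (simp add: cseminorm_minus)
        then show "AE t in ?M. ennreal (cmod (g t) * p (U t - U (step n t))) \<le> ennreal (cmod (g t) * (B + B))" for n
          by (auto intro!: ennreal_leI mult_left_mono)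
        have "(\<lambda>n. cmod (g t) * p (U t - U (step n t))) \<longlonglongrightarrow> cmod (g t) * p (U t - U t)" for t
          using step_lim[of t] U
          by (intro tendsto_intros continuous_on_tendsto_compose[OF conjunct2[OF p]] continuous_on_tendsto_compose[OF U]) auto
        then have "(\<lambda>n. ennreal (cmod (g t) * p (U t - U (step n t)))) \<longlonglongrightarrow> ennreal 0" for t
          using p by (intro tendsto_ennrealI) (simp add: cseminorm_zero)
        then show "AE t in ?M. (\<lambda>n. ennreal (cmod (g t) * p (U t - U (step n t)))) \<longlonglongrightarrow> 0" by simp
      qed measurable
      then have "(\<lambda>n. (\<integral>\<^sup>+ t. ennreal (cmod (g t) * p (U t - U (step n t))) \<partial>?M)
          + ennreal B * (\<integral>\<^sup>+ t. norm (g t - \<sigma> n t) \<partial>?M)) \<longlonglongrightarrow> 0 + ennreal B * 0"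
        by (intro tendsto_add ennreal_tendsto_cmult \<sigma>(2)) auto
      then have lim: "(\<lambda>n. (\<integral>\<^sup>+ t. ennreal (cmod (g t) * p (U t - U (step n t))) \<partial>?M)
          + ennreal B * (\<integral>\<^sup>+ t. norm (g t - \<sigma> n t) \<partial>?M)) \<longlonglongrightarrow> 0" by simp
      have "(\<integral>\<^sup>+ t. ennreal (p (g t *\<^sub>C u t - \<sigma> n t *\<^sub>C U (step n t))) \<partial>?M)
          \<le> (\<integral>\<^sup>+ t. ennreal (cmod (g t) * p (U t - U (step n t))) \<partial>?M)
            + ennreal B * (\<integral>\<^sup>+ t. norm (g t - \<sigma> n t) \<partial>?M)" for n
      proof -
        have "(\<integral>\<^sup>+ t. ennreal (p (g t *\<^sub>C u t - \<sigma> n t *\<^sub>C U (step n t))) \<partial>?M)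
            \<le> (\<integral>\<^sup>+ t. ennreal (cmod (g t) * p (U t - U (step n t))) + ennreal B * norm (g t - \<sigma> n t) \<partial>?M)"
        proof (rule nn_integral_mono)
          fix t assume "t \<in> space ?M"
          then have "g t *\<^sub>C u t - \<sigma> n t *\<^sub>C U (step n t)
              = g t *\<^sub>C (U t - U (step n t)) + (g t - \<sigma> n t) *\<^sub>C U (step n t)"
            by (simp add: U_eq complex_vector.scale_right_diff_distrib complex_vector.scale_left_diff_distrib)
          then have "p (g t *\<^sub>C u t - \<sigma> n t *\<^sub>C U (step n t))
              \<le> cmod (g t) * p (U t - U (step n t)) + cmod (g t - \<sigma> n t) * p (U (step n t))"
            using cseminorm_triangle[of p "g t *\<^sub>C (U t - U (step n t))" "(g t - \<sigma> n t) *\<^sub>C U (step n t)"] p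
            by (simp add: cseminorm_scaleC)
          also have "\<dots> \<le> cmod (g t) * p (U t - U (step n t)) + B * cmod (g t - \<sigma> n t)"
            using UB[of "step n t"] by (simp add: mult.commute mult_right_mono)
          finally have "ennreal (p (g t *\<^sub>C u t - \<sigma> n t *\<^sub>C U (step n t)))
              \<le> ennreal (cmod (g t) * p (U t - U (step n t)) + B * cmod (g t - \<sigma> n t))"
            by (rule ennreal_leI)
          also have "\<dots> = ennreal (cmod (g t) * p (U t - U (step n t))) + ennreal B * norm (g t - \<sigma> n t)"
            using B0 p by (simp add: ennreal_mult' ennreal_plus cseminorm_nonneg)
          finally show "ennreal (p (g t *\<^sub>C u t - \<sigma> n t *\<^sub>C U (step n t)))
              \<le> ennreal (cmod (g t) * p (U t - U (step n t))) + ennreal B * norm (g t - \<sigma> n t)" .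
        qed
        also have "\<dots> = (\<integral>\<^sup>+ t. ennreal (cmod (g t) * p (U t - U (step n t))) \<partial>?M)
            + ennreal B * (\<integral>\<^sup>+ t. norm (g t - \<sigma> n t) \<partial>?M)"
          by (simp add: nn_integral_add nn_integral_cmult)
        finally show ?thesis .
      qed
      then show ?thesis
        by (intro tendsto_sandwich[OF _ _ tendsto_const lim]) auto
    qed
  qed (rule that)
qed

text \<open>With \<open>cdual_separates\<close> and \<open>cdual_norming\<close>, this is the
  interface to the vector integral: identities and estimates are checked on scalars.\<close>

lemma cdual_lcs_integral:
  fixes u :: "real \<Rightarrow> 'x::seq_complete_lcs"
  assumes b: "b \<ge> 0" and g: "integrable (lebesgue_on {0..b}) g" and u: "continuous_on {0..b} u"
    and \<phi>: "\<phi> \<in> cdual"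
  shows "has_bochner_integral (lebesgue_on {0..b}) (\<lambda>t. g t * \<phi> (u t))
    (\<phi> (lcs_integral (lebesgue_on {0..b}) (\<lambda>t. g t *\<^sub>C u t)))"
proof -
  let ?M = "lebesgue_on {0..b}"
  obtain z where z: "has_lcs_integral ?M (\<lambda>t. g t *\<^sub>C u t) z"
    using has_lcs_integral_scaleC_exists[OF b g u] .
  have meas: "(\<lambda>t. \<phi> (g t *\<^sub>C u t)) \<in> borel_measurable ?M" if \<phi>: "\<phi> \<in> cdual" for \<phi>
  proof -
    have "(\<lambda>t. \<phi> (u t)) \<in> borel_measurable ?M"
      by (intro continuous_imp_measurable_on_sets_lebesgue cdual_continuous_on_compose[OF \<phi> u]) auto
    then have "(\<lambda>t. g t * \<phi> (u t)) \<in> borel_measurable ?M"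
      using borel_measurable_integrable[OF g] by measurable
    then show ?thesis by (simp add: cdual_scaleC[OF \<phi>])
  qed
  have "lcs_integral ?M (\<lambda>t. g t *\<^sub>C u t) = z" by (rule lcs_integral_eqI[OF z meas])
  then show ?thesis
    using has_lcs_integral_cdual[OF z \<phi> meas[OF \<phi>]] by (simp add: cdual_scaleC[OF \<phi>])
qed

lemma cseminorm_lcs_integral_le:
  fixes u :: "real \<Rightarrow> 'x::seq_complete_lcs"
  assumes b: "b \<ge> 0" and g: "integrable (lebesgue_on {0..b}) g" and u: "continuous_on {0..b} u"
    and p: "ccseminorm p"
    and h: "integrable (lebesgue_on {0..b}) h" and le: "\<And>t. t \<in> {0..b} \<Longrightarrow> cmod (g t) * p (u t) \<le> h t"
  shows "p (lcs_integral (lebesgue_on {0..b}) (\<lambda>t. g t *\<^sub>C u t)) \<le> (\<integral>t. h t \<partial>lebesgue_on {0..b})"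
proof -
  let ?I = "lcs_integral (lebesgue_on {0..b}) (\<lambda>t. g t *\<^sub>C u t)"
  obtain \<phi> where \<phi>: "\<phi> \<in> cdual" "\<And>x. cmod (\<phi> x) \<le> p x" "\<phi> ?I = p ?I"
    using cdual_norming[OF p] by blast
  note I = cdual_lcs_integral[OF b g u \<phi>(1)]
  have "p ?I = cmod (\<phi> ?I)" using p \<phi>(3) by (simp add: cseminorm_nonneg)
  also have "\<phi> ?I = (\<integral>t. g t * \<phi> (u t) \<partial>lebesgue_on {0..b})"
    using I by (simp add: has_bochner_integral_iff)
  also have "cmod \<dots> \<le> (\<integral>t. h t \<partial>lebesgue_on {0..b})"
  proof (rule Bochner_Integration.integral_norm_bound_integral[OF _ h])
    show "integrable (lebesgue_on {0..b}) (\<lambda>t. g t * \<phi> (u t))" using I by (simp add: has_bochner_integral_iff)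
    fix t assume "t \<in> space (lebesgue_on {0..b})"
    then have "t \<in> {0..b}" by simp
    then show "norm (g t * \<phi> (u t)) \<le> h t"
      using le[of t] mult_left_mono[OF \<phi>(2)[of "u t"], of "cmod (g t)"] by (simp add: norm_mult)
  qed
  finally show ?thesis .
qed

section \<open>Scalar Laplace transforms\<close>

abbreviation lexp :: "complex \<Rightarrow> real \<Rightarrow> complex" where
  "lexp \<mu> t \<equiv> exp (- (\<mu> * of_real t))"

section \<open>Lebesgue integrals on intervals, product measures and exponential kernels\<close>

lemma lebesgue_on_subset:
  fixes f :: "real \<Rightarrow> 'b::{banach, second_countable_topology}"
  assumes "S \<subseteq> T" "S \<in> sets lebesgue" "T \<in> sets lebesgue"
  shows integrable_lebesgue_on_subset: "integrable (lebesgue_on S) f \<longleftrightarrow> integrable (lebesgue_on T) (\<lambda>x. indicator S x *\<^sub>R f x)"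
    and integral_lebesgue_on_subset: "integral\<^sup>L (lebesgue_on S) f = integral\<^sup>L (lebesgue_on T) (\<lambda>x. indicator S x *\<^sub>R f x)"
proof -
  have eq: "lebesgue_on S = restrict_space (lebesgue_on T) S"
    using assms by (subst restrict_restrict_space) (auto simp: Int_absorb1)
  have S: "S \<inter> space (lebesgue_on T) \<in> sets (lebesgue_on T)"
    using assms by (auto simp: sets_restrict_space_iff)
  show "integrable (lebesgue_on S) f \<longleftrightarrow> integrable (lebesgue_on T) (\<lambda>x. indicator S x *\<^sub>R f x)"
    unfolding eq by (rule integrable_restrict_space[OF S])
  show "integral\<^sup>L (lebesgue_on S) f = integral\<^sup>L (lebesgue_on T) (\<lambda>x. indicator S x *\<^sub>R f x)"
    unfolding eq by (rule integral_restrict_space[OF S])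
qed

lemma sigma_finite_lebesgue: "sigma_finite_measure (lebesgue :: 'a::euclidean_space measure)"
proof
  obtain A :: "'a set set" where A: "countable A" "A \<subseteq> sets lborel" "\<Union>A = space lborel" "\<forall>a\<in>A. emeasure lborel a \<noteq> \<infinity>"
    using lborel.sigma_finite_countable by blast
  then show "\<exists>A :: 'a set set. countable A \<and> A \<subseteq> sets lebesgue \<and> \<Union>A = space lebesgue \<and> (\<forall>a\<in>A. emeasure lebesgue a \<noteq> \<infinity>)"
    by (intro exI[of _ A]) (auto simp: subset_iff)
qed

lemma pair_sigma_finite_lebesgue_on:
  "S \<in> sets lebesgue \<Longrightarrow> T \<in> sets lebesgue \<Longrightarrow> pair_sigma_finite (lebesgue_on S) (lebesgue_on T)"
  by (intro pair_sigma_finite.intro sigma_finite_measure_restrict_space sigma_finite_lebesgue)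

lemma (in pair_sigma_finite) integrable_product:
  fixes f :: "_ \<Rightarrow> 'c::{real_normed_algebra, banach, second_countable_topology}"
  assumes f: "integrable M1 f" and g: "integrable M2 g"
    and mult: "\<And>x y. norm (f x * g y) = norm (f x) * norm (g y)"
  shows "integrable (M1 \<Otimes>\<^sub>M M2) (\<lambda>(x, y). f x * g y)"
proof (rule Fubini_integrable)
  note [measurable] = borel_measurable_integrable[OF f] borel_measurable_integrable[OF g]
  show "(\<lambda>(x, y). f x * g y) \<in> borel_measurable (M1 \<Otimes>\<^sub>M M2)" by measurable
  show "integrable M1 (\<lambda>x. \<integral>y. norm (case (x, y) of (x, y) \<Rightarrow> f x * g y) \<partial>M2)"
    using f by (simp add: mult)
  show "AE x in M1. integrable M2 (\<lambda>y. case (x, y) of (x, y) \<Rightarrow> f x * g y)"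
    using g by simp
qed

lemma integrable_bounded_mult:
  fixes f g :: "_ \<Rightarrow> complex"
  assumes g: "integrable M g" and f: "f \<in> borel_measurable M"
    and le: "\<And>t. t \<in> space M \<Longrightarrow> norm (f t) \<le> C"
  shows "integrable M (\<lambda>t. f t * g t)"
proof (rule Bochner_Integration.integrable_bound)
  show "integrable M (\<lambda>t. C * norm (g t))" using g by simp
  show "(\<lambda>t. f t * g t) \<in> borel_measurable M"
    using f borel_measurable_integrable[OF g] by measurable
  show "AE t in M. norm (f t * g t) \<le> norm (C * norm (g t))"
    using le by (intro AE_I2) (force simp: norm_mult abs_mult intro!: mult_right_mono)
qed

lemma measurable_lebesgue_on_continuous:
  "continuous_on UNIV f \<Longrightarrow> f \<in> borel_measurable (lebesgue_on S)"
  for f :: "real \<Rightarrow> 'b::euclidean_space"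
  by (rule measurable_restrict_space1) (rule measurable_completion, simp add: borel_measurable_continuous_onI)

lemma norm_exp_mult_of_real: "cmod (lexp \<mu> t) = exp (- (Re \<mu> * t))"
  by (simp add: norm_exp_eq_Re)

lemma integrable_laplace_kernel:
  fixes g :: "real \<Rightarrow> complex"
  assumes g: "integrable (lebesgue_on {0..b}) g"
  shows "integrable (lebesgue_on {0..b}) (\<lambda>t. lexp \<mu> t * g t)"
proof (rule integrable_bounded_mult[OF g])
  show "(\<lambda>t. lexp \<mu> t) \<in> borel_measurable (lebesgue_on {0..b})"
    by (intro measurable_lebesgue_on_continuous continuous_intros)
  fix t assume "t \<in> space (lebesgue_on {0..b})"
  then have t: "0 \<le> t" "t \<le> b" by auto
  have "- (Re \<mu> * t) \<le> \<bar>Re \<mu>\<bar> * t" using t by (metis abs_ge_minus_self mult_minus_left mult_right_mono)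
  also have "\<dots> \<le> \<bar>Re \<mu>\<bar> * b" using t by (intro mult_left_mono) auto
  finally show "norm (lexp \<mu> t) \<le> exp (\<bar>Re \<mu>\<bar> * b)"
    by (simp add: norm_exp_mult_of_real)
qed

text \<open>Written with \<nu> as a factor rather than a divisor, so that \<nu> = 0 needs no
  separate case.\<close>

lemma integral_exp_interval:
  fixes \<nu> :: complex
  assumes "t \<le> b"
  shows "\<nu> * (\<integral>x. lexp \<nu> x \<partial>lebesgue_on {t..b}) = lexp \<nu> t - lexp \<nu> b"
proof -
  have "((\<lambda>x. \<nu> * lexp \<nu> x) has_integral (- lexp \<nu> b - - lexp \<nu> t)) {t..b}"
  proof (rule fundamental_theorem_of_calculus[OF assms])
    fix x
    have "((\<lambda>z. - exp (- (\<nu> * z))) has_field_derivative \<nu> * lexp \<nu> x) (at (of_real x))"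
      by (auto intro!: derivative_eq_intros)
    then show "((\<lambda>x. - lexp \<nu> x) has_vector_derivative \<nu> * lexp \<nu> x) (at x within {t..b})"
      by (rule has_vector_derivative_real_field)
  qed
  moreover have "integrable (lebesgue_on {t..b}) (\<lambda>x. \<nu> * lexp \<nu> x)"
    by (intro continuous_imp_integrable_real continuous_intros)
  ultimately have "(\<integral>x. \<nu> * lexp \<nu> x \<partial>lebesgue_on {t..b}) = lexp \<nu> t - lexp \<nu> b"
    by (subst lebesgue_integral_eq_integral) (auto simp: integral_unique simp del: Henstock_Kurzweil_Integration.integral_mult_right)
  then show ?thesis by (simp only: integral_mult_right_zero)
qed

section \<open>Conditionally convergent transforms: integration by parts, half-planes of
  convergence, holomorphy\<close>

text \<open>Integration by parts against the indefinite integral of a function that is merely locally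
  integrable, as an instance of Fubini's theorem on the triangle \<open>0 \<le> t \<le> x \<le> b\<close>.\<close>

lemma laplace_partial_by_parts:
  assumes g: "locally_integrable g" and b: "b \<ge> 0"
  shows "laplace_partial g \<mu> b = exp (- ((\<mu> - \<mu>\<^sub>0) * of_real b)) * laplace_partial g \<mu>\<^sub>0 b
    + (\<mu> - \<mu>\<^sub>0) * (\<integral>x. exp (- ((\<mu> - \<mu>\<^sub>0) * of_real x)) * laplace_partial g \<mu>\<^sub>0 x \<partial>lebesgue_on {0..b})"
proof -
  define \<nu> where "\<nu> = \<mu> - \<mu>\<^sub>0"
  define h where "h t = exp (- (\<mu>\<^sub>0 * of_real t)) * g t" for t
  let ?M = "lebesgue_on {0..b}"
  interpret pair_sigma_finite ?M ?M by (rule pair_sigma_finite_lebesgue_on) auto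
  have h: "integrable ?M h"
    using g b unfolding h_def by (intro integrable_laplace_kernel) (auto simp: locally_integrable_def)
  have e: "integrable ?M (\<lambda>x. lexp \<nu> x)"
    by (intro continuous_imp_integrable_real continuous_intros)
  \<comment> \<open>The integrand on the triangle t \<le> x. Integrating t first produces the
    partial transform at x; integrating x first produces
    \<open>lexp \<nu> t - lexp \<nu> b\<close>.\<close>
  define F where "F x t = indicator {..x} t *\<^sub>R (lexp \<nu> x * h t)" for x t
  have [measurable]: "(\<lambda>t. t) \<in> borel_measurable ?M"
    by (intro measurable_lebesgue_on_continuous continuous_intros)
  have "integrable (?M \<Otimes>\<^sub>M ?M) (\<lambda>z. indicator {z \<in> space (?M \<Otimes>\<^sub>M ?M). snd z \<le> fst z} z *\<^sub>R
      (case z of (x, t) \<Rightarrow> lexp \<nu> x * h t))"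
    by (intro integrable_mult_indicator integrable_product e h) (auto simp: norm_mult)
  also have "?this \<longleftrightarrow> integrable (?M \<Otimes>\<^sub>M ?M) (case_prod F)"
    by (intro Bochner_Integration.integrable_cong) (auto simp: F_def space_pair_measure split: split_indicator)
  finally have fubini: "(\<integral>t. (\<integral>x. F x t \<partial>?M) \<partial>?M) = (\<integral>x. (\<integral>t. F x t \<partial>?M) \<partial>?M)"
    by (rule Fubini_integral)
  have inner: "(\<integral>x. (\<integral>t. F x t \<partial>?M) \<partial>?M) = (\<integral>x. lexp \<nu> x * laplace_partial g \<mu>\<^sub>0 x \<partial>?M)"
  proof (rule Bochner_Integration.integral_cong[OF refl])
    fix x assume "x \<in> space ?M"
    then have x: "x \<in> {0..b}" by simp
    have "(\<integral>t. F x t \<partial>?M) = (\<integral>t. lexp \<nu> x * (indicator {0..x} t *\<^sub>R h t) \<partial>?M)"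
      by (intro Bochner_Integration.integral_cong) (auto simp: F_def split: split_indicator)
    also have "\<dots> = lexp \<nu> x * (\<integral>t. h t \<partial>lebesgue_on {0..x})"
      using x by (subst integral_lebesgue_on_subset[of "{0..x}" "{0..b}"]) (auto simp del: mult_scaleR_right)
    finally show "(\<integral>t. F x t \<partial>?M) = lexp \<nu> x * laplace_partial g \<mu>\<^sub>0 x"
      by (simp add: laplace_partial_def h_def)
  qed
  have "\<nu> * (\<integral>x. lexp \<nu> x * laplace_partial g \<mu>\<^sub>0 x \<partial>?M) = (\<integral>t. \<nu> * (\<integral>x. F x t \<partial>?M) \<partial>?M)"
    by (simp only: integral_mult_right_zero fubini inner)
  also have "\<dots> = (\<integral>t. lexp \<mu> t * g t - lexp \<nu> b * h t \<partial>?M)"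
  proof (rule Bochner_Integration.integral_cong[OF refl])
    fix t assume "t \<in> space ?M"
    then have t: "t \<in> {0..b}" by simp
    have "(\<integral>x. F x t \<partial>?M) = (\<integral>x. (indicator {t..b} x *\<^sub>R lexp \<nu> x) * h t \<partial>?M)"
      by (intro Bochner_Integration.integral_cong) (auto simp: F_def split: split_indicator)
    also have "\<dots> = (\<integral>x. lexp \<nu> x \<partial>lebesgue_on {t..b}) * h t"
      using t by (subst integral_lebesgue_on_subset[of "{t..b}" "{0..b}"]) (auto simp del: mult_scaleR_left)
    finally have "\<nu> * (\<integral>x. F x t \<partial>?M) = (lexp \<nu> t - lexp \<nu> b) * h t"
      using integral_exp_interval[of t b \<nu>] t by (simp add: mult.assoc[symmetric])
    also have "\<dots> = lexp \<mu> t * g t - lexp \<nu> b * h t"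
      by (simp add: h_def \<nu>_def left_diff_distrib mult.assoc[symmetric] exp_add[symmetric] algebra_simps)
    finally show "\<nu> * (\<integral>x. F x t \<partial>?M) = lexp \<mu> t * g t - lexp \<nu> b * h t" .
  qed
  also have "\<dots> = laplace_partial g \<mu> b - lexp \<nu> b * laplace_partial g \<mu>\<^sub>0 b"
    using g b h integrable_laplace_kernel[of b g \<mu>]
    by (simp add: laplace_partial_def h_def[symmetric] locally_integrable_def)
  finally show ?thesis by (simp add: \<nu>_def)
qed

lemma continuous_on_atLeast0_I:
  fixes f :: "real \<Rightarrow> 'a::topological_space"
  assumes "\<And>b. b \<ge> 0 \<Longrightarrow> continuous_on {0..b} f"
  shows "continuous_on {0..} f"
  unfolding continuous_on_eq_continuous_within
proof
  fix x :: real assume x: "x \<in> {0..}"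
  have "continuous (at x within {0..x + 1}) f"
    using assms[of "x + 1"] x by (auto simp: continuous_on_eq_continuous_within)
  moreover have "at x within {0..x + 1} = at x within {0..}"
    using x by (intro at_within_nhd[of _ "{x - 1<..<x + 1}"]) auto
  ultimately show "continuous (at x within {0..}) f" by simp
qed

lemma continuous_on_laplace_partial:
  assumes "locally_integrable g"
  shows "continuous_on {0..} (laplace_partial g \<mu>)"
  unfolding laplace_partial_def
  using assms by (intro continuous_on_atLeast0_I indefinite_integral_continuous_real integrable_laplace_kernel)
    (auto simp: locally_integrable_def)

text \<open>Far out the limit gives the bound, on the remaining compact interval continuity does.
  Boundedness is what survives of conditional convergence, and it makes the integral left by
  integration by parts absolutely convergent.\<close>

lemma bounded_laplace_partial:
  assumes g: "locally_integrable g" and ex: "laplace_exists g \<mu>"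
  obtains C where "C \<ge> 0" "\<And>x. x \<ge> 0 \<Longrightarrow> cmod (laplace_partial g \<mu> x) \<le> C"
proof -
  obtain L where L: "(laplace_partial g \<mu> \<longlongrightarrow> L) at_top" using ex by (auto simp: laplace_exists_def)
  have "eventually (\<lambda>x. cmod (laplace_partial g \<mu> x - L) < 1) at_top"
    using tendstoD[OF L, of 1] by (simp add: dist_norm)
  then obtain B where B: "\<And>x. x \<ge> B \<Longrightarrow> cmod (laplace_partial g \<mu> x - L) < 1"
    by (auto simp: eventually_at_top_linorder)
  have "bounded (laplace_partial g \<mu> ` {0..B})"
    by (intro compact_imp_bounded compact_continuous_image continuous_on_subset[OF continuous_on_laplace_partial[OF g]]) auto
  then obtain D where D: "\<And>x. x \<in> {0..B} \<Longrightarrow> cmod (laplace_partial g \<mu> x) \<le> D"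
    unfolding bounded_iff by (metis image_eqI)
  show thesis
  proof (rule that[of "max D (cmod L + 1)"])
    show "max D (cmod L + 1) \<ge> 0" by (simp add: max.coboundedI2)
    fix x :: real assume "x \<ge> 0"
    show "cmod (laplace_partial g \<mu> x) \<le> max D (cmod L + 1)"
    proof (cases "x \<le> B")
      case True
      then show ?thesis using D[of x] \<open>x \<ge> 0\<close> by auto
    next
      case False
      then show ?thesis using B[of x] norm_triangle_ineq2[of "laplace_partial g \<mu> x" L] by simp
    qed
  qed
qed

lemma tendsto_integral_lebesgue_on_atLeast0:
  fixes f :: "real \<Rightarrow> 'b::{banach, second_countable_topology}"
  assumes f: "integrable (lebesgue_on {0..}) f"
  shows "((\<lambda>b. \<integral>t. f t \<partial>lebesgue_on {0..b}) \<longlongrightarrow> (\<integral>t. f t \<partial>lebesgue_on {0..})) at_top"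
proof -
  have "((\<lambda>b. \<integral>t. indicator {0..b} t *\<^sub>R f t \<partial>lebesgue_on {0..}) \<longlongrightarrow> (\<integral>t. f t \<partial>lebesgue_on {0..})) at_top"
  proof (rule integral_dominated_convergence_at_top[where w = "\<lambda>t. norm (f t)"])
    show "f \<in> borel_measurable (lebesgue_on {0..})" using f by simp
    show "(\<lambda>t. indicator {0..b} t *\<^sub>R f t) \<in> borel_measurable (lebesgue_on {0..})" for b
    proof -
      have [measurable]: "{0..b} \<inter> {0..} \<in> sets (lebesgue_on {0..})" by (auto simp: sets_restrict_space_iff)
      have "(\<lambda>t. indicator ({0..b} \<inter> {0..}) t *\<^sub>R f t) \<in> borel_measurable (lebesgue_on {0..})"
        using f by measurable
      then show ?thesis by (simp add: Int_absorb2 subset_iff)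
    qed
    show "integrable (lebesgue_on {0..}) (\<lambda>t. norm (f t))" using f by simp
    show "AE x in lebesgue_on {0..}. ((\<lambda>b. indicator {0..b} x *\<^sub>R f x) \<longlongrightarrow> f x) at_top"
    proof (rule AE_I2)
      fix x :: real assume "x \<in> space (lebesgue_on {0..})"
      then have "eventually (\<lambda>b. indicator {0..b} x *\<^sub>R f x = f x) at_top"
        by (intro eventually_mono[OF eventually_ge_at_top[of x]]) auto
      then show "((\<lambda>b. indicator {0..b} x *\<^sub>R f x) \<longlongrightarrow> f x) at_top"
        by (rule tendsto_eventually)
    qed
    show "\<forall>\<^sub>F b in at_top. AE x in lebesgue_on {0..}. norm (indicator {0..b} x *\<^sub>R f x) \<le> norm (f x)"
      by (auto split: split_indicator)
  qed
  moreover have "(\<integral>t. indicator {0..b} t *\<^sub>R f t \<partial>lebesgue_on {0..}) = (\<integral>t. f t \<partial>lebesgue_on {0..b})" for b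
    by (rule integral_lebesgue_on_subset[symmetric]) auto
  ultimately show ?thesis by simp
qed

lemma integrable_exp_neg_atLeast0:
  fixes c :: real
  assumes "c > 0"
  shows "integrable (lebesgue_on {0..}) (\<lambda>t. exp (- (c * t)))"
proof (rule absolutely_integrable_imp_integrable)
  show "(\<lambda>t. exp (- (c * t))) absolutely_integrable_on {0..}"
    using has_integral_exp_minus_to_infinity[OF assms, of 0]
    by (intro nonnegative_absolutely_integrable_1) (auto simp: integrable_on_def)
qed auto

lemma integrable_bounded_laplace_kernel:
  fixes f :: "real \<Rightarrow> complex"
  assumes f: "f \<in> borel_measurable (lebesgue_on {0..})" and le: "\<And>t. t \<ge> 0 \<Longrightarrow> cmod (f t) \<le> C * exp (\<omega> * t)"
    and "Re \<mu> > \<omega>"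
  shows "integrable (lebesgue_on {0..}) (\<lambda>t. lexp \<mu> t * f t)"
proof (rule Bochner_Integration.integrable_bound)
  show "integrable (lebesgue_on {0..}) (\<lambda>t. C * exp (- ((Re \<mu> - \<omega>) * t)))"
    using assms by (intro integrable_mult_right integrable_exp_neg_atLeast0) auto
  show "(\<lambda>t. lexp \<mu> t * f t) \<in> borel_measurable (lebesgue_on {0..})"
    by (intro borel_measurable_times f measurable_lebesgue_on_continuous continuous_intros)
  show "AE t in lebesgue_on {0..}. norm (lexp \<mu> t * f t) \<le> norm (C * exp (- ((Re \<mu> - \<omega>) * t)))"
  proof (rule AE_I2)
    fix t :: real assume "t \<in> space (lebesgue_on {0..})"
    then have "norm (lexp \<mu> t * f t) \<le> exp (- (Re \<mu> * t)) * (C * exp (\<omega> * t))"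
      using le[of t] by (simp add: norm_mult norm_exp_mult_of_real)
    also have "\<dots> = C * exp (- ((Re \<mu> - \<omega>) * t))"
      by (simp add: exp_add[symmetric] algebra_simps)
    finally show "norm (lexp \<mu> t * f t) \<le> norm (C * exp (- ((Re \<mu> - \<omega>) * t)))" by simp
  qed
qed

lemma measurable_lebesgue_on_continuous_on:
  fixes f :: "real \<Rightarrow> 'b::euclidean_space"
  shows "continuous_on S f \<Longrightarrow> S \<in> sets lebesgue \<Longrightarrow> f \<in> borel_measurable (lebesgue_on S)"
  by (rule continuous_imp_measurable_on_sets_lebesgue)

text \<open>The boundary term is a bounded factor times a decaying exponential and vanishes in the
  limit, while the remaining integrals converge absolutely.\<close>

lemma laplace_by_parts:
  assumes g: "locally_integrable g" and ex: "laplace_exists g \<mu>\<^sub>0" and "Re \<mu>\<^sub>0 < Re \<mu>"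
  shows "(laplace_partial g \<mu> \<longlongrightarrow> (\<mu> - \<mu>\<^sub>0) *
      (\<integral>x. exp (- ((\<mu> - \<mu>\<^sub>0) * of_real x)) * laplace_partial g \<mu>\<^sub>0 x \<partial>lebesgue_on {0..})) at_top"
proof -
  define \<nu> where "\<nu> = \<mu> - \<mu>\<^sub>0"
  have \<nu>: "Re \<nu> > 0" using assms by (simp add: \<nu>_def)
  let ?K = "laplace_partial g \<mu>\<^sub>0"
  obtain C where C: "C \<ge> 0" "\<And>x. x \<ge> 0 \<Longrightarrow> cmod (?K x) \<le> C"
    using bounded_laplace_partial[OF g ex] by blast
  have int: "integrable (lebesgue_on {0..}) (\<lambda>x. lexp \<nu> x * ?K x)"
    using C(2) \<nu> by (intro integrable_bounded_laplace_kernel[of _ C 0] measurable_lebesgue_on_continuous_on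
        continuous_on_laplace_partial[OF g]) auto
  have "((\<lambda>b. lexp \<nu> b * ?K b) \<longlongrightarrow> 0) at_top"
  proof (rule Lim_null_comparison)
    show "eventually (\<lambda>b. norm (lexp \<nu> b * ?K b) \<le> exp (- (Re \<nu> * b)) * C) at_top"
      using eventually_ge_at_top[of 0]
      by eventually_elim (simp add: norm_mult norm_exp_mult_of_real C mult_left_mono)
    have "((\<lambda>b. exp (- (Re \<nu> * b)) * C) \<longlongrightarrow> 0 * C) at_top"
      using \<nu> by (intro tendsto_mult tendsto_const filterlim_compose[OF exp_at_bot]
          filterlim_compose[OF filterlim_uminus_at_bot_at_top] filterlim_tendsto_pos_mult_at_top[OF tendsto_const] filterlim_ident)
    then show "((\<lambda>b. exp (- (Re \<nu> * b)) * C) \<longlongrightarrow> 0) at_top" by simp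
  qed
  then have "((\<lambda>b. lexp \<nu> b * ?K b + \<nu> * (\<integral>x. lexp \<nu> x * ?K x \<partial>lebesgue_on {0..b}))
      \<longlongrightarrow> 0 + \<nu> * (\<integral>x. lexp \<nu> x * ?K x \<partial>lebesgue_on {0..})) at_top"
    by (intro tendsto_intros tendsto_integral_lebesgue_on_atLeast0 int)
  then have lim: "((\<lambda>b. lexp \<nu> b * ?K b + \<nu> * (\<integral>x. lexp \<nu> x * ?K x \<partial>lebesgue_on {0..b}))
      \<longlongrightarrow> \<nu> * (\<integral>x. lexp \<nu> x * ?K x \<partial>lebesgue_on {0..})) at_top" by simp
  show ?thesis unfolding \<nu>_def[symmetric]
  proof (rule Lim_transform_eventually[OF lim])
    show "\<forall>\<^sub>F b in at_top. lexp \<nu> b * ?K b + \<nu> * (\<integral>x. lexp \<nu> x * ?K x \<partial>lebesgue_on {0..b})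
        = laplace_partial g \<mu> b"
      using eventually_ge_at_top[of 0]
      by eventually_elim (simp add: \<nu>_def laplace_partial_by_parts[OF g, of _ \<mu> \<mu>\<^sub>0])
  qed
qed

lemma laplace_eqI: "(laplace_partial g \<mu> \<longlongrightarrow> L) at_top \<Longrightarrow> laplace g \<mu> = L"
  unfolding laplace_def by (rule tendsto_Lim) simp_all

lemma tendsto_laplace: "laplace_exists g \<mu> \<Longrightarrow> (laplace_partial g \<mu> \<longlongrightarrow> laplace g \<mu>) at_top"
  using laplace_eqI by (auto simp: laplace_exists_def)

lemma laplace_exists_mono:
  assumes "locally_integrable g" "laplace_exists g \<mu>\<^sub>0" "Re \<mu>\<^sub>0 < Re \<mu>"
  shows "laplace_exists g \<mu>"
  using laplace_by_parts[OF assms] by (auto simp: laplace_exists_def)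

lemma laplace_exists_abs:
  assumes g: "locally_integrable g" and "laplace_abs g \<le> ereal \<omega>" "\<omega> < Re \<mu>"
  shows "laplace_exists g \<mu>"
proof -
  have "laplace_abs g < ereal (Re \<mu>)" using assms by (auto intro: le_less_trans)
  then obtain \<mu>\<^sub>0 where "laplace_exists g \<mu>\<^sub>0" "Re \<mu>\<^sub>0 < Re \<mu>"
    by (auto simp: laplace_abs_def INF_less_iff)
  then show ?thesis using laplace_exists_mono[OF g] by blast
qed


text \<open>Differentiation under the integral sign with an explicit error: the second-order Taylor
  remainder of the exponential bounds the deviation of the difference quotient by
  \<open>cmod h * B\<close>.\<close>

lemma laplace_integral_holomorphic:
  fixes f :: "real \<Rightarrow> complex"
  assumes int: "\<And>\<sigma>. \<sigma> > \<sigma>\<^sub>0 \<Longrightarrow> integrable (lebesgue_on {0..}) (\<lambda>t. exp (- (of_real \<sigma> * of_real t)) * f t)"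
  shows "(\<lambda>\<mu>. \<integral>t. lexp \<mu> t * f t \<partial>lebesgue_on {0..}) holomorphic_on {\<mu>. Re \<mu> > \<sigma>\<^sub>0}"
    (is "?\<Phi> holomorphic_on _")
proof -
  let ?M = "lebesgue_on {0..} :: real measure"
  have cm: "k \<in> borel_measurable ?M" if "continuous_on UNIV k" for k :: "real \<Rightarrow> complex"
    using that by (rule measurable_lebesgue_on_continuous)
  \<comment> \<open>Measurability of f itself is recovered from that of a weighted f by cancelling
    the exponential.\<close>
  have "(\<lambda>t. exp (of_real (\<sigma>\<^sub>0 + 1) * of_real t) * (exp (- (of_real (\<sigma>\<^sub>0 + 1) * of_real t)) * f t)) \<in> borel_measurable ?M"
    by (intro borel_measurable_times[OF cm borel_measurable_integrable[OF int]] continuous_intros) auto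
  then have f[measurable]: "f \<in> borel_measurable ?M"
    by (simp add: mult.assoc[symmetric] exp_add[symmetric])
  have dom: "integrable ?M (\<lambda>t. k t * f t)"
    if "continuous_on UNIV k" "\<sigma> > \<sigma>\<^sub>0" "\<And>t. t \<ge> 0 \<Longrightarrow> cmod (k t) \<le> C * exp (- (\<sigma> * t))" for k \<sigma> C
  proof (rule Bochner_Integration.integrable_bound)
    show "integrable ?M (\<lambda>t. C * norm (exp (- (of_real \<sigma> * of_real t)) * f t))"
      using int[OF that(2)] by simp
    show "(\<lambda>t. k t * f t) \<in> borel_measurable ?M" by (intro borel_measurable_times cm that f)
    show "AE t in ?M. norm (k t * f t) \<le> norm (C * norm (exp (- (of_real \<sigma> * of_real t)) * f t))"
    proof (rule AE_I2)
      fix t :: real assume "t \<in> space ?M"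
      then have "norm (k t * f t) \<le> (C * exp (- (\<sigma> * t))) * norm (f t)"
        using that(3)[of t] by (simp add: norm_mult mult_right_mono)
      also have "\<dots> = C * norm (exp (- (of_real \<sigma> * of_real t)) * f t)"
        by (simp add: norm_mult norm_exp_mult_of_real)
      finally show "norm (k t * f t) \<le> norm (C * norm (exp (- (of_real \<sigma> * of_real t)) * f t))" by simp
    qed
  qed
  have ker: "integrable ?M (\<lambda>t. lexp \<mu> t * f t)" if "Re \<mu> > \<sigma>\<^sub>0" for \<mu>
    using that by (intro dom[where \<sigma> = "Re \<mu>" and C = 1] continuous_intros) (auto simp: norm_exp_mult_of_real)
  have "\<exists>D. (?\<Phi> has_field_derivative D) (at \<mu>)" if \<mu>: "Re \<mu> > \<sigma>\<^sub>0" for \<mu>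
  proof -
    \<comment> \<open>The distance to the boundary line is split in three: one \<delta> absorbs the
      perturbation h, one the factor t squared, and the last keeps \<sigma> inside the region of
      integrability.\<close>
    define \<delta> where "\<delta> = (Re \<mu> - \<sigma>\<^sub>0) / 3"
    have \<delta>: "\<delta> > 0" using \<mu> by (simp add: \<delta>_def)
    define \<sigma> where "\<sigma> = Re \<mu> - 2 * \<delta>"
    have \<sigma>: "\<sigma> > \<sigma>\<^sub>0" using \<mu> by (simp add: \<sigma>_def \<delta>_def field_simps)
    have quad: "t\<^sup>2 \<le> 2 / \<delta>\<^sup>2 * exp (\<delta> * t)" if "t \<ge> 0" for t
    proof -
      have "(\<delta> * t)\<^sup>2 / 2 \<le> exp (\<delta> * t)"
        using exp_lower_Taylor_quadratic[of "\<delta> * t"] mult_nonneg_nonneg[of \<delta> t] that \<delta> by linarith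
      then show ?thesis using \<delta> by (simp add: field_simps power_mult_distrib)
    qed
    have lin: "t \<le> 1 / \<delta> * exp (\<delta> * t)" if "t \<ge> 0" for t
    proof -
      have "\<delta> * t \<le> exp (\<delta> * t)" using exp_ge_add_one_self[of "\<delta> * t"] by linarith
      then show ?thesis using \<delta> by (simp add: field_simps)
    qed
    define D where "D = (\<integral>t. (- of_real t * lexp \<mu> t) * f t \<partial>?M)"
    define B where "B = (\<integral>t. 2 / \<delta>\<^sup>2 * norm (exp (- (of_real \<sigma> * of_real t)) * f t) \<partial>?M)"
    have D_int: "integrable ?M (\<lambda>t. (- of_real t * lexp \<mu> t) * f t)"
    proof (rule dom[OF _ \<sigma>, where C = "1 / \<delta>"])
      fix t :: real assume t: "t \<ge> 0"
      have "cmod (- of_real t * lexp \<mu> t) = t * exp (- (Re \<mu> * t))"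
        using t by (simp add: norm_mult norm_exp_mult_of_real)
      also have "\<dots> \<le> (1 / \<delta> * exp (\<delta> * t)) * exp (- (Re \<mu> * t))"
        using lin[OF t] by (intro mult_right_mono) auto
      also have "\<dots> = 1 / \<delta> * exp (- (\<sigma> * t) - \<delta> * t)"
        by (simp add: \<sigma>_def exp_add[symmetric] algebra_simps)
      also have "\<dots> \<le> 1 / \<delta> * exp (- (\<sigma> * t))"
        using \<delta> t by (intro mult_left_mono) auto
      finally show "cmod (- of_real t * lexp \<mu> t) \<le> 1 / \<delta> * exp (- (\<sigma> * t))" .
    qed (intro continuous_intros)
    have est: "cmod (?\<Phi> (\<mu> + h) - ?\<Phi> \<mu> - h * D) \<le> (cmod h)\<^sup>2 * B" if h: "cmod h \<le> \<delta>" for h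
    proof -
      have "Re (\<mu> + h) > \<sigma>\<^sub>0"
        using h abs_Re_le_cmod[of h] \<mu> \<delta> by (simp add: \<delta>_def abs_le_iff)
      note int_h = ker[OF this]
      have \<Phi>_eq: "?\<Phi> (\<mu> + h) - ?\<Phi> \<mu> - h * D = (\<integral>t. exp (- ((\<mu> + h) * of_real t)) * f t - lexp \<mu> t * f t
          - h * ((- of_real t * lexp \<mu> t) * f t) \<partial>?M)"
        unfolding D_def using int_h ker[OF \<mu>] D_int
        by (subst Bochner_Integration.integral_diff Bochner_Integration.integral_mult_right_zero; simp)+
      have "cmod (?\<Phi> (\<mu> + h) - ?\<Phi> \<mu> - h * D) \<le> (\<integral>t. (cmod h)\<^sup>2 * (2 / \<delta>\<^sup>2 * norm (exp (- (of_real \<sigma> * of_real t)) * f t)) \<partial>?M)"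
        unfolding \<Phi>_eq
      proof (rule Bochner_Integration.integral_norm_bound_integral)
        show "integrable ?M (\<lambda>t. exp (- ((\<mu> + h) * of_real t)) * f t - lexp \<mu> t * f t
          - h * ((- of_real t * lexp \<mu> t) * f t))"
          by (intro Bochner_Integration.integrable_diff integrable_mult_right int_h ker[OF \<mu>] D_int)
        show "integrable ?M (\<lambda>t. (cmod h)\<^sup>2 * (2 / \<delta>\<^sup>2 * norm (exp (- (of_real \<sigma> * of_real t)) * f t)))"
          using int[OF \<sigma>] by simp
        fix t :: real assume "t \<in> space ?M"
        then have t: "t \<ge> 0" by simp
        define z where "z = - (h * of_real t)"
        have z: "cmod z = cmod h * t" using t by (simp add: z_def norm_mult)
        have "exp (- ((\<mu> + h) * of_real t)) = lexp \<mu> t * exp z"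
          by (simp add: z_def exp_add[symmetric] algebra_simps)
        then have eq: "exp (- ((\<mu> + h) * of_real t)) * f t - lexp \<mu> t * f t
            - h * ((- of_real t * lexp \<mu> t) * f t)
          = lexp \<mu> t * (exp z - (1 + z)) * f t"
          by (simp add: z_def algebra_simps)
        have taylor: "cmod (exp z - (1 + z)) \<le> exp (\<delta> * t) * ((cmod h)\<^sup>2 * (2 / \<delta>\<^sup>2 * exp (\<delta> * t)))"
        proof -
          have "cmod (exp z - (1 + z)) \<le> exp \<bar>Re z\<bar> * (cmod z)\<^sup>2"
            using Taylor_exp[of z 1] by (simp add: numeral_2_eq_2)
          also have "\<dots> \<le> exp (\<delta> * t) * ((cmod h)\<^sup>2 * t\<^sup>2)"
          proof (intro mult_mono)
            have "\<bar>Re z\<bar> \<le> cmod h * t" using abs_Re_le_cmod[of z] z by simp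
            also have "\<dots> \<le> \<delta> * t" using h t by (rule mult_right_mono)
            finally show "exp \<bar>Re z\<bar> \<le> exp (\<delta> * t)" by simp
          qed (simp_all add: z power_mult_distrib)
          also have "\<dots> \<le> exp (\<delta> * t) * ((cmod h)\<^sup>2 * (2 / \<delta>\<^sup>2 * exp (\<delta> * t)))"
            by (intro mult_left_mono quad t) auto
          finally show ?thesis .
        qed
        have "cmod (exp (- ((\<mu> + h) * of_real t)) * f t - lexp \<mu> t * f t
            - h * ((- of_real t * lexp \<mu> t) * f t))
          = exp (- (Re \<mu> * t)) * cmod (exp z - (1 + z)) * cmod (f t)"
          unfolding eq by (simp only: norm_mult norm_exp_mult_of_real)
        also have "\<dots> \<le> exp (- (Re \<mu> * t)) * (exp (\<delta> * t) * ((cmod h)\<^sup>2 * (2 / \<delta>\<^sup>2 * exp (\<delta> * t)))) * cmod (f t)"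
          by (intro mult_right_mono mult_left_mono taylor) auto
        also have "\<dots> = (cmod h)\<^sup>2 * (2 / \<delta>\<^sup>2) * (exp (- (Re \<mu> * t)) * exp (\<delta> * t) * exp (\<delta> * t)) * cmod (f t)"
          by (simp add: mult_ac)
        also have "exp (- (Re \<mu> * t)) * exp (\<delta> * t) * exp (\<delta> * t) = exp (- (\<sigma> * t))"
          by (simp add: \<sigma>_def exp_add[symmetric] algebra_simps)
        also have "(cmod h)\<^sup>2 * (2 / \<delta>\<^sup>2) * exp (- (\<sigma> * t)) * cmod (f t)
            = (cmod h)\<^sup>2 * (2 / \<delta>\<^sup>2 * norm (exp (- (of_real \<sigma> * of_real t)) * f t))"
          by (simp add: norm_mult norm_exp_mult_of_real)
        finally show "norm (exp (- ((\<mu> + h) * of_real t)) * f t - lexp \<mu> t * f t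
            - h * ((- of_real t * lexp \<mu> t) * f t)) \<le> (cmod h)\<^sup>2 * (2 / \<delta>\<^sup>2 * norm (exp (- (of_real \<sigma> * of_real t)) * f t))" .
      qed
      then show ?thesis unfolding B_def by (simp only: integral_mult_right_zero)
    qed
    have "((\<lambda>h. (?\<Phi> (\<mu> + h) - ?\<Phi> \<mu>) / h - D) \<longlongrightarrow> 0) (at 0)"
    proof (rule Lim_null_comparison)
      show "eventually (\<lambda>h. norm ((?\<Phi> (\<mu> + h) - ?\<Phi> \<mu>) / h - D) \<le> cmod h * B) (at 0)"
        unfolding eventually_at
      proof (intro exI[of _ \<delta>] conjI ballI impI \<delta>)
        fix h :: complex assume "h \<noteq> 0 \<and> dist h 0 < \<delta>"
        then have h: "h \<noteq> 0" "cmod h \<le> \<delta>" by auto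
        have "(?\<Phi> (\<mu> + h) - ?\<Phi> \<mu>) / h - D = (?\<Phi> (\<mu> + h) - ?\<Phi> \<mu> - h * D) / h"
          using h by (simp add: field_simps)
        also have "cmod \<dots> \<le> (cmod h)\<^sup>2 * B / cmod h"
          unfolding norm_divide by (intro divide_right_mono est h) auto
        also have "\<dots> = cmod h * B" using h by (simp add: power2_eq_square)
        finally show "norm ((?\<Phi> (\<mu> + h) - ?\<Phi> \<mu>) / h - D) \<le> cmod h * B" .
      qed
      show "((\<lambda>h. cmod h * B) \<longlongrightarrow> 0) (at 0)"
        using tendsto_mult[OF tendsto_norm[OF tendsto_ident_at[of "0::complex" UNIV]] tendsto_const[of B]] by simp
    qed
    then have "(?\<Phi> has_field_derivative D) (at \<mu>)"
      unfolding DERIV_def by (rule LIM_zero_cancel)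
    then show ?thesis by blast
  qed
  then show ?thesis
    unfolding holomorphic_on_def field_differentiable_def by (blast intro: has_field_derivative_at_within)
qed

text \<open>By parts, the transform equals \<mu> - \<open>\<mu>\<^sub>0\<close> times an absolutely
  convergent transform evaluated at \<mu> - \<open>\<mu>\<^sub>0\<close>, to which the preceding
  lemma applies.\<close>

lemma laplace_holomorphic:
  assumes g: "locally_integrable g" and ex: "laplace_exists g \<mu>\<^sub>0"
  shows "laplace g holomorphic_on {\<mu>. Re \<mu> > Re \<mu>\<^sub>0}"
proof -
  let ?K = "laplace_partial g \<mu>\<^sub>0"
  let ?\<Phi> = "\<lambda>\<mu>. \<integral>x. lexp \<mu> x * ?K x \<partial>lebesgue_on {0..}"
  obtain C where C: "C \<ge> 0" "\<And>x. x \<ge> 0 \<Longrightarrow> cmod (?K x) \<le> C"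
    using bounded_laplace_partial[OF g ex] by blast
  have "?\<Phi> holomorphic_on {\<mu>. Re \<mu> > 0}"
    by (intro laplace_integral_holomorphic integrable_bounded_laplace_kernel[of _ C 0]
        measurable_lebesgue_on_continuous_on continuous_on_laplace_partial[OF g]) (auto simp: C)
  then have "(?\<Phi> \<circ> (\<lambda>\<mu>. \<mu> - \<mu>\<^sub>0)) holomorphic_on {\<mu>. Re \<mu> > Re \<mu>\<^sub>0}"
    by (intro holomorphic_on_compose_gen[where t = "{\<mu>. Re \<mu> > 0}"] holomorphic_intros) auto
  then have "(\<lambda>\<mu>. (\<mu> - \<mu>\<^sub>0) * ?\<Phi> (\<mu> - \<mu>\<^sub>0)) holomorphic_on {\<mu>. Re \<mu> > Re \<mu>\<^sub>0}"
    by (intro holomorphic_intros) (simp add: comp_def)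
  then show ?thesis
    by (rule holomorphic_transform) (simp add: laplace_eqI[OF laplace_by_parts[OF g ex]])
qed

section \<open>Lerch's uniqueness theorem\<close>

text \<open>In the variable \<open>x = exp (- t)\<close> the hypothesis says that \<open>K\<close> is orthogonal to all polynomials,
  so Weierstrass approximation of \<open>x K (- ln x)\<close> applies.\<close>

lemma lerch_real:
  fixes K :: "real \<Rightarrow> real"
  assumes K: "continuous_on {0..} K" and C: "\<And>t. t \<ge> 0 \<Longrightarrow> \<bar>K t\<bar> \<le> C"
    and zero: "\<And>n::nat. (\<integral>t. exp (- (real (Suc n) * t)) * K t \<partial>lebesgue_on {0..}) = 0"
    and "t\<^sub>0 \<ge> 0"
  shows "K t\<^sub>0 = 0"
proof -
  let ?M = "lebesgue_on {0..} :: real measure"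
  have C0: "C \<ge> 0" using C[of 0] by simp
  have int: "integrable ?M (\<lambda>t. k t * K t)" if k: "continuous_on {0..} k" "\<And>t. t \<ge> 0 \<Longrightarrow> \<bar>k t\<bar> \<le> B * exp (- (1 * t))" for k B
  proof (rule Bochner_Integration.integrable_bound)
    show "integrable ?M (\<lambda>t. B * C * exp (- (1 * t)))"
      by (intro integrable_mult_right integrable_exp_neg_atLeast0) simp
    show "(\<lambda>t. k t * K t) \<in> borel_measurable ?M"
      by (intro measurable_lebesgue_on_continuous_on continuous_intros K k) auto
    show "AE t in ?M. norm (k t * K t) \<le> norm (B * C * exp (- (1 * t)))"
    proof (rule AE_I2)
      fix t :: real assume "t \<in> space ?M"
      then have "\<bar>k t\<bar> * \<bar>K t\<bar> \<le> (B * exp (- (1 * t))) * C"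
        using k(2)[of t] C[of t] by (intro mult_mono) auto
      then have "norm (k t * K t) \<le> B * C * exp (- (1 * t))" by (simp add: abs_mult mult_ac)
      also have "\<dots> \<le> norm (B * C * exp (- (1 * t)))" by (simp only: real_norm_def abs_ge_self)
      finally show "norm (k t * K t) \<le> norm (B * C * exp (- (1 * t)))" .
    qed
  qed
  define K' where "K' t = K (max 0 t)" for t
  have K': "continuous_on UNIV K'" unfolding K'_def
    by (rule continuous_on_compose2[OF K]) (auto intro!: continuous_intros)
  have K'_eq: "K' t = K t" if "t \<ge> 0" for t using that by (simp add: K'_def)
  \<comment> \<open>As x tends to 0 the argument - ln x runs to infinity, where K need not converge;
    the factor x together with the bound C makes h continuous at 0.\<close>
  define h where "h x = (if x \<le> 0 then 0 else x * K' (- ln x))" for x :: real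
  have h: "continuous_on {0..1} h"
    unfolding continuous_on_eq_continuous_within
  proof
    fix x :: real assume x: "x \<in> {0..1}"
    show "continuous (at x within {0..1}) h"
    proof (cases "x = 0")
      case True
      have "(h \<longlongrightarrow> 0) (at 0 within {0..1})"
      proof (rule Lim_null_comparison)
        have "\<bar>h y\<bar> \<le> \<bar>y\<bar> * C" for y
        proof (cases "y \<le> 0")
          case True
          then have "h y = 0" by (simp add: h_def)
          then show ?thesis using C0 by (simp only: abs_zero) (intro mult_nonneg_nonneg abs_ge_zero)
        next
          case False
          then have "\<bar>h y\<bar> = \<bar>y\<bar> * \<bar>K (max 0 (- ln y))\<bar>" by (simp add: h_def K'_def abs_mult)
          then show ?thesis using C[of "max 0 (- ln y)"] by (simp add: mult_left_mono)
        qed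
        then show "eventually (\<lambda>y. norm (h y) \<le> \<bar>y\<bar> * C) (at 0 within {0..1})" by simp
        show "((\<lambda>y. \<bar>y\<bar> * C) \<longlongrightarrow> 0) (at 0 within {0..1})"
          using tendsto_mult[OF tendsto_rabs[OF tendsto_ident_at[of "0::real" "{0..1}"]] tendsto_const[of C]] by simp
      qed
      then show ?thesis by (simp add: True continuous_within h_def)
    next
      case False
      then have "x > 0" using x by simp
      have "continuous_on {0<..} (\<lambda>y. y * K' (- ln y))"
        by (intro continuous_intros continuous_on_compose2[OF K']) auto
      then have "continuous_on {0<..} h"
        by (rule continuous_on_eq) (auto simp: h_def)
      then have "isCont h x"
        using \<open>x > 0\<close> by (simp add: continuous_on_eq_continuous_at)
      then show ?thesis by (rule continuous_at_imp_continuous_within)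
    qed
  qed
  have h_exp: "h (exp (- t)) = exp (- t) * K t" if "t \<ge> 0" for t using that by (simp add: h_def K'_eq)
  define I where "I = (\<integral>t. exp (- (1 * t)) \<partial>?M)"
  \<comment> \<open>J is the integral of the square of \<open>exp (- t) * K t\<close>. Replacing one
    of the two factors by q (exp (- t)) gives an integral that is zero by hypothesis, so J is
    bounded by the approximation error.\<close>
  define J where "J = (\<integral>t. (exp (- t) * exp (- t) * K t) * K t \<partial>?M)"
  have J_int: "integrable ?M (\<lambda>t. (exp (- t) * exp (- t) * K t) * K t)"
  proof (rule int[where B = C])
    fix t :: real assume t: "t \<ge> 0"
    have "exp (- t) * (exp (- t) * \<bar>K t\<bar>) \<le> exp (- t) * (1 * C)"
      using t C[OF t] by (intro mult_left_mono mult_mono) auto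
    then show "\<bar>exp (- t) * exp (- t) * K t\<bar> \<le> C * exp (- (1 * t))" by (simp add: abs_mult mult_ac)
  qed (intro continuous_intros K)
  have "I \<ge> 0" unfolding I_def by (rule Bochner_Integration.integral_nonneg) auto
  have J_le: "J \<le> e * (C * I)" if e: "e > 0" for e
  proof -
    obtain q where q: "real_polynomial_function q" "\<And>x. x \<in> {0..1} \<Longrightarrow> \<bar>h x - q x\<bar> < e"
      using Stone_Weierstrass_real_polynomial_function[OF _ h e] by auto
    obtain c N where qc: "q = (\<lambda>x. \<Sum>i\<le>N. c i * x ^ i)"
      using q(1) by (auto simp: real_polynomial_function_iff_sum)
    have pow: "exp (- t) ^ i * exp (- t) = exp (- (real (Suc i) * t))" for t :: real and i
      by (simp add: exp_of_nat_mult[symmetric] exp_add[symmetric] algebra_simps)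
    have int_i: "integrable ?M (\<lambda>t. exp (- (real (Suc i) * t)) * K t)" for i
      by (rule int[where B = 1]) (auto intro!: continuous_intros simp: algebra_simps)
    \<comment> \<open>The additional factor exp (- t) raises every exponent by one; even the
      constant term of q is then covered by the hypothesis, which starts at exponent 1.\<close>
    have eq: "q (exp (- t)) * exp (- t) * K t = (\<Sum>i\<le>N. c i * (exp (- (real (Suc i) * t)) * K t))" for t
      by (simp only: qc sum_distrib_right pow[symmetric] mult.assoc)
    have q_int: "integrable ?M (\<lambda>t. q (exp (- t)) * exp (- t) * K t)"
      unfolding eq by (intro Bochner_Integration.integrable_sum integrable_mult_right int_i)
    have q0: "(\<integral>t. q (exp (- t)) * exp (- t) * K t \<partial>?M) = 0"
      unfolding eq by (subst Bochner_Integration.integral_sum) (auto intro: int_i simp: zero simp del: of_nat_Suc)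
    have "J = J - (\<integral>t. q (exp (- t)) * exp (- t) * K t \<partial>?M)" by (simp add: q0)
    also have "\<dots> = (\<integral>t. (exp (- t) * exp (- t) * K t) * K t - q (exp (- t)) * exp (- t) * K t \<partial>?M)"
      unfolding J_def by (rule Bochner_Integration.integral_diff[symmetric, OF J_int q_int])
    also have "\<dots> \<le> (\<integral>t. e * C * exp (- (1 * t)) \<partial>?M)"
    proof (rule integral_mono)
      show "integrable ?M (\<lambda>t. (exp (- t) * exp (- t) * K t) * K t - q (exp (- t)) * exp (- t) * K t)"
        by (rule Bochner_Integration.integrable_diff[OF J_int q_int])
      show "integrable ?M (\<lambda>t. e * C * exp (- (1 * t)))"
        by (intro integrable_mult_right integrable_exp_neg_atLeast0) simp
      fix t :: real assume "t \<in> space ?M"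
      then have t: "t \<ge> 0" by simp
      have "(exp (- t) * exp (- t) * K t) * K t - q (exp (- t)) * exp (- t) * K t
          = (h (exp (- t)) - q (exp (- t))) * (exp (- t) * K t)"
        by (simp add: h_exp[OF t] algebra_simps)
      also have "\<dots> \<le> \<bar>h (exp (- t)) - q (exp (- t))\<bar> * (exp (- t) * \<bar>K t\<bar>)"
        using abs_ge_self[of "(h (exp (- t)) - q (exp (- t))) * (exp (- t) * K t)"] by (simp add: abs_mult)
      also have "\<dots> \<le> e * (exp (- t) * C)"
        using q(2)[of "exp (- t)"] C[OF t] t e by (intro mult_mono mult_left_mono) auto
      finally show "(exp (- t) * exp (- t) * K t) * K t - q (exp (- t)) * exp (- t) * K t \<le> e * C * exp (- (1 * t))"
        by (simp add: mult_ac)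
    qed
    also have "\<dots> = e * (C * I)" by (simp add: I_def)
    finally show ?thesis .
  qed
  have "J \<le> 0"
  proof (rule field_le_epsilon)
    fix e :: real assume "e > 0"
    \<comment> \<open>Dividing by \<open>C * I + 1\<close> rather than \<open>C * I\<close> stays
      meaningful when the latter is 0.\<close>
    then have "J \<le> e / (C * I + 1) * (C * I)"
      using C0 \<open>I \<ge> 0\<close> by (intro J_le) (auto intro!: divide_pos_pos add_nonneg_pos)
    also have "\<dots> \<le> e / (C * I + 1) * (C * I + 1)"
      using C0 \<open>I \<ge> 0\<close> \<open>e > 0\<close> by (intro mult_left_mono) auto
    also have "\<dots> = e"
      using mult_nonneg_nonneg[OF C0 \<open>I \<ge> 0\<close>] by simp
    finally show "J \<le> 0 + e" by simp
  qed
  \<comment> \<open>The extra 1 makes the interval nondegenerate even if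
    \<open>t\<^sub>0 = 0\<close>.\<close>
  define b where "b = t\<^sub>0 + 1"
  let ?f = "\<lambda>t. (exp (- t) * exp (- t) * K t) * K t"
  have nonneg: "0 \<le> ?f t" for t by (simp add: mult.assoc zero_le_mult_iff)
  have cont: "continuous_on {0..b} ?f"
    by (intro continuous_intros continuous_on_subset[OF K]) auto
  have int_b: "integrable (lebesgue_on {0..b}) ?f" using cont by (rule continuous_imp_integrable_real)
  have "integral {0..b} ?f = (\<integral>t. ?f t \<partial>lebesgue_on {0..b})"
    using int_b by (simp add: lebesgue_integral_eq_integral)
  also have "\<dots> = (\<integral>t. indicator {0..b} t *\<^sub>R ?f t \<partial>?M)"
    by (rule integral_lebesgue_on_subset) auto
  also have "\<dots> \<le> J"
    unfolding J_def
  proof (rule integral_mono[OF _ J_int])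
    show "integrable ?M (\<lambda>t. indicator {0..b} t *\<^sub>R ?f t)"
      using int_b by (subst (asm) integrable_lebesgue_on_subset[of "{0..b}" "{0..}"]) auto
    show "indicator {0..b} t *\<^sub>R ?f t \<le> ?f t" for t
      using nonneg by (simp split: split_indicator)
  qed
  also have "J \<le> 0" by fact
  finally have "integral {0..b} ?f = 0"
    using nonneg integrable_on_lebesgue_on[OF int_b] by (intro antisym Henstock_Kurzweil_Integration.integral_nonneg) auto
  then have "(?f has_integral 0) (cbox 0 b)"
    using integrable_integral[OF integrable_on_lebesgue_on[OF int_b]] by simp
  then have "?f t\<^sub>0 = 0"
    using cont nonneg \<open>t\<^sub>0 \<ge> 0\<close> by (intro has_integral_0_cbox_imp_0[of 0 b ?f t\<^sub>0]) (auto simp: b_def)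
  then show ?thesis by simp
qed

text \<open>By parts relative to c, the transform of g at c + n + 1 is n + 1 times the transform of
  the bounded continuous function \<open>laplace_partial g (of_real c)\<close> at n + 1. The real
  case applies to its real and imaginary parts; g itself may be discontinuous, so the conclusion is
  about its partial transform.\<close>

lemma lerch:
  assumes g: "locally_integrable g" and ex: "laplace_exists g (of_real c)"
    and zero: "\<And>n::nat. laplace g (of_real (c + Suc n)) = 0" and "t \<ge> 0"
  shows "laplace_partial g (of_real c) t = 0"
proof -
  let ?K = "laplace_partial g (of_real c)"
  obtain C where C: "C \<ge> 0" "\<And>x. x \<ge> 0 \<Longrightarrow> cmod (?K x) \<le> C"
    using bounded_laplace_partial[OF g ex] by blast
  have eq: "exp (- (of_real (real (Suc n)) * of_real x)) = complex_of_real (exp (- (real (Suc n) * x)))" for n x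
    by (metis exp_of_real of_real_minus of_real_mult)
  have int: "integrable (lebesgue_on {0..}) (\<lambda>x. exp (- (of_real (real (Suc n)) * of_real x)) * ?K x)" for n
    using C by (intro integrable_bounded_laplace_kernel[of _ C 0]
        measurable_lebesgue_on_continuous_on continuous_on_laplace_partial[OF g]) auto
  have 0: "(\<integral>x. exp (- (of_real (real (Suc n)) * of_real x)) * ?K x \<partial>lebesgue_on {0..}) = 0" for n
    using laplace_eqI[OF laplace_by_parts[OF g ex, of "of_real (c + Suc n)"]] zero[of n]
    by (auto simp: of_nat_neq_0 simp del: of_nat_Suc)
  have "Re (?K t) = 0"
  proof (rule lerch_real[OF _ _ _ \<open>t \<ge> 0\<close>])
    show "continuous_on {0..} (\<lambda>x. Re (?K x))" by (intro continuous_intros continuous_on_laplace_partial g)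
    show "\<bar>Re (?K x)\<bar> \<le> C" if "x \<ge> 0" for x using abs_Re_le_cmod C(2)[OF that] order_trans by blast
    show "(\<integral>x. exp (- (real (Suc n) * x)) * Re (?K x) \<partial>lebesgue_on {0..}) = 0" for n
      using integral_Re[OF int[of n, unfolded eq]] 0[of n, unfolded eq] by (simp del: of_nat_Suc)
  qed
  moreover have "Im (?K t) = 0"
  proof (rule lerch_real[OF _ _ _ \<open>t \<ge> 0\<close>])
    show "continuous_on {0..} (\<lambda>x. Im (?K x))" by (intro continuous_intros continuous_on_laplace_partial g)
    show "\<bar>Im (?K x)\<bar> \<le> C" if "x \<ge> 0" for x using abs_Im_le_cmod C(2)[OF that] order_trans by blast
    show "(\<integral>x. exp (- (real (Suc n) * x)) * Im (?K x) \<partial>lebesgue_on {0..}) = 0" for n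
      using integral_Im[OF int[of n, unfolded eq]] 0[of n, unfolded eq] by (simp del: of_nat_Suc)
  qed
  ultimately show ?thesis by (simp add: complex_eq_iff)
qed

text \<open>The vanishing partial transform is a primitive of the weighted g. Working on
  \<open>{0..t + 1}\<close> gives its derivative a meaning at t = 0 as well.\<close>

lemma laplace_partial_eq_0_continuous:
  assumes g: "continuous_on {0..} g" and zero: "\<And>t. t \<ge> 0 \<Longrightarrow> laplace_partial g \<mu> t = 0" and t: "t \<ge> 0"
  shows "g t = 0"
proof -
  let ?h = "\<lambda>s. lexp \<mu> s * g s"
  have h: "continuous_on {0..t + 1} ?h"
    by (intro continuous_intros continuous_on_subset[OF g]) auto
  have "((\<lambda>u. integral {0..u} ?h) has_vector_derivative ?h t) (at t within {0..t + 1})"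
    using t by (intro integral_has_vector_derivative h) auto
  moreover have "integral {0..u} ?h = 0" if "u \<in> {0..t + 1}" for u
    using zero[of u] that continuous_imp_integrable_real[OF continuous_on_subset[OF h, of "{0..u}"]]
    by (simp add: laplace_partial_def lebesgue_integral_eq_integral)
  ultimately have "((\<lambda>u. 0) has_vector_derivative ?h t) (at t within {0..t + 1})"
    using t by (intro has_vector_derivative_transform[of t "{0..t + 1}" "\<lambda>u. 0" "\<lambda>u. integral {0..u} ?h"]) auto
  then have "?h t = 0"
    using t by (intro vector_derivative_unique_within_closed_interval[of 0 "t + 1" t "\<lambda>u. 0"]) auto
  then show ?thesis by simp
qed

text \<open>The counterpart for the merely locally integrable kernel: by Lebesgue differentiation,
  almost every value is a limit of averages over intervals to the right, and these averages vanish.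
  Extension by 0 provides the integrability over arbitrary boxes that the differentiation theorem
  asks for.\<close>

lemma laplace_partial_eq_0_AE:
  assumes g: "locally_integrable g" and zero: "\<And>t. t \<ge> 0 \<Longrightarrow> laplace_partial g \<mu> t = 0"
  shows "AE t in lebesgue_on {0..}. g t = 0"
proof -
  let ?h = "\<lambda>s. lexp \<mu> s * g s"
  define f where "f s = (if s \<ge> 0 then ?h s else 0)" for s
  have int: "integrable (lebesgue_on {0..b}) ?h" if "b \<ge> 0" for b
    using g that by (intro integrable_laplace_kernel) (auto simp: locally_integrable_def)
  have int0: "f integrable_on {0..b}" if "b \<ge> 0" for b
    by (rule integrable_eq[OF integrable_on_lebesgue_on[OF int[OF that]]]) (auto simp: f_def)
  have f_int: "f integrable_on cbox a b" for a b
  proof -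
    have "f integrable_on {min a 0..0}"
      by (rule integrable_spike_finite[of "{0}" _ _ "\<lambda>_. 0"]) (auto simp: f_def)
    then have "f integrable_on {min a 0..max b 0}"
      by (rule Henstock_Kurzweil_Integration.integrable_combine[rotated 2]) (auto intro: int0)
    then show ?thesis
      unfolding cbox_interval by (rule integrable_on_subinterval) auto
  qed
  have integral0: "integral {0..b} f = 0" if "b \<ge> 0" for b
  proof -
    have "integral {0..b} f = integral {0..b} ?h"
      by (intro Henstock_Kurzweil_Integration.integral_cong) (auto simp: f_def)
    then show ?thesis
      using zero[OF that] int[OF that] by (simp add: laplace_partial_def lebesgue_integral_eq_integral)
  qed
  obtain N where N: "negligible N" "\<And>x e. \<lbrakk>x \<notin> N; 0 < e\<rbrakk> \<Longrightarrow>
      \<exists>d>0. \<forall>h. 0 < h \<and> h < d \<longrightarrow> norm (integral (cbox x (x + h *\<^sub>R One)) f /\<^sub>R h ^ DIM(real) - f x) < e"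
    using integrable_ccontinuous_explicit[OF f_int] by blast
  have "g x = 0" if x: "x \<notin> N" "x \<ge> 0" for x
  proof -
    have "norm (f x) < e" if e: "e > 0" for e
    proof -
      obtain d where d: "d > 0" "\<And>h. 0 < h \<and> h < d \<Longrightarrow> norm (integral (cbox x (x + h *\<^sub>R One)) f /\<^sub>R h ^ DIM(real) - f x) < e"
        using N(2)[OF x(1) e] by blast
      have "integral {0..x} f + integral {x..x + d / 2} f = integral {0..x + d / 2} f"
        using x d(1) by (intro Henstock_Kurzweil_Integration.integral_combine int0) auto
      then have "integral {x..x + d / 2} f = 0"
        using integral0[of x] integral0[of "x + d / 2"] x d(1) by simp
      then show ?thesis using d(1) d(2)[of "d / 2"] by simp
    qed
    then have "f x = 0" by (metis less_irrefl zero_less_norm_iff)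
    then show ?thesis using x by (simp add: f_def)
  qed
  moreover have "AE x in lebesgue. x \<notin> N"
    using N(1) by (intro AE_not_in) (simp add: negligible_iff_null_sets)
  ultimately show ?thesis
    by (auto simp: AE_restrict_space_iff elim: eventually_mono)
qed

section \<open>Zeros of scalar transforms, and absolute convergence for the kernel\<close>

lemma fsigma_halfspace_Re_gt: "fsigma {\<mu>. r < Re \<mu>}"
proof -
  have "fsigma (\<Union>n::nat. {\<mu>. r + inverse (real (Suc n)) \<le> Re \<mu>})"
    by (intro fsigma.intros closed_halfspace_Re_ge)
  also have "(\<Union>n::nat. {\<mu>. r + inverse (real (Suc n)) \<le> Re \<mu>}) = {\<mu>. r < Re \<mu>}"
  proof (intro equalityI subsetI)
    fix \<mu> assume "\<mu> \<in> {\<mu>. r < Re \<mu>}"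
    then obtain n where "inverse (real (Suc n)) < Re \<mu> - r" using reals_Archimedean[of "Re \<mu> - r"] by auto
    then show "\<mu> \<in> (\<Union>n::nat. {\<mu>. r + inverse (real (Suc n)) \<le> Re \<mu>})" by (auto intro!: exI[of _ n])
  next
    fix \<mu> assume "\<mu> \<in> (\<Union>n::nat. {\<mu>. r + inverse (real (Suc n)) \<le> Re \<mu>})"
    then obtain n where "r + inverse (real (Suc n)) \<le> Re \<mu>" by auto
    moreover have "inverse (real (Suc n)) > 0" by simp
    ultimately have "r < Re \<mu>" by linarith
    then show "\<mu> \<in> {\<mu>. r < Re \<mu>}" by simp
  qed
  finally show ?thesis .
qed

text \<open>Nonconstant holomorphic functions have countably many zeros here and a nonzero constant
  has none. The constant 0 is excluded by Lerch, which would make g vanish almost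
  everywhere.\<close>

lemma countable_laplace_zeros:
  assumes g: "locally_integrable g" and ex: "laplace_exists g \<mu>\<^sub>0"
    and nz: "\<not> (AE t in lebesgue_on {0..}. g t = 0)"
  shows "countable {x. Re \<mu>\<^sub>0 < x \<and> laplace g (of_real x) = 0}"
proof -
  let ?H = "{\<mu>. Re \<mu> > Re \<mu>\<^sub>0}"
  have H: "open ?H" "connected ?H" "fsigma ?H"
    by (simp_all add: open_halfspace_Re_gt convex_connected convex_halfspace_Re_gt fsigma_halfspace_Re_gt)
  have "countable {\<mu> \<in> ?H. laplace g \<mu> = 0}"
  proof (cases "laplace g constant_on ?H")
    case False
    then show ?thesis
      by (intro holomorphic_countable_zeros laplace_holomorphic[OF g ex] H)
  next
    case True
    then obtain c where c: "\<And>\<mu>. \<mu> \<in> ?H \<Longrightarrow> laplace g \<mu> = c" by (auto simp: constant_on_def)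
    have "c \<noteq> 0"
    proof
      assume "c = 0"
      have "laplace_exists g (of_real (Re \<mu>\<^sub>0 + 1))"
        by (rule laplace_exists_mono[OF g ex]) simp
      then have "laplace_partial g (of_real (Re \<mu>\<^sub>0 + 1)) t = 0" if "t \<ge> 0" for t
        by (rule lerch[OF g _ _ that]) (subst c, auto simp: \<open>c = 0\<close>)
      then have "AE t in lebesgue_on {0..}. g t = 0" by (rule laplace_partial_eq_0_AE[OF g])
      then show False using nz by simp
    qed
    then have "{\<mu> \<in> ?H. laplace g \<mu> = 0} = {}" using c by auto
    then show ?thesis by (simp only: countable_empty)
  qed
  then have "countable (complex_of_real ` {x. Re \<mu>\<^sub>0 < x \<and> laplace g (of_real x) = 0})"
    by (rule countable_subset[rotated]) auto
  then show ?thesis by (rule countable_image_inj_on) (auto simp: inj_on_def)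
qed

text \<open>The bad starting points are the integer shifts of Z; their union is countable and cannot
  fill an interval.\<close>

lemma exists_progression_avoiding_countable:
  fixes Z :: "real set"
  assumes "countable Z"
  obtains c where "c > \<sigma>" "\<And>n::nat. c + n \<notin> Z"
proof -
  have "countable (\<Union>n::nat. (\<lambda>z. z - n) ` Z)" using assms by auto
  moreover have "uncountable {\<sigma><..<\<sigma> + 1}" by (simp add: uncountable_open_interval)
  ultimately have "\<not> {\<sigma><..<\<sigma> + 1} \<subseteq> (\<Union>n::nat. (\<lambda>z. z - n) ` Z)"
    using countable_subset by blast
  then obtain c where c: "c > \<sigma>" "c \<notin> (\<Union>n::nat. (\<lambda>z. z - n) ` Z)"
    unfolding subset_iff greaterThanLessThan_iff by blast
  have "c + n \<notin> Z" for n :: nat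
  proof
    assume "c + n \<in> Z"
    then have "(c + n) - n \<in> (\<lambda>z. z - n) ` Z" by (rule imageI)
    then show False using c(2) by auto
  qed
  then show thesis using c(1) that by blast
qed


text \<open>For a nonnegative integrand a convergent improper integral is a Lebesgue integral, by
  monotone convergence. This converts (P1) for the modulus of \<open>a\<close> into the absolute
  convergence used with Fubini.\<close>

lemma integrable_laplace_abs:
  fixes a :: "real \<Rightarrow> complex"
  assumes a: "locally_integrable a" and ex: "laplace_exists (\<lambda>t. complex_of_real (cmod (a t))) (of_real c)"
  shows "integrable (lebesgue_on {0..}) (\<lambda>t. exp (- (of_real c * of_real t)) * a t)"
proof -
  let ?M = "lebesgue_on {0..} :: real measure"
  let ?h = "\<lambda>t. exp (- (of_real c * of_real t)) * a t"
  have int: "integrable (lebesgue_on {0..real n}) ?h" for n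
    using a by (intro integrable_laplace_kernel) (auto simp: locally_integrable_def)
  have int': "integrable ?M (\<lambda>t. indicator {0..real n} t *\<^sub>R ?h t)" for n
    using int[of n] by (subst (asm) integrable_lebesgue_on_subset[of _ "{0..}"]) auto
  have ind_lim: "(\<lambda>n. indicator {0..real n} t *\<^sub>R z) \<longlonglongrightarrow> z" if "t \<ge> 0" for t and z :: "'b::real_normed_vector"
  proof -
    obtain N :: nat where "t \<le> real N" using real_arch_simple by blast
    then have "eventually (\<lambda>n. indicator {0..real n} t *\<^sub>R z = z) sequentially"
      using that by (intro eventually_sequentiallyI[of N]) (auto simp: indicator_def)
    then show ?thesis by (rule tendsto_eventually)
  qed
  \<comment> \<open>Local integrability gives measurability on bounded intervals; on the half-line
    it comes from the limit of truncations.\<close>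
  have meas: "?h \<in> borel_measurable ?M"
  proof (rule borel_measurable_LIMSEQ_metric)
    show "(\<lambda>t. indicator {0..real n} t *\<^sub>R ?h t) \<in> borel_measurable ?M" for n
      by (rule borel_measurable_integrable[OF int'])
    show "(\<lambda>n. indicator {0..real n} t *\<^sub>R ?h t) \<longlonglongrightarrow> ?h t" if "t \<in> space ?M" for t
      using that by (intro ind_lim) simp
  qed
  obtain L where L: "(laplace_partial (\<lambda>t. complex_of_real (cmod (a t))) (of_real c) \<longlongrightarrow> L) at_top"
    using ex by (auto simp: laplace_exists_def)
  have norm_h: "of_real (norm (?h t)) = exp (- (of_real c * of_real t)) * complex_of_real (cmod (a t))" for t
    by (simp add: norm_mult norm_exp_mult_of_real exp_of_real[symmetric])
  have partial: "laplace_partial (\<lambda>t. complex_of_real (cmod (a t))) (of_real c) b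
      = of_real (\<integral>t. norm (?h t) \<partial>lebesgue_on {0..b})" for b
    unfolding laplace_partial_def norm_h[symmetric] by (rule integral_complex_of_real)
  have "integrable ?M (\<lambda>t. norm (?h t))"
  proof (rule integrable_monotone_convergence)
    show "integrable ?M (\<lambda>t. indicator {0..real n} t *\<^sub>R norm (?h t))" for n
      using Bochner_Integration.integrable_norm[OF int'[of n]] by simp
    show "AE t in ?M. mono (\<lambda>n. indicator {0..real n} t *\<^sub>R norm (?h t))"
      by (auto simp: mono_def split: split_indicator)
    show "AE t in ?M. (\<lambda>n. indicator {0..real n} t *\<^sub>R norm (?h t)) \<longlonglongrightarrow> norm (?h t)"
      by (rule AE_I2) (rule ind_lim, simp)
    have "(\<lambda>n. Re (laplace_partial (\<lambda>t. complex_of_real (cmod (a t))) (of_real c) (real n))) \<longlonglongrightarrow> Re L"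
      by (intro tendsto_Re filterlim_compose[OF L] filterlim_real_sequentially)
    then show "(\<lambda>n. \<integral>t. indicator {0..real n} t *\<^sub>R norm (?h t) \<partial>?M) \<longlonglongrightarrow> Re L"
      unfolding partial Re_complex_of_real
      by (subst integral_lebesgue_on_subset[of _ "{0..}", symmetric]) simp_all
    show "(\<lambda>t. norm (?h t)) \<in> borel_measurable ?M" using meas by measurable
  qed
  then show ?thesis using meas by (simp add: integrable_norm_iff)
qed

section \<open>Convolutions and vector-valued Laplace transforms\<close>

lemma has_bochner_integral_reflect_interval:
  fixes f :: "real \<Rightarrow> complex"
  shows "has_bochner_integral (lebesgue_on {0..t}) (\<lambda>s. f (t - s)) i \<longleftrightarrow> has_bochner_integral (lebesgue_on {0..t}) f i"
proof -
  have "indicator {0..t} (t - s) = (indicator {0..t} s :: real)" for s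
    by (auto split: split_indicator)
  then show ?thesis
    using has_bochner_integral_lebesgue_real_affine_iff[of "- 1" "\<lambda>s. indicator {0..t} s *\<^sub>R f s" i t]
    by (simp add: has_bochner_integral_restrict_space)
qed

lemma has_bochner_integral_shift:
  fixes f :: "real \<Rightarrow> 'b::euclidean_space"
  assumes "\<And>x. x < 0 \<Longrightarrow> f x = 0" and "s \<ge> 0"
  shows "has_bochner_integral (lebesgue_on {0..}) (\<lambda>t. f (t - s)) i \<longleftrightarrow> has_bochner_integral (lebesgue_on {0..}) f i"
proof -
  have "indicator {0..} x *\<^sub>R f x = f x" "indicator {0..} x *\<^sub>R f (x - s) = f (- s + 1 * x)" for x
    using assms by (auto split: split_indicator)
  then show ?thesis
    using has_bochner_integral_lebesgue_real_affine_iff[of 1 f i "- s"]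
    by (simp add: has_bochner_integral_restrict_space)
qed

lemma integrable_reflect_convolution:
  assumes a: "locally_integrable a" and t: "t \<ge> 0"
  shows "integrable (lebesgue_on {0..t}) (\<lambda>s. a (t - s))"
proof -
  have "has_bochner_integral (lebesgue_on {0..t}) a (integral\<^sup>L (lebesgue_on {0..t}) a)"
    using a t by (simp add: locally_integrable_def has_bochner_integral_iff)
  then show ?thesis
    unfolding has_bochner_integral_reflect_interval[symmetric, of t a] by (simp add: has_bochner_integral_iff)
qed

text \<open>Reflection leaves \<open>a\<close> unshifted, and the cut-off makes the domain S
  independent of t. Thus t enters only through the second factor, as dominated convergence and
  Fubini require.\<close>

lemma convolution_integral_eq:
  fixes a r :: "real \<Rightarrow> complex"
  assumes int: "integrable (lebesgue_on {0..t}) (\<lambda>s. a (t - s) * r s)"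
    and S: "{0..t} \<subseteq> S" "S \<subseteq> {0..}" "S \<in> sets lebesgue"
  shows "(\<integral>s. a (t - s) * r s \<partial>lebesgue_on {0..t}) = (\<integral>s. a s * (if s \<le> t then r (t - s) else 0) \<partial>lebesgue_on S)"
proof -
  have "has_bochner_integral (lebesgue_on {0..t}) (\<lambda>s. a (t - s) * r s) (\<integral>s. a (t - s) * r s \<partial>lebesgue_on {0..t})"
    using int by (rule has_bochner_integral_integrable)
  then have "has_bochner_integral (lebesgue_on {0..t}) (\<lambda>s. a s * r (t - s)) (\<integral>s. a (t - s) * r s \<partial>lebesgue_on {0..t})"
    using has_bochner_integral_reflect_interval[of t "\<lambda>s. a (t - s) * r s"] by simp
  then have "(\<integral>s. a (t - s) * r s \<partial>lebesgue_on {0..t}) = (\<integral>s. a s * r (t - s) \<partial>lebesgue_on {0..t})"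
    by (simp add: has_bochner_integral_iff)
  also have "\<dots> = (\<integral>s. indicator {0..t} s *\<^sub>R (a s * r (t - s)) \<partial>lebesgue_on S)"
    using S by (intro integral_lebesgue_on_subset) auto
  also have "\<dots> = (\<integral>s. a s * (if s \<le> t then r (t - s) else 0) \<partial>lebesgue_on S)"
    using S by (intro Bochner_Integration.integral_cong) (auto split: split_indicator)
  finally show ?thesis .
qed

lemma cdual_convolution:
  fixes u :: "real \<Rightarrow> 'x::seq_complete_lcs"
  assumes a: "locally_integrable a" and u: "continuous_on {0..} u" and t: "t \<ge> 0" and \<phi>: "\<phi> \<in> cdual"
  shows "has_bochner_integral (lebesgue_on {0..t}) (\<lambda>s. a (t - s) * \<phi> (u s)) (\<phi> (convolution a u t))"
  unfolding convolution_def
  by (rule cdual_lcs_integral[OF t integrable_reflect_convolution[OF a t] continuous_on_subset[OF u] \<phi>]) auto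

text \<open>Since \<open>a\<close> may be irregular, continuity must come from u. After reflection
  the integrand is \<open>a s\<close> times a shifted cut-off copy v of u; it depends continuously
  on the shift except at the jump of v, which is a null set in s.\<close>

lemma continuous_on_convolution:
  fixes u :: "real \<Rightarrow> 'x::seq_complete_lcs"
  assumes a: "locally_integrable a" and u: "continuous_on {0..} u"
  shows "continuous_on {0..} (convolution a u)"
  unfolding continuous_on_def
proof
  fix t :: real assume "t \<in> {0..}"
  then have t: "t \<ge> 0" by simp
  define b where "b = t + 1"
  let ?M = "lebesgue_on {0..b}"
  have b: "b \<ge> 0" "t < b" using t by (auto simp: b_def)
  have a_int: "integrable ?M a" using a b by (simp add: locally_integrable_def)
  define U where "U r = u (max 0 (min b r))" for r
  have U: "continuous_on UNIV U"
    unfolding U_def by (rule continuous_on_clamp[OF b(1) continuous_on_subset[OF u]]) auto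
  define v where "v r = indicator {0..} r *\<^sub>C U r" for r :: real
  have conv_eq: "\<phi> (convolution a u x) = (\<integral>s. a s * \<phi> (v (x - s)) \<partial>?M)"
    and conv_int: "integrable ?M (\<lambda>s. a s * \<phi> (v (x - s)))"
    if x: "0 \<le> x" "x \<le> b" and \<phi>: "\<phi> \<in> cdual" for \<phi> x
  proof -
    have eq: "(if s \<le> x then \<phi> (u (x - s)) else 0) = \<phi> (v (x - s))" if "s \<in> {0..b}" for s
      using that x by (auto simp: v_def U_def cdual_scaleC[OF \<phi>] split: split_indicator)
    note I = cdual_convolution[OF a u x(1) \<phi>]
    have "\<phi> (convolution a u x) = (\<integral>s. a s * (if s \<le> x then \<phi> (u (x - s)) else 0) \<partial>?M)"
      using I x by (subst convolution_integral_eq[symmetric]) (auto simp: has_bochner_integral_iff)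
    also have "\<dots> = (\<integral>s. a s * \<phi> (v (x - s)) \<partial>?M)"
      by (intro Bochner_Integration.integral_cong) (auto simp: eq)
    finally show "\<phi> (convolution a u x) = (\<integral>s. a s * \<phi> (v (x - s)) \<partial>?M)" .
    have "bounded ((\<lambda>r. \<phi> (U r)) ` {0..b})"
      by (intro compact_imp_bounded compact_continuous_image cdual_continuous_on_compose[OF \<phi>] continuous_on_subset[OF U]) auto
    then obtain B where B: "\<And>r. r \<in> {0..b} \<Longrightarrow> cmod (\<phi> (U r)) \<le> B"
      unfolding bounded_iff by blast
    have UB: "cmod (\<phi> (U r)) \<le> B" for r
      using B[of "max 0 (min b r)"] b by (simp add: U_def)
    have "integrable ?M (\<lambda>s. \<phi> (v (x - s)) * a s)"
    proof (rule integrable_bounded_mult[OF a_int])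
      have "(\<lambda>s. \<phi> (U (x - s))) \<in> borel_measurable ?M"
        by (intro measurable_lebesgue_on_continuous cdual_continuous_on_compose[OF \<phi>]
            continuous_on_compose2[OF U] continuous_intros) auto
      moreover have "(\<lambda>s. x - s) \<in> borel_measurable ?M"
        by (intro measurable_lebesgue_on_continuous continuous_intros)
      ultimately show "(\<lambda>s. \<phi> (v (x - s))) \<in> borel_measurable ?M"
        unfolding v_def cdual_scaleC[OF \<phi>] by measurable
      show "cmod (\<phi> (v (x - s))) \<le> B" for s
        using UB[of "x - s"] order_trans[OF norm_ge_zero UB[of "x - s"]]
        by (auto simp: v_def cdual_scaleC[OF \<phi>] split: split_indicator)
    qed
    then show "integrable ?M (\<lambda>s. a s * \<phi> (v (x - s)))" by (simp add: mult.commute)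
  qed
  show "(convolution a u \<longlongrightarrow> convolution a u t) (at t within {0..})"
    unfolding tendsto_lcs_iff
  proof (intro allI impI)
    fix p :: "'x \<Rightarrow> real" assume p: "ccseminorm p"
    have "bounded ((\<lambda>r. p (U r)) ` {0..b})"
      by (intro compact_imp_bounded compact_continuous_image continuous_on_cseminorm[OF p]
          continuous_on_subset[OF U]) auto
    then obtain B where B: "\<And>r. r \<in> {0..b} \<Longrightarrow> p (U r) \<le> B"
      unfolding bounded_iff by (metis abs_le_D1 image_eqI real_norm_def)
    have "p (U r) \<le> B" for r
      using B[of "max 0 (min b r)"] b by (simp add: U_def)
    then have vB: "p (v r) \<le> B" for r
      using cseminorm_nonneg[of p "U r"] p order_trans[OF cseminorm_nonneg[of p "U r"]]
      by (auto simp: v_def cseminorm_zero scaleC_one split: split_indicator)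
    have vB2: "p (v r - v s) \<le> B + B" for r s
      using cseminorm_triangle[of p "v r" "- v s"] vB[of r] vB[of s] p by (simp add: cseminorm_minus)
    have B0: "B \<ge> 0" using vB[of 0] cseminorm_nonneg[of p "v 0"] p by linarith
    \<comment> \<open>A majorant valid for every functional dominated by p, so the norming
      functional chosen below may vary with x.\<close>
    define Q where "Q x = (\<integral>s. cmod (a s) * p (v (x - s) - v (t - s)) \<partial>?M)" for x
    have m[measurable]: "(\<lambda>s. p (v (x - s) - v (y - s))) \<in> borel_measurable ?M" for x y
    proof -
      have [measurable]: "(\<lambda>s. x - s) \<in> borel_measurable ?M" for x
        by (intro measurable_lebesgue_on_continuous continuous_intros)
      show ?thesis
        unfolding v_def by (rule borel_measurable_cseminorm_diff[OF p U]) measurable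
    qed
    note [measurable] = borel_measurable_integrable[OF a_int]
    have Q_int: "integrable ?M (\<lambda>s. cmod (a s) * p (v (x - s) - v (t - s)))" for x
    proof (rule Bochner_Integration.integrable_bound)
      show "integrable ?M (\<lambda>s. cmod (a s) * (B + B))" using a_int by simp
      show "AE s in ?M. norm (cmod (a s) * p (v (x - s) - v (t - s))) \<le> norm (cmod (a s) * (B + B))"
        using vB2 p B0
        by (intro AE_I2) (auto simp: abs_mult cseminorm_nonneg intro!: mult_left_mono)
    qed measurable
    have Q_lim: "(Q \<longlongrightarrow> 0) (at t within {0..})"
      unfolding tendsto_at_iff_sequentially
    proof (intro allI impI)
      fix X :: "nat \<Rightarrow> real" assume "\<forall>i. X i \<in> {0..} - {t}" and X: "X \<longlonglongrightarrow> t"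
      have "(\<lambda>n. \<integral>s. cmod (a s) * p (v (X n - s) - v (t - s)) \<partial>?M) \<longlonglongrightarrow> (\<integral>s. 0 \<partial>?M)"
      proof (rule integral_dominated_convergence[where w = "\<lambda>s. cmod (a s) * (B + B)"])
        show "integrable ?M (\<lambda>s. cmod (a s) * (B + B))" using a_int by simp
        show "AE s in ?M. norm (cmod (a s) * p (v (X n - s) - v (t - s))) \<le> cmod (a s) * (B + B)" for n
          using vB2 p by (intro AE_I2) (auto simp: abs_mult cseminorm_nonneg intro!: mult_left_mono)
        \<comment> \<open>The jump of v at 0 corresponds to s = t; on either side of it v is
          eventually given by U or is constantly 0.\<close>
        have lim: "(\<lambda>n. cmod (a s) * p (v (X n - s) - v (t - s))) \<longlonglongrightarrow> 0" if "s \<noteq> t" for s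
        proof -
          have Xs: "(\<lambda>n. X n - s) \<longlonglongrightarrow> t - s" by (intro tendsto_intros X)
          have "(\<lambda>n. v (X n - s)) \<longlonglongrightarrow> v (t - s)"
          proof (cases "s < t")
            case True
            have "eventually (\<lambda>n. X n - s > 0) sequentially"
              using True by (intro order_tendstoD(1)[OF Xs]) simp
            then have "eventually (\<lambda>n. U (X n - s) = v (X n - s)) sequentially"
              by eventually_elim (simp add: v_def scaleC_one)
            moreover have "(\<lambda>n. U (X n - s)) \<longlonglongrightarrow> U (t - s)"
              by (rule continuous_on_tendsto_compose[OF U Xs]) auto
            ultimately have "(\<lambda>n. v (X n - s)) \<longlonglongrightarrow> U (t - s)"
              by (rule Lim_transform_eventually[rotated])
            then show ?thesis using True by (simp add: v_def scaleC_one)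
          next
            case False
            then have "eventually (\<lambda>n. X n - s < 0) sequentially"
              using that by (intro order_tendstoD(2)[OF Xs]) simp
            then have "eventually (\<lambda>n. v (X n - s) = v (t - s)) sequentially"
              by eventually_elim (use False that in \<open>simp add: v_def\<close>)
            then show ?thesis by (rule tendsto_eventually)
          qed
          then have "(\<lambda>n. p (v (X n - s) - v (t - s))) \<longlonglongrightarrow> 0"
            using p by (simp add: tendsto_lcs_iff)
          from tendsto_mult[OF tendsto_const this, of "cmod (a s)"] show ?thesis by simp
        qed
        have "AE s in lebesgue. s \<noteq> t"
          by (rule AE_completion) (rule AE_lborel_singleton)
        then show "AE s in ?M. (\<lambda>n. cmod (a s) * p (v (X n - s) - v (t - s))) \<longlonglongrightarrow> 0"
          by (subst AE_restrict_space_iff) (auto elim!: eventually_mono intro: lim)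
      qed measurable
      then show "(Q \<circ> X) \<longlonglongrightarrow> 0" by (simp add: Q_def comp_def)
    qed
    have ev: "eventually (\<lambda>x. p (convolution a u x - convolution a u t) \<le> Q x) (at t within {0..})"
    proof -
      have "eventually (\<lambda>x. x \<in> {0..}) (at t within {0..})" by (simp add: eventually_at_filter)
      moreover have "eventually (\<lambda>x. x < b) (at t within {0..})"
        by (rule order_tendstoD(2)[OF tendsto_ident_at b(2)])
      ultimately show ?thesis
      proof eventually_elim
        fix x assume "x \<in> {0..}" "x < b"
        then have x: "0 \<le> x" "x \<le> b" by auto
        obtain \<phi> where \<phi>: "\<phi> \<in> cdual" "\<And>z. cmod (\<phi> z) \<le> p z"
          "\<phi> (convolution a u x - convolution a u t) = p (convolution a u x - convolution a u t)"
          using cdual_norming[OF p] by blast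
        have t': "0 \<le> t" "t \<le> b" using t b by auto
        have "p (convolution a u x - convolution a u t) = cmod (\<phi> (convolution a u x) - \<phi> (convolution a u t))"
          using p \<phi>(3) by (simp add: cdual_diff[OF \<phi>(1)] cseminorm_nonneg)
        also have "\<phi> (convolution a u x) - \<phi> (convolution a u t)
            = (\<integral>s. a s * \<phi> (v (x - s)) - a s * \<phi> (v (t - s)) \<partial>?M)"
          unfolding conv_eq[OF x \<phi>(1)] conv_eq[OF t' \<phi>(1)]
          by (rule Bochner_Integration.integral_diff[symmetric, OF conv_int[OF x \<phi>(1)] conv_int[OF t' \<phi>(1)]])
        also have "cmod \<dots> \<le> Q x"
          unfolding Q_def
        proof (rule Bochner_Integration.integral_norm_bound_integral[OF _ Q_int])
          show "integrable ?M (\<lambda>s. a s * \<phi> (v (x - s)) - a s * \<phi> (v (t - s)))"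
            by (rule Bochner_Integration.integrable_diff[OF conv_int[OF x \<phi>(1)] conv_int[OF t' \<phi>(1)]])
          show "norm (a s * \<phi> (v (x - s)) - a s * \<phi> (v (t - s))) \<le> cmod (a s) * p (v (x - s) - v (t - s))" for s
            using \<phi>(2)[of "v (x - s) - v (t - s)"]
            by (simp add: right_diff_distrib[symmetric] norm_mult cdual_diff[OF \<phi>(1), symmetric] mult_left_mono)
        qed
        finally show "p (convolution a u x - convolution a u t) \<le> Q x" .
      qed
    qed
    have "eventually (\<lambda>x. 0 \<le> p (convolution a u x - convolution a u t)) (at t within {0..})"
      using p by (simp add: cseminorm_nonneg)
    from tendsto_sandwich[OF this ev tendsto_const Q_lim]
    show "((\<lambda>x. p (convolution a u x - convolution a u t)) \<longlongrightarrow> 0) (at t within {0..})" .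
  qed
qed

text \<open>Writing \<open>exp (\<omega>' * s)\<close> as \<open>exp (\<omega>' * t)\<close> times
  \<open>exp (- (\<omega>' * (t - s)))\<close> moves the weight onto \<open>a\<close>, whose
  weighted modulus is integrable.\<close>

lemma cseminorm_convolution_le:
  fixes u :: "real \<Rightarrow> 'x::seq_complete_lcs"
  assumes a: "locally_integrable a" and u: "continuous_on {0..} u" and p: "ccseminorm p"
    and a_int: "integrable (lebesgue_on {0..}) (\<lambda>t. exp (- (of_real \<omega>' * of_real t)) * a t)"
    and le: "\<And>t. t \<ge> 0 \<Longrightarrow> p (u t) \<le> C * exp (\<omega>' * t)" and "C \<ge> 0" and t: "t \<ge> 0"
  shows "p (convolution a u t)
    \<le> C * (\<integral>t. cmod (exp (- (of_real \<omega>' * of_real t)) * a t) \<partial>lebesgue_on {0..}) * exp (\<omega>' * t)"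
proof -
  define e where "e s = cmod (exp (- (of_real \<omega>' * of_real s)) * a s)" for s
  have e_eq: "e s = exp (- (\<omega>' * s)) * cmod (a s)" for s
    by (simp add: e_def norm_mult norm_exp_mult_of_real)
  have e_int: "integrable (lebesgue_on {0..}) e" using a_int unfolding e_def by simp
  have e_int_t: "integrable (lebesgue_on {0..t}) e"
    unfolding e_def using integrable_laplace_kernel[of t a] a t by (simp add: locally_integrable_def)
  have "has_bochner_integral (lebesgue_on {0..t}) (\<lambda>s. complex_of_real (e s)) (of_real (\<integral>s. e s \<partial>lebesgue_on {0..t}))"
    using e_int_t by (intro has_bochner_integral_of_real has_bochner_integral_integrable)
  then have "has_bochner_integral (lebesgue_on {0..t}) (\<lambda>s. complex_of_real (e (t - s))) (of_real (\<integral>s. e s \<partial>lebesgue_on {0..t}))"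
    using has_bochner_integral_reflect_interval[of t "\<lambda>s. complex_of_real (e s)"] by simp
  then have refl: "has_bochner_integral (lebesgue_on {0..t}) (\<lambda>s. e (t - s)) (\<integral>s. e s \<partial>lebesgue_on {0..t})"
    by (auto dest: has_bochner_integral_Re)
  have "p (convolution a u t) \<le> (\<integral>s. C * exp (\<omega>' * t) * e (t - s) \<partial>lebesgue_on {0..t})"
    unfolding convolution_def
  proof (rule cseminorm_lcs_integral_le[OF t integrable_reflect_convolution[OF a t] continuous_on_subset[OF u] p])
    show "integrable (lebesgue_on {0..t}) (\<lambda>s. C * exp (\<omega>' * t) * e (t - s))"
      using refl by (simp add: has_bochner_integral_iff)
    fix s assume s: "s \<in> {0..t}"
    have "cmod (a (t - s)) * p (u s) \<le> cmod (a (t - s)) * (C * exp (\<omega>' * s))"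
      using le[of s] s by (intro mult_left_mono) auto
    also have "exp (\<omega>' * s) = exp (\<omega>' * t) * exp (- (\<omega>' * (t - s)))"
      by (simp add: exp_add[symmetric] algebra_simps)
    finally show "cmod (a (t - s)) * p (u s) \<le> C * exp (\<omega>' * t) * e (t - s)"
      by (simp add: e_eq mult_ac)
  qed auto
  also have "\<dots> = C * exp (\<omega>' * t) * (\<integral>s. e s \<partial>lebesgue_on {0..t})"
    using refl by (simp add: has_bochner_integral_iff)
  also have "\<dots> \<le> C * exp (\<omega>' * t) * (\<integral>s. e s \<partial>lebesgue_on {0..})"
  proof (rule mult_left_mono)
    have "(\<integral>s. e s \<partial>lebesgue_on {0..t}) = (\<integral>s. indicator {0..t} s *\<^sub>R e s \<partial>lebesgue_on {0..})"
      by (rule integral_lebesgue_on_subset) auto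
    also have "\<dots> \<le> (\<integral>s. e s \<partial>lebesgue_on {0..})"
    proof (rule integral_mono[OF _ e_int])
      show "integrable (lebesgue_on {0..}) (\<lambda>s. indicator {0..t} s *\<^sub>R e s)"
        using e_int_t by (subst (asm) integrable_lebesgue_on_subset[of _ "{0..}"]) auto
      show "indicator {0..t} s *\<^sub>R e s \<le> e s" for s by (simp add: e_def split: split_indicator)
    qed
    finally show "(\<integral>s. e s \<partial>lebesgue_on {0..t}) \<le> (\<integral>s. e s \<partial>lebesgue_on {0..})" .
    show "0 \<le> C * exp (\<omega>' * t)" using \<open>C \<ge> 0\<close> by simp
  qed
  also have "\<dots> = C * (\<integral>s. e s \<partial>lebesgue_on {0..}) * exp (\<omega>' * t)" by simp
  finally show ?thesis unfolding e_def .
qed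

text \<open>The exponential factorises as \<open>lexp \<mu> s\<close> times its value at t - s, so
  the weighted convolution is again a convolution of two integrable functions, and Fubini on the
  quadrant gives the product.\<close>

lemma laplace_scalar_convolution:
  fixes a r :: "real \<Rightarrow> complex"
  assumes a: "locally_integrable a" and a_int: "integrable (lebesgue_on {0..}) (\<lambda>t. lexp \<mu> t * a t)"
    and r: "continuous_on {0..} r" and le: "\<And>t. t \<ge> 0 \<Longrightarrow> cmod (r t) \<le> C * exp (\<omega> * t)" and \<omega>: "\<omega> < Re \<mu>"
  shows "(laplace_partial (\<lambda>t. \<integral>s. a (t - s) * r s \<partial>lebesgue_on {0..t}) \<mu> \<longlongrightarrow> laplace a \<mu> * laplace r \<mu>) at_top"
    and "(laplace_partial r \<mu> \<longlongrightarrow> laplace r \<mu>) at_top"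
proof -
  let ?M = "lebesgue_on {0..} :: real measure"
  interpret pair_sigma_finite ?M ?M by (rule pair_sigma_finite_lebesgue_on) auto
  define A where "A s = lexp \<mu> s * a s" for s
  \<comment> \<open>Vanishing at negative arguments encodes s \<le> t, and it makes the integral of
    \<open>B (t - s)\<close> over t \<ge> 0 independent of s.\<close>
  define B where "B x = (if x \<ge> 0 then lexp \<mu> x * r x else 0)" for x
  have A: "integrable ?M A" using a_int by (simp add: A_def[abs_def])
  have r_int: "integrable ?M (\<lambda>t. lexp \<mu> t * r t)"
    by (rule integrable_bounded_laplace_kernel[OF measurable_lebesgue_on_continuous_on[OF r] le \<omega>]) auto
  also have "?this \<longleftrightarrow> integrable ?M B"
    by (intro Bochner_Integration.integrable_cong) (auto simp: B_def)
  finally have B: "integrable ?M B" .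
  have lap_r: "(laplace_partial r \<mu> \<longlongrightarrow> (\<integral>t. B t \<partial>?M)) at_top"
  proof -
    have "(\<integral>t. lexp \<mu> t * r t \<partial>?M) = (\<integral>t. B t \<partial>?M)"
      by (intro Bochner_Integration.integral_cong) (auto simp: B_def)
    then show ?thesis
      using tendsto_integral_lebesgue_on_atLeast0[OF r_int] by (simp add: laplace_partial_def[abs_def])
  qed
  then show "(laplace_partial r \<mu> \<longlongrightarrow> laplace r \<mu>) at_top" by (simp add: laplace_eqI)
  have lap_a: "laplace a \<mu> = (\<integral>t. A t \<partial>?M)"
    using tendsto_integral_lebesgue_on_atLeast0[OF A]
    by (intro laplace_eqI) (simp add: laplace_partial_def[abs_def] A_def)
  \<comment> \<open>Borel measurability is required because B is composed with the difference map on
    the product space.\<close>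
  have B_meas: "B \<in> borel_measurable borel"
  proof -
    have "(\<lambda>x. indicator {0..} x * (lexp \<mu> x * r (max 0 x))) \<in> borel_measurable borel"
      by (intro borel_measurable_times borel_measurable_indicator borel_measurable_continuous_onI
          continuous_intros continuous_on_compose2[OF r]) auto
    also have "(\<lambda>x. indicator {0..} x * (lexp \<mu> x * r (max 0 x))) = B"
      by (auto simp: B_def fun_eq_iff split: split_indicator)
    finally show ?thesis .
  qed
  have [measurable]: "(\<lambda>t. t) \<in> borel_measurable ?M"
    by (intro measurable_lebesgue_on_continuous continuous_intros)
  have [measurable]: "A \<in> borel_measurable ?M" using A by simp
  have shift: "has_bochner_integral ?M (\<lambda>t. B (t - s)) (\<integral>t. B t \<partial>?M)" if "s \<ge> 0" for s
    using B that by (subst has_bochner_integral_shift) (auto simp: B_def has_bochner_integral_integrable)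
  have shift_norm: "has_bochner_integral ?M (\<lambda>t. norm (B (t - s))) (\<integral>t. norm (B t) \<partial>?M)" if "s \<ge> 0" for s
  proof (rule has_bochner_integral_shift[of "\<lambda>t. norm (B t)", THEN iffD2])
    show "norm (B x) = 0" if "x < 0" for x using that by (simp add: B_def)
    show "has_bochner_integral ?M (\<lambda>t. norm (B t)) (\<integral>t. norm (B t) \<partial>?M)"
      using B by (intro has_bochner_integral_integrable Bochner_Integration.integrable_norm)
  qed fact
  have int: "integrable (?M \<Otimes>\<^sub>M ?M) (case_prod (\<lambda>s t. A s * B (t - s)))"
  proof (rule Fubini_integrable)
    have "(\<lambda>z. B (snd z - fst z)) \<in> borel_measurable (?M \<Otimes>\<^sub>M ?M)"
      by (rule measurable_compose[OF _ B_meas]) measurable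
    then show "(\<lambda>(s, t). A s * B (t - s)) \<in> borel_measurable (?M \<Otimes>\<^sub>M ?M)"
      unfolding case_prod_beta by measurable
    have "integrable ?M (\<lambda>s. norm (A s) * (\<integral>t. norm (B t) \<partial>?M))" using A by simp
    also have "?this \<longleftrightarrow> integrable ?M (\<lambda>s. \<integral>t. norm (case (s, t) of (s, t) \<Rightarrow> A s * B (t - s)) \<partial>?M)"
      using shift_norm by (intro Bochner_Integration.integrable_cong) (auto simp: norm_mult has_bochner_integral_iff)
    finally show "integrable ?M (\<lambda>s. \<integral>t. norm (case (s, t) of (s, t) \<Rightarrow> A s * B (t - s)) \<partial>?M)" .
    show "AE s in ?M. integrable ?M (\<lambda>t. case (s, t) of (s, t) \<Rightarrow> A s * B (t - s))"
      using shift by (intro AE_I2) (auto simp: has_bochner_integral_iff)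
  qed
  have "(\<integral>t. (\<integral>s. A s * B (t - s) \<partial>?M) \<partial>?M) = (\<integral>s. (\<integral>t. A s * B (t - s) \<partial>?M) \<partial>?M)"
    by (rule Fubini_integral[OF int])
  also have "\<dots> = (\<integral>s. A s * (\<integral>t. B t \<partial>?M) \<partial>?M)"
    using shift by (intro Bochner_Integration.integral_cong) (auto simp: has_bochner_integral_iff)
  also have "\<dots> = laplace a \<mu> * laplace r \<mu>"
    by (simp add: lap_a laplace_eqI[OF lap_r])
  finally have total: "(\<integral>t. (\<integral>s. A s * B (t - s) \<partial>?M) \<partial>?M) = laplace a \<mu> * laplace r \<mu>" .
  have conv: "(\<integral>s. A s * B (t - s) \<partial>?M) = lexp \<mu> t * (\<integral>s. a (t - s) * r s \<partial>lebesgue_on {0..t})"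
    if t: "t \<ge> 0" for t
  proof -
    have "bounded (r ` {0..t})"
      by (intro compact_imp_bounded compact_continuous_image continuous_on_subset[OF r]) auto
    then obtain D where D: "\<And>s. s \<in> {0..t} \<Longrightarrow> cmod (r s) \<le> D" unfolding bounded_iff by blast
    have "integrable (lebesgue_on {0..t}) (\<lambda>s. r s * a (t - s))"
      by (rule integrable_bounded_mult[OF integrable_reflect_convolution[OF a t]
            measurable_lebesgue_on_continuous_on[OF continuous_on_subset[OF r]]]) (auto intro: D)
    then have "(\<integral>s. a (t - s) * r s \<partial>lebesgue_on {0..t}) = (\<integral>s. a s * (if s \<le> t then r (t - s) else 0) \<partial>?M)"
      by (intro convolution_integral_eq) (auto simp: mult.commute)
    then have "lexp \<mu> t * (\<integral>s. a (t - s) * r s \<partial>lebesgue_on {0..t})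
        = (\<integral>s. lexp \<mu> t * (a s * (if s \<le> t then r (t - s) else 0)) \<partial>?M)"
      by (simp only: integral_mult_right_zero)
    also have "\<dots> = (\<integral>s. A s * B (t - s) \<partial>?M)"
    proof (intro Bochner_Integration.integral_cong refl)
      fix s
      have "lexp \<mu> t = lexp \<mu> s * exp (- (\<mu> * of_real (t - s)))"
        by (simp add: exp_add[symmetric] algebra_simps)
      then show "lexp \<mu> t * (a s * (if s \<le> t then r (t - s) else 0)) = A s * B (t - s)"
        by (simp add: A_def B_def mult_ac)
    qed
    finally show ?thesis ..
  qed
  have "integrable ?M (\<lambda>t. \<integral>s. A s * B (t - s) \<partial>?M)" by (rule integrable_snd[OF int])
  from tendsto_integral_lebesgue_on_atLeast0[OF this]
  have lim: "((\<lambda>b. \<integral>t. (\<integral>s. A s * B (t - s) \<partial>?M) \<partial>lebesgue_on {0..b}) \<longlongrightarrow> laplace a \<mu> * laplace r \<mu>) at_top"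
    by (simp add: total)
  have "laplace_partial (\<lambda>t. \<integral>s. a (t - s) * r s \<partial>lebesgue_on {0..t}) \<mu>
      = (\<lambda>b. \<integral>t. (\<integral>s. A s * B (t - s) \<partial>?M) \<partial>lebesgue_on {0..b})"
    unfolding laplace_partial_def by (intro ext Bochner_Integration.integral_cong) (auto simp: conv)
  with lim show "(laplace_partial (\<lambda>t. \<integral>s. a (t - s) * r s \<partial>lebesgue_on {0..t}) \<mu> \<longlongrightarrow> laplace a \<mu> * laplace r \<mu>) at_top"
    by simp
qed

text \<open>A Cauchy estimate for improper integrals: increments of the partial integrals of f are
  controlled by those of a real majorant, whose limit is known.\<close>

lemma norm_integral_diff_le:
  fixes f :: "real \<Rightarrow> complex"
  assumes f: "integrable (lebesgue_on {0..}) f" and g: "integrable (lebesgue_on {0..}) g"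
    and le: "\<And>t. t \<ge> 0 \<Longrightarrow> cmod (f t) \<le> g t"
  shows "cmod ((\<integral>t. f t \<partial>lebesgue_on {0..b'}) - (\<integral>t. f t \<partial>lebesgue_on {0..b}))
    \<le> \<bar>(\<integral>t. g t \<partial>lebesgue_on {0..b'}) - (\<integral>t. g t \<partial>lebesgue_on {0..b})\<bar>"
proof (induction b b' rule: linorder_wlog)
  case (le b b')
  let ?M = "lebesgue_on {0..} :: real measure"
  have f_eq: "(\<integral>t. f t \<partial>lebesgue_on {0..b}) = (\<integral>t. indicator {0..b} t *\<^sub>R f t \<partial>?M)"
    and g_eq: "(\<integral>t. g t \<partial>lebesgue_on {0..b}) = (\<integral>t. indicator {0..b} t *\<^sub>R g t \<partial>?M)" for b
    by (rule integral_lebesgue_on_subset; auto)+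
  have ivl: "{0..b} \<in> sets ?M" for b by (auto simp: sets_restrict_space_iff)
  have f_int: "integrable ?M (\<lambda>t. indicator {0..b} t *\<^sub>R f t)"
    and g_int: "integrable ?M (\<lambda>t. indicator {0..b} t *\<^sub>R g t)" for b
    by (rule integrable_mult_indicator[OF ivl f], rule integrable_mult_indicator[OF ivl g])
  have "cmod ((\<integral>t. f t \<partial>lebesgue_on {0..b'}) - (\<integral>t. f t \<partial>lebesgue_on {0..b}))
      = cmod (\<integral>t. indicator {0..b'} t *\<^sub>R f t - indicator {0..b} t *\<^sub>R f t \<partial>?M)"
    unfolding f_eq by (simp only: Bochner_Integration.integral_diff[OF f_int f_int])
  also have "\<dots> \<le> (\<integral>t. indicator {0..b'} t *\<^sub>R g t - indicator {0..b} t *\<^sub>R g t \<partial>?M)"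
  proof (rule Bochner_Integration.integral_norm_bound_integral)
    show "integrable ?M (\<lambda>t. indicator {0..b'} t *\<^sub>R f t - indicator {0..b} t *\<^sub>R f t)"
      by (rule Bochner_Integration.integrable_diff[OF f_int f_int])
    show "integrable ?M (\<lambda>t. indicator {0..b'} t *\<^sub>R g t - indicator {0..b} t *\<^sub>R g t)"
      by (rule Bochner_Integration.integrable_diff[OF g_int g_int])
    show "cmod (indicator {0..b'} t *\<^sub>R f t - indicator {0..b} t *\<^sub>R f t)
        \<le> indicator {0..b'} t *\<^sub>R g t - indicator {0..b} t *\<^sub>R g t" if "t \<in> space ?M" for t
      using that le assms(3)[of t] by (auto split: split_indicator)
  qed
  also have "\<dots> = (\<integral>t. g t \<partial>lebesgue_on {0..b'}) - (\<integral>t. g t \<partial>lebesgue_on {0..b})"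
    unfolding g_eq by (rule Bochner_Integration.integral_diff[OF g_int g_int])
  finally show ?case by linarith
next
  case (sym b b')
  then show ?case by (simp add: norm_minus_commute abs_minus_commute)
qed

text \<open>\<open>lcs_laplace\<close> is a \<open>Lim\<close>, so a functional can be moved inside
  only after convergence is shown. The function is split because its parts converge for different
  reasons: w by exponential domination, and k times a fixed vector by the scalar transform, possibly
  only conditionally.\<close>

lemma lcs_laplace_cdual:
  fixes w :: "real \<Rightarrow> 'x::seq_complete_lcs"
  assumes w: "continuous_on {0..} w"
    and bound: "\<And>p. ccseminorm p \<Longrightarrow> \<exists>C. \<forall>t\<ge>0. p (w t) \<le> C * exp (\<omega> * t)" and \<omega>: "\<omega> < Re \<mu>"
    and k: "continuous_on {0..} k" "laplace_exists k \<mu>"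
    and f: "\<And>t. f t = w t + k t *\<^sub>C x" and \<phi>: "\<phi> \<in> cdual"
  shows "(laplace_partial (\<lambda>t. \<phi> (f t)) \<mu> \<longlongrightarrow> \<phi> (lcs_laplace f \<mu>)) at_top"
proof -
  define e where "e t = lexp \<mu> t" for t
  define I where "I b = lcs_integral (lebesgue_on {0..b}) (\<lambda>t. e t *\<^sub>C w t)" for b
  have e_cont: "continuous_on S e" for S unfolding e_def by (intro continuous_intros)
  have e_int: "integrable (lebesgue_on {0..b}) e" for b
    by (intro continuous_imp_integrable_real e_cont)
  have cdual_I: "\<phi> (I b) = (\<integral>t. e t * \<phi> (w t) \<partial>lebesgue_on {0..b})" if "b \<ge> 0" "\<phi> \<in> cdual" for \<phi> b
    using cdual_lcs_integral[OF that(1) e_int continuous_on_subset[OF w] that(2)]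
    by (simp add: I_def has_bochner_integral_iff)
  \<comment> \<open>J is the partial integral of a scalar majorant; its convergence gives a Cauchy
    estimate in p for the vector integrals.\<close>
  have est: "\<exists>J L. (J \<longlongrightarrow> L) at_top \<and> (\<forall>b\<ge>0. \<forall>b'\<ge>0. p (I b' - I b) \<le> \<bar>J b' - J b\<bar>)"
    if p: "ccseminorm p" for p
  proof -
    obtain C where C: "\<And>t. t \<ge> 0 \<Longrightarrow> p (w t) \<le> C * exp (\<omega> * t)" using bound[OF p] by blast
    define g where "g t = C * exp (- ((Re \<mu> - \<omega>) * t))" for t
    have g: "integrable (lebesgue_on {0..}) g"
      unfolding g_def using \<omega> by (intro integrable_mult_right integrable_exp_neg_atLeast0) simp
    have "p (I b' - I b) \<le> \<bar>(\<integral>t. g t \<partial>lebesgue_on {0..b'}) - (\<integral>t. g t \<partial>lebesgue_on {0..b})\<bar>"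
      if b: "b \<ge> 0" "b' \<ge> 0" for b b'
    proof -
      obtain \<psi> where \<psi>: "\<psi> \<in> cdual" "\<And>z. cmod (\<psi> z) \<le> p z" "\<psi> (I b' - I b) = p (I b' - I b)"
        using cdual_norming[OF p] by blast
      have \<psi>w: "cmod (\<psi> (w t)) \<le> C * exp (\<omega> * t)" if "t \<ge> 0" for t
        using \<psi>(2)[of "w t"] C[OF that] by linarith
      have "p (I b' - I b) = cmod (\<psi> (I b') - \<psi> (I b))"
        using p \<psi>(3) by (simp add: cdual_diff[OF \<psi>(1)] cseminorm_nonneg)
      also have "\<dots> \<le> \<bar>(\<integral>t. g t \<partial>lebesgue_on {0..b'}) - (\<integral>t. g t \<partial>lebesgue_on {0..b})\<bar>"
        unfolding cdual_I[OF b(1) \<psi>(1)] cdual_I[OF b(2) \<psi>(1)]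
      proof (rule norm_integral_diff_le[OF _ g])
        show "integrable (lebesgue_on {0..}) (\<lambda>t. e t * \<psi> (w t))"
          unfolding e_def
          by (rule integrable_bounded_laplace_kernel[OF measurable_lebesgue_on_continuous_on \<psi>w \<omega>])
            (auto intro: cdual_continuous_on_compose[OF \<psi>(1) w])
        fix t :: real assume t: "t \<ge> 0"
        have "cmod (e t * \<psi> (w t)) \<le> exp (- (Re \<mu> * t)) * (C * exp (\<omega> * t))"
          unfolding e_def norm_mult norm_exp_mult_of_real by (intro mult_left_mono \<psi>w t) auto
        also have "\<dots> = g t" by (simp add: g_def exp_add[symmetric] algebra_simps)
        finally show "cmod (e t * \<psi> (w t)) \<le> g t" .
      qed
      finally show ?thesis .
    qed
    then show ?thesis
      using tendsto_integral_lebesgue_on_atLeast0[OF g] by blast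
  qed
  \<comment> \<open>Completeness concerns sequences only, so the limit is found along integer
    endpoints and then shown to be the limit for real b.\<close>
  have "lcs_Cauchy (\<lambda>n. I (real n))"
    unfolding lcs_Cauchy_def
  proof (intro allI impI)
    fix U :: "'x set" assume "open U \<and> 0 \<in> U"
    then obtain p where p: "ccseminorm p" "{y. p (y - 0) < 1} \<subseteq> U"
      using open_contains_cseminorm_ball by blast
    obtain J L where J: "(J \<longlongrightarrow> L) at_top" "\<forall>b\<ge>0. \<forall>b'\<ge>0. p (I b' - I b) \<le> \<bar>J b' - J b\<bar>"
      using est[OF p(1)] by blast
    have "eventually (\<lambda>b. \<bar>J b - L\<bar> < 1 / 2) at_top"
      using tendstoD[OF J(1), of "1 / 2"] by (simp add: dist_real_def)
    then obtain B where B: "\<And>b. b \<ge> B \<Longrightarrow> \<bar>J b - L\<bar> < 1 / 2"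
      by (auto simp: eventually_at_top_linorder)
    obtain N :: nat where N: "B \<le> real N" using real_arch_simple by blast
    have "I (real m) - I (real n) \<in> U" if "m \<ge> N" "n \<ge> N" for m n
    proof -
      have "B \<le> real m" "B \<le> real n" using that N by linarith+
      then have "\<bar>J (real m) - L\<bar> < 1 / 2" "\<bar>J (real n) - L\<bar> < 1 / 2" by (auto dest: B)
      then have "\<bar>J (real m) - J (real n)\<bar> < 1" by linarith
      moreover have "p (I (real m) - I (real n)) \<le> \<bar>J (real m) - J (real n)\<bar>" using J(2) by simp
      ultimately show ?thesis using p(2) by auto
    qed
    then show "\<exists>N. \<forall>m\<ge>N. \<forall>n\<ge>N. I (real m) - I (real n) \<in> U" by blast
  qed
  then obtain z where z: "(\<lambda>n. I (real n)) \<longlonglongrightarrow> z"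
    using lcs_Cauchy_convergent by (auto simp: convergent_def)
  have I_lim: "(I \<longlongrightarrow> z) at_top"
    unfolding tendsto_lcs_iff
  proof (intro allI impI)
    fix p :: "'x \<Rightarrow> real" assume p: "ccseminorm p"
    obtain J L where J: "(J \<longlongrightarrow> L) at_top" "\<forall>b\<ge>0. \<forall>b'\<ge>0. p (I b' - I b) \<le> \<bar>J b' - J b\<bar>"
      using est[OF p] by blast
    have le: "p (I b - z) \<le> \<bar>J b - L\<bar>" if "b \<ge> 0" for b
    proof (rule LIMSEQ_le)
      show "(\<lambda>n. p (I b - I (real n))) \<longlonglongrightarrow> p (I b - z)"
        by (rule continuous_on_tendsto_compose[OF conjunct2[OF p]]) (auto intro!: tendsto_intros z)
      show "(\<lambda>n. \<bar>J b - J (real n)\<bar>) \<longlonglongrightarrow> \<bar>J b - L\<bar>"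
        by (intro tendsto_intros filterlim_compose[OF J(1)] filterlim_real_sequentially)
      show "\<exists>N. \<forall>n\<ge>N. p (I b - I (real n)) \<le> \<bar>J b - J (real n)\<bar>" using J(2) that by auto
    qed
    have "((\<lambda>b. \<bar>J b - L\<bar>) \<longlongrightarrow> \<bar>L - L\<bar>) at_top" by (intro tendsto_intros J(1))
    then have lim: "((\<lambda>b. \<bar>J b - L\<bar>) \<longlongrightarrow> 0) at_top" by simp
    have "eventually (\<lambda>b. p (I b - z) \<le> \<bar>J b - L\<bar>) at_top"
      by (rule eventually_mono[OF eventually_ge_at_top[of 0] le])
    then show "((\<lambda>b. p (I b - z)) \<longlongrightarrow> 0) at_top"
      using p by (intro tendsto_sandwich[OF _ _ tendsto_const lim]) (auto simp: cseminorm_nonneg)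
  qed
  have f_cont: "continuous_on {0..} f"
    unfolding f[abs_def] by (intro continuous_intros w k)
  have cdual_F: "\<phi> (lcs_integral (lebesgue_on {0..b}) (\<lambda>t. e t *\<^sub>C f t)) = laplace_partial (\<lambda>t. \<phi> (f t)) \<mu> b"
    if "b \<ge> 0" "\<phi> \<in> cdual" for \<phi> b
    using cdual_lcs_integral[OF that(1) e_int continuous_on_subset[OF f_cont] that(2)]
    by (simp add: laplace_partial_def e_def has_bochner_integral_iff)
  have F_eq: "lcs_integral (lebesgue_on {0..b}) (\<lambda>t. e t *\<^sub>C f t) = I b + laplace_partial k \<mu> b *\<^sub>C x" if "b \<ge> 0" for b
  proof (rule cdual_separates)
    fix \<psi> :: "'x \<Rightarrow> complex" assume \<psi>: "\<psi> \<in> cdual"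
    have "\<psi> (lcs_integral (lebesgue_on {0..b}) (\<lambda>t. e t *\<^sub>C f t)) = (\<integral>t. e t * \<psi> (w t) + (e t * k t) * \<psi> x \<partial>lebesgue_on {0..b})"
      unfolding cdual_F[OF that \<psi>] laplace_partial_def
      by (intro Bochner_Integration.integral_cong refl)
        (simp add: f cdual_add[OF \<psi>] cdual_scaleC[OF \<psi>] e_def algebra_simps)
    also have "\<dots> = (\<integral>t. e t * \<psi> (w t) \<partial>lebesgue_on {0..b}) + (\<integral>t. (e t * k t) * \<psi> x \<partial>lebesgue_on {0..b})"
      by (intro Bochner_Integration.integral_add continuous_imp_integrable_real continuous_intros e_cont
          cdual_continuous_on_compose[OF \<psi>] continuous_on_subset[OF w] continuous_on_subset[OF k(1)]) auto
    also have "\<dots> = \<psi> (I b) + laplace_partial k \<mu> b * \<psi> x"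
      by (simp only: cdual_I[OF that \<psi>] integral_mult_left_zero laplace_partial_def e_def)
    finally show "\<psi> (lcs_integral (lebesgue_on {0..b}) (\<lambda>t. e t *\<^sub>C f t)) = \<psi> (I b + laplace_partial k \<mu> b *\<^sub>C x)"
      by (simp add: cdual_add[OF \<psi>] cdual_scaleC[OF \<psi>])
  qed
  have lim: "((\<lambda>b. I b + laplace_partial k \<mu> b *\<^sub>C x) \<longlongrightarrow> z + laplace k \<mu> *\<^sub>C x) at_top"
    by (intro tendsto_intros I_lim tendsto_laplace k)
  have F_lim: "((\<lambda>b. lcs_integral (lebesgue_on {0..b}) (\<lambda>t. e t *\<^sub>C f t)) \<longlongrightarrow> z + laplace k \<mu> *\<^sub>C x) at_top"
    by (rule Lim_transform_eventually[OF lim])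
      (rule eventually_mono[OF eventually_ge_at_top[of 0]], simp add: F_eq)
  then have "lcs_laplace f \<mu> = z + laplace k \<mu> *\<^sub>C x"
    unfolding lcs_laplace_def e_def by (intro tendsto_Lim) simp_all
  with F_lim have "((\<lambda>b. lcs_integral (lebesgue_on {0..b}) (\<lambda>t. e t *\<^sub>C f t)) \<longlongrightarrow> lcs_laplace f \<mu>) at_top" by simp
  from cdual_tendsto[OF \<phi> this] show ?thesis
    by (rule Lim_transform_eventually)
      (rule eventually_mono[OF eventually_ge_at_top[of 0]], simp add: cdual_F \<phi>)
qed

section \<open>The characterization of the families\<close>

text \<open>Equicontinuity bounds all rescaled operators by 1 in p on a single seminorm ball; every
  vector is brought into that ball by scaling.\<close>

lemma equicontinuous_orbit_bound:
  fixes R :: "real \<Rightarrow> 'y::complex_lcs \<Rightarrow> 'x::complex_lcs"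
  assumes R: "strongly_continuous_family R"
    and eq: "equicontinuous_ops {(\<lambda>y. complex_of_real (exp (- \<omega> * t)) *\<^sub>C R t y) |t. t \<ge> 0}"
    and p: "ccseminorm p"
  obtains C where "C \<ge> 0" "\<And>t. t \<ge> 0 \<Longrightarrow> p (R t y) \<le> C * exp (\<omega> * t)"
proof -
  define U where "U = {x. p (x - 0) < 1}"
  define \<F> where "\<F> = {(\<lambda>y. complex_of_real (exp (- \<omega> * t)) *\<^sub>C R t y) |t. t \<ge> 0}"
  have "open U" unfolding U_def by (rule open_cseminorm_ball[OF p])
  moreover have "0 \<in> U" using p by (simp add: U_def cseminorm_zero)
  ultimately have "\<exists>V. open V \<and> 0 \<in> V \<and> (\<forall>T\<in>\<F>. T ` V \<subseteq> U)"
    using spec[OF eq[folded \<F>_def, unfolded equicontinuous_ops_def], of U] by simp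
  then obtain V where V: "open V" "0 \<in> V" "\<forall>T\<in>\<F>. T ` V \<subseteq> U"
    by (elim exE conjE)
  obtain q where q: "ccseminorm q" "{y. q (y - 0) < 1} \<subseteq> V"
    using open_contains_cseminorm_ball[OF V(1,2)] by blast
  \<comment> \<open>The added 1 keeps C positive when q y = 0 and puts y / C strictly inside the
    unit ball.\<close>
  define C where "C = q y + 1"
  have C: "C > 0" using cseminorm_nonneg[of q y] q by (simp add: C_def)
  have "q (complex_of_real (inverse C) *\<^sub>C y) = q y / C"
    using C q by (simp add: cseminorm_scaleC divide_inverse mult.commute norm_inverse)
  then have "complex_of_real (inverse C) *\<^sub>C y \<in> V"
    using C q by (auto simp: C_def)
  have "p (R t y) \<le> C * exp (\<omega> * t)" if t: "t \<ge> 0" for t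
  proof -
    have "R t \<in> continuous_linear_ops" using R t by (simp add: strongly_continuous_family_def)
    then have "R t (complex_of_real (inverse C) *\<^sub>C y) = complex_of_real (inverse C) *\<^sub>C R t y"
      by (simp add: continuous_linear_ops_def module_hom.scale[OF Vector_Spaces.linear.axioms(3)])
    moreover have "p (complex_of_real (exp (- \<omega> * t)) *\<^sub>C R t (complex_of_real (inverse C) *\<^sub>C y)) < 1"
    proof -
      have "(\<lambda>y. complex_of_real (exp (- \<omega> * t)) *\<^sub>C R t y) \<in> \<F>" using t by (auto simp: \<F>_def)
      from imageI[OF \<open>complex_of_real (inverse C) *\<^sub>C y \<in> V\<close>, THEN subsetD[OF bspec[OF V(3) this]]]
      show ?thesis by (simp add: U_def)
    qed
    ultimately have "exp (- \<omega> * t) * inverse C * p (R t y) < 1"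
      using p C by (simp add: cseminorm_scaleC norm_mult norm_inverse)
    then show ?thesis using C by (simp add: exp_minus field_simps)
  qed
  then show thesis using C that[of C] by simp
qed

lemma strongly_continuous_family_continuous_on:
  "strongly_continuous_family R \<Longrightarrow> continuous_on {0..} (\<lambda>t. R t y)"
  by (simp add: strongly_continuous_family_def)

lemma locally_integrable_continuous: "continuous_on {0..} k \<Longrightarrow> locally_integrable k"
  unfolding locally_integrable_def
  by (intro allI impI continuous_imp_integrable_real) (auto intro: continuous_on_subset)

lemma laplace_partial_add:
  assumes "locally_integrable f" "locally_integrable g" "b \<ge> 0"
  shows "laplace_partial (\<lambda>t. f t + g t) \<mu> b = laplace_partial f \<mu> b + laplace_partial g \<mu> b"
  unfolding laplace_partial_def distrib_left
  using assms by (intro Bochner_Integration.integral_add integrable_laplace_kernel) (auto simp: locally_integrable_def)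

lemma laplace_partial_cmult: "laplace_partial (\<lambda>t. c * f t) \<mu> b = c * laplace_partial f \<mu> b"
  unfolding laplace_partial_def by (simp only: mult.left_commute[of _ c] integral_mult_right_zero)

lemma tendsto_laplace_partial_add:
  assumes "locally_integrable f" "locally_integrable g"
    and "(laplace_partial f \<mu> \<longlongrightarrow> F) at_top" "(laplace_partial g \<mu> \<longlongrightarrow> G) at_top"
  shows "(laplace_partial (\<lambda>t. f t + g t) \<mu> \<longlongrightarrow> F + G) at_top"
  by (rule Lim_transform_eventually[OF tendsto_add[OF assms(3,4)]])
    (rule eventually_mono[OF eventually_ge_at_top[of 0]], simp add: laplace_partial_add assms)

lemma tendsto_laplace_partial_cmult:
  "(laplace_partial f \<mu> \<longlongrightarrow> F) at_top \<Longrightarrow> (laplace_partial (\<lambda>t. c * f t) \<mu> \<longlongrightarrow> c * F) at_top"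
  unfolding laplace_partial_cmult[abs_def] by (intro tendsto_intros)

lemma laplace_partial_cong:
  "(\<And>t. t \<ge> 0 \<Longrightarrow> f t = g t) \<Longrightarrow> laplace_partial f \<mu> = laplace_partial g \<mu>"
  unfolding laplace_partial_def by (intro ext Bochner_Integration.integral_cong) auto

text \<open>The term n = 0 provides convergence at the base point c; the later terms are the zeros
  that \<open>lerch\<close> asks for.\<close>

lemma lerch_continuous:
  assumes g: "continuous_on {0..} g"
    and zero: "\<And>n::nat. (laplace_partial g (of_real (c + real n)) \<longlongrightarrow> 0) at_top" and t: "t \<ge> 0"
  shows "g t = 0"
proof (rule laplace_partial_eq_0_continuous[OF g _ t])
  show "laplace_partial g (of_real c) s = 0" if "s \<ge> 0" for s
  proof (rule lerch[OF locally_integrable_continuous[OF g] _ _ that])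
    show "laplace_exists g (of_real c)" using zero[of 0] by (auto simp: laplace_exists_def)
    show "laplace g (of_real (c + Suc n)) = 0" for n by (rule laplace_eqI[OF zero])
  qed
qed

text \<open>What is extracted from (P1) and the abscissae: absolute convergence for
  \<open>a\<close>, but only convergence for k, throughout the half-plane.\<close>

locale volterra_kernel =
  fixes a k :: "real \<Rightarrow> complex" and \<omega> :: real
  assumes k: "continuous_on {0..} k" and k_nz: "\<exists>t\<ge>0. k t \<noteq> 0"
    and a: "locally_integrable a" and a_nz: "\<not> (AE t in lebesgue_on {0..}. a t = 0)"
    and a_int: "\<And>\<mu>. \<omega> < Re \<mu> \<Longrightarrow> integrable (lebesgue_on {0..}) (\<lambda>t. lexp \<mu> t * a t)"
    and k_ex: "\<And>\<mu>. \<omega> < Re \<mu> \<Longrightarrow> laplace_exists k \<mu>"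
begin

lemma progression:
  obtains c where "c > \<omega>" "\<And>n::nat. laplace a (of_real (c + n)) * laplace k (of_real (c + n)) \<noteq> 0"
proof -
  let ?\<sigma> = "complex_of_real (\<omega> + 1)"
  have a_ex: "laplace_exists a ?\<sigma>"
    using tendsto_integral_lebesgue_on_atLeast0[OF a_int[of ?\<sigma>]]
    by (auto simp: laplace_exists_def laplace_partial_def[abs_def])
  have k_nz': "\<not> (AE t in lebesgue_on {0..}. k t = 0)"
  proof
    assume "AE t in lebesgue_on {0..}. k t = 0"
    \<comment> \<open>At \<mu> = 0 the partial transform is the integral of k; a continuous k that
      is zero almost everywhere then vanishes at every t \<ge> 0.\<close>
    then have AE_b: "AE t in lebesgue_on {0..b}. exp (- (0 * of_real t)) * k t = 0" for b
      by (auto simp: AE_restrict_space_iff elim!: eventually_mono)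
    have "laplace_partial k 0 b = 0" for b
      unfolding laplace_partial_def by (rule integral_eq_zero_AE[OF AE_b])
    then show False using laplace_partial_eq_0_continuous[OF k, of 0] k_nz by blast
  qed
  let ?Z = "\<lambda>g. {x. Re ?\<sigma> < x \<and> laplace g (of_real x) = 0}"
  have "countable (?Z a \<union> ?Z k)"
    using countable_laplace_zeros[OF a a_ex a_nz]
      countable_laplace_zeros[OF locally_integrable_continuous[OF k] k_ex k_nz', of ?\<sigma>] by simp
  then obtain c where c: "c > \<omega> + 1" "\<And>n::nat. c + n \<notin> ?Z a \<union> ?Z k"
    by (rule exists_progression_avoiding_countable[where \<sigma> = "\<omega> + 1"]) blast
  show thesis
  proof (rule that[of c])
    show "c > \<omega>" using c(1) by simp
    show "laplace a (of_real (c + n)) * laplace k (of_real (c + n)) \<noteq> 0" for n :: nat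
      using c(1) c(2)[of n] by auto
  qed
qed

text \<open>Tested with functionals, u has the transform
  \<open>laplace k \<mu> *\<^sub>C c - Z\<close>, so its convolution with \<open>a\<close> has
  \<open>laplace a \<mu>\<close> times that, which is the negative of the vector inside
  \<psi>.\<close>

lemma existence_defect:
  fixes u :: "real \<Rightarrow> 'x::seq_complete_lcs" and c :: 'x
  assumes u: "continuous_on {0..} u" and bound: "\<And>p. ccseminorm p \<Longrightarrow> \<exists>C. \<forall>t\<ge>0. p (u t) \<le> C * exp (\<omega> * t)"
    and \<phi>: "\<phi> \<in> cdual" and \<psi>: "\<psi> \<in> cdual" and \<mu>: "\<omega> < Re \<mu>"
  defines "Z \<equiv> lcs_laplace (\<lambda>t. k t *\<^sub>C c - u t) \<mu>"
  shows "(laplace_partial (\<lambda>t. \<phi> (u t - k t *\<^sub>C c) + \<psi> (convolution a u t)) \<mu> \<longlongrightarrow>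
    - (\<phi> Z + \<psi> (laplace a \<mu> *\<^sub>C Z - (laplace a \<mu> * laplace k \<mu>) *\<^sub>C c))) at_top"
proof -
  have minus_bound: "\<exists>C. \<forall>t\<ge>0. p (- u t) \<le> C * exp (\<omega> * t)" if "ccseminorm p" for p
    using bound[OF that] that by (simp add: cseminorm_minus)
  have Z: "(laplace_partial (\<lambda>t. \<theta> (k t *\<^sub>C c - u t)) \<mu> \<longlongrightarrow> \<theta> Z) at_top" if \<theta>: "\<theta> \<in> cdual" for \<theta>
    unfolding Z_def
    by (rule lcs_laplace_cdual[OF _ minus_bound \<mu> k k_ex[OF \<mu>] _ \<theta>]) (auto intro!: continuous_intros u)
  define r where "r t = \<psi> (u t)" for t
  have r: "continuous_on {0..} r" unfolding r_def by (rule cdual_continuous_on_compose[OF \<psi> u])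
  obtain C where C: "\<And>t. t \<ge> 0 \<Longrightarrow> cmod (r t) \<le> C * exp (\<omega> * t)"
    using bound[OF cdual_cseminorm[OF \<psi>]] by (auto simp: r_def)
  note conv = laplace_scalar_convolution[OF a a_int[OF \<mu>] r C \<mu>]
  have "(laplace_partial (\<lambda>t. \<psi> c * k t + (- 1) * r t) \<mu> \<longlongrightarrow> \<psi> c * laplace k \<mu> + (- 1) * laplace r \<mu>) at_top"
    by (intro tendsto_laplace_partial_add tendsto_laplace_partial_cmult tendsto_laplace k_ex \<mu> conv(2)
        locally_integrable_continuous continuous_intros k r)
  moreover have "(\<lambda>t. \<psi> c * k t + (- 1) * r t) = (\<lambda>t. \<psi> (k t *\<^sub>C c - u t))"
    by (simp add: fun_eq_iff r_def cdual_diff[OF \<psi>] cdual_scaleC[OF \<psi>])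
  ultimately have "(laplace_partial (\<lambda>t. \<psi> (k t *\<^sub>C c - u t)) \<mu> \<longlongrightarrow> \<psi> c * laplace k \<mu> + (- 1) * laplace r \<mu>) at_top"
    by simp
  \<comment> \<open>Two limits of the same partial transform, one scalar and one through
    \<open>lcs_laplace\<close>, determine the transform of r.\<close>
  from tendsto_unique[OF trivial_limit_at_top_linorder this Z[OF \<psi>]]
  have lap_r: "laplace r \<mu> = \<psi> c * laplace k \<mu> - \<psi> Z" by (simp add: algebra_simps)
  have conv_eq: "laplace_partial (\<lambda>t. \<psi> (convolution a u t)) \<mu>
      = laplace_partial (\<lambda>t. \<integral>s. a (t - s) * r s \<partial>lebesgue_on {0..t}) \<mu>"
    using cdual_convolution[OF a u _ \<psi>] by (intro laplace_partial_cong) (simp add: has_bochner_integral_iff r_def)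
  have "(laplace_partial (\<lambda>t. (- 1) * \<phi> (k t *\<^sub>C c - u t) + \<psi> (convolution a u t)) \<mu>
      \<longlongrightarrow> (- 1) * \<phi> Z + laplace a \<mu> * laplace r \<mu>) at_top"
    using conv(1) unfolding conv_eq[symmetric]
    by (intro tendsto_laplace_partial_add tendsto_laplace_partial_cmult Z[OF \<phi>] locally_integrable_continuous
        continuous_intros cdual_continuous_on_compose[OF \<phi>] cdual_continuous_on_compose[OF \<psi>]
        continuous_on_convolution[OF a u] k u)
  moreover have "(\<lambda>t. (- 1) * \<phi> (k t *\<^sub>C c - u t) + \<psi> (convolution a u t))
      = (\<lambda>t. \<phi> (u t - k t *\<^sub>C c) + \<psi> (convolution a u t))"
    by (simp add: fun_eq_iff cdual_diff[OF \<phi>])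
  moreover have "(- 1) * \<phi> Z + laplace a \<mu> * laplace r \<mu>
      = - (\<phi> Z + \<psi> (laplace a \<mu> *\<^sub>C Z - (laplace a \<mu> * laplace k \<mu>) *\<^sub>C c))"
    by (simp add: lap_r cdual_diff[OF \<psi>] cdual_scaleC[OF \<psi>] algebra_simps)
  ultimately show ?thesis by (simp only:)
qed

text \<open>(E) asks for some u in \<A> Z with \<open>laplace a \<mu> *\<^sub>C Z - u\<close>
  prescribed; the equation determines u = W. Both sides thus become membership in \<A>, tested by
  pairs annihilating it.\<close>

lemma existence_iff:
  fixes \<A> :: "('x::seq_complete_lcs \<times> 'x) set"
  assumes \<A>: "MLO \<A>" "closed \<A>"
    and u: "continuous_on {0..} u" and bound: "\<And>p. ccseminorm p \<Longrightarrow> \<exists>C. \<forall>t\<ge>0. p (u t) \<le> C * exp (\<omega> * t)"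
  shows "(\<forall>t\<ge>0. (u t - k t *\<^sub>C c, convolution a u t) \<in> \<A>) \<longleftrightarrow>
    (\<forall>\<mu>. \<omega> < Re \<mu> \<and> laplace a \<mu> * laplace k \<mu> \<noteq> 0 \<longrightarrow>
      (laplace a \<mu> * laplace k \<mu>) *\<^sub>C c \<in> scalar_minus (laplace a \<mu>) \<A> `` {lcs_laplace (\<lambda>t. k t *\<^sub>C c - u t) \<mu>})"
    (is "?L \<longleftrightarrow> ?R")
proof -
  define Z where "Z \<mu> = lcs_laplace (\<lambda>t. k t *\<^sub>C c - u t) \<mu>" for \<mu>
  define W where "W \<mu> = laplace a \<mu> *\<^sub>C Z \<mu> - (laplace a \<mu> * laplace k \<mu>) *\<^sub>C c" for \<mu>
  have E_iff: "(laplace a \<mu> * laplace k \<mu>) *\<^sub>C c \<in> scalar_minus (laplace a \<mu>) \<A> `` {Z \<mu>} \<longleftrightarrow> (Z \<mu>, W \<mu>) \<in> \<A>" for \<mu>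
    by (auto simp: scalar_minus_def W_def intro!: exI[of _ "W \<mu>"])
  have R_iff: "?R \<longleftrightarrow> (\<forall>\<mu>. \<omega> < Re \<mu> \<and> laplace a \<mu> * laplace k \<mu> \<noteq> 0 \<longrightarrow> (Z \<mu>, W \<mu>) \<in> \<A>)"
    unfolding Z_def[symmetric] E_iff ..
  show ?thesis
    unfolding R_iff
  proof (intro iffI allI impI)
    fix \<mu> assume L: ?L and \<mu>: "\<omega> < Re \<mu> \<and> laplace a \<mu> * laplace k \<mu> \<noteq> 0"
    show "(Z \<mu>, W \<mu>) \<in> \<A>"
    proof (rule closed_MLO_memI[OF \<A>])
      fix \<phi> \<psi> :: "'x \<Rightarrow> complex" assume d: "\<phi> \<in> cdual" "\<psi> \<in> cdual" "\<And>u v. (u, v) \<in> \<A> \<Longrightarrow> \<phi> u + \<psi> v = 0"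
      have lim: "(laplace_partial (\<lambda>t. \<phi> (u t - k t *\<^sub>C c) + \<psi> (convolution a u t)) \<mu> \<longlongrightarrow> - (\<phi> (Z \<mu>) + \<psi> (W \<mu>))) at_top"
        unfolding Z_def W_def by (rule existence_defect[OF u bound d(1,2)]) (use \<mu> in auto)
      have "laplace_partial (\<lambda>t. \<phi> (u t - k t *\<^sub>C c) + \<psi> (convolution a u t)) \<mu> = laplace_partial (\<lambda>t. 0) \<mu>"
        using L d(3) by (intro laplace_partial_cong) simp
      also have "\<dots> = (\<lambda>b. 0)" by (simp add: laplace_partial_def[abs_def])
      finally have "- (\<phi> (Z \<mu>) + \<psi> (W \<mu>)) = 0"
        by (intro tendsto_unique[OF trivial_limit_at_top_linorder lim]) simp
      then show "\<phi> (Z \<mu>) + \<psi> (W \<mu>) = 0" by (simp only: neg_equal_0_iff_equal)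
    qed
  next
    fix t :: real
    assume R: "\<forall>\<mu>. \<omega> < Re \<mu> \<and> laplace a \<mu> * laplace k \<mu> \<noteq> 0 \<longrightarrow> (Z \<mu>, W \<mu>) \<in> \<A>" and t: "t \<ge> 0"
    obtain s where s: "s > \<omega>" "\<And>n::nat. laplace a (of_real (s + n)) * laplace k (of_real (s + n)) \<noteq> 0"
      using progression by blast
    show "(u t - k t *\<^sub>C c, convolution a u t) \<in> \<A>"
    proof (rule closed_MLO_memI[OF \<A>])
      fix \<phi> \<psi> :: "'x \<Rightarrow> complex" assume d: "\<phi> \<in> cdual" "\<psi> \<in> cdual" "\<And>u v. (u, v) \<in> \<A> \<Longrightarrow> \<phi> u + \<psi> v = 0"
      show "\<phi> (u t - k t *\<^sub>C c) + \<psi> (convolution a u t) = 0"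
      proof (rule lerch_continuous[OF _ _ t])
        show "continuous_on {0..} (\<lambda>t. \<phi> (u t - k t *\<^sub>C c) + \<psi> (convolution a u t))"
          by (intro continuous_intros cdual_continuous_on_compose[OF d(1)] cdual_continuous_on_compose[OF d(2)]
              continuous_on_convolution[OF a u] k u)
        fix n :: nat
        let ?\<mu> = "complex_of_real (s + real n)"
        have \<mu>: "\<omega> < Re ?\<mu>" using s(1) by simp
        have "(laplace_partial (\<lambda>t. \<phi> (u t - k t *\<^sub>C c) + \<psi> (convolution a u t)) ?\<mu> \<longlongrightarrow> - (\<phi> (Z ?\<mu>) + \<psi> (W ?\<mu>))) at_top"
          unfolding Z_def W_def by (rule existence_defect[OF u bound d(1,2) \<mu>])
        moreover have "\<phi> (Z ?\<mu>) + \<psi> (W ?\<mu>) = 0" using R \<mu> s(2)[of n] by (intro d(3)) blast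
        ultimately show "(laplace_partial (\<lambda>t. \<phi> (u t - k t *\<^sub>C c) + \<psi> (convolution a u t)) ?\<mu> \<longlongrightarrow> 0) at_top"
          by (simp only: minus_zero)
      qed
    qed
  qed
qed

text \<open>The transform of the modulus of \<open>a\<close> may diverge at \<omega> itself, so the
  growth of the convolution is estimated with an intermediate exponent between \<omega> and Re
  \<mu>. The whole difference is then exponentially bounded, and \<open>lcs_laplace_cdual\<close> is
  used with zero scalar part.\<close>

lemma uniqueness_laplace:
  fixes u v :: "real \<Rightarrow> 'x::seq_complete_lcs"
  assumes u: "continuous_on {0..} u" "\<And>p. ccseminorm p \<Longrightarrow> \<exists>C. \<forall>t\<ge>0. p (u t) \<le> C * exp (\<omega> * t)"
    and v: "continuous_on {0..} v" "\<And>p. ccseminorm p \<Longrightarrow> \<exists>C\<ge>0. \<forall>t\<ge>0. p (v t) \<le> C * exp (\<omega> * t)"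
    and \<mu>: "\<omega> < Re \<mu>" and \<phi>: "\<phi> \<in> cdual"
  shows "(laplace_partial (\<lambda>t. \<phi> (u t - convolution a v t)) \<mu> \<longlongrightarrow>
    \<phi> (lcs_laplace (\<lambda>t. u t - convolution a v t) \<mu>)) at_top"
proof -
  obtain \<omega>' where \<omega>': "\<omega> < \<omega>'" "\<omega>' < Re \<mu>" using dense[OF \<mu>] by blast
  show ?thesis
  proof (rule lcs_laplace_cdual[OF _ _ \<omega>'(2) continuous_on_const[of _ 0] _ _ \<phi>])
    show "continuous_on {0..} (\<lambda>t. u t - convolution a v t)"
      by (intro continuous_intros u continuous_on_convolution[OF a v(1)])
    show "laplace_exists (\<lambda>t. 0) \<mu>" by (auto simp: laplace_exists_def laplace_partial_def[abs_def])
    show "u t - convolution a v t = u t - convolution a v t + 0 *\<^sub>C 0" for t by simp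
    fix p :: "'x \<Rightarrow> real" assume p: "ccseminorm p"
    obtain C where C: "\<And>t. t \<ge> 0 \<Longrightarrow> p (u t) \<le> C * exp (\<omega> * t)" using u(2)[OF p] by blast
    obtain D where D: "D \<ge> 0" "\<And>t. t \<ge> 0 \<Longrightarrow> p (v t) \<le> D * exp (\<omega> * t)" using v(2)[OF p] by blast
    have exp_le: "exp (\<omega> * t) \<le> exp (\<omega>' * t)" if "t \<ge> 0" for t
      using \<omega>'(1) that by (simp add: mult_right_mono)
    let ?N = "\<integral>t. cmod (exp (- (of_real \<omega>' * of_real t)) * a t) \<partial>lebesgue_on {0..}"
    have "p (u t - convolution a v t) \<le> (\<bar>C\<bar> + D * ?N) * exp (\<omega>' * t)" if t: "t \<ge> 0" for t
    proof -
      have "p (v s) \<le> D * exp (\<omega>' * s)" if "s \<ge> 0" for s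
        using D(2)[OF that] mult_left_mono[OF exp_le[OF that] D(1)] by linarith
      then have "p (convolution a v t) \<le> D * ?N * exp (\<omega>' * t)"
        using \<omega>'(1) by (intro cseminorm_convolution_le[OF a v(1) p a_int _ D(1) t]) auto
      moreover have "p (u t) \<le> \<bar>C\<bar> * exp (\<omega>' * t)"
        using C[OF t] mult_mono[OF abs_ge_self exp_le[OF t], of C] by simp
      ultimately show ?thesis
        using cseminorm_triangle[of p "u t" "- convolution a v t"] p
        by (simp add: cseminorm_minus distrib_right)
    qed
    then show "\<exists>C. \<forall>t\<ge>0. p (u t - convolution a v t) \<le> C * exp (\<omega>' * t)" by blast
  qed
qed

lemma uniqueness_transform:
  fixes u v :: "real \<Rightarrow> 'x::seq_complete_lcs"
  assumes u: "continuous_on {0..} u" "\<And>p. ccseminorm p \<Longrightarrow> \<exists>C. \<forall>t\<ge>0. p (u t) \<le> C * exp (\<omega> * t)"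
    and v: "continuous_on {0..} v" "\<And>p. ccseminorm p \<Longrightarrow> \<exists>C\<ge>0. \<forall>t\<ge>0. p (v t) \<le> C * exp (\<omega> * t)"
    and eq: "\<And>t. t \<ge> 0 \<Longrightarrow> convolution a v t = u t - k t *\<^sub>C c" and \<mu>: "\<omega> < Re \<mu>"
  shows "laplace k \<mu> *\<^sub>C c = lcs_laplace (\<lambda>t. u t - convolution a v t) \<mu>"
proof (rule cdual_separates)
  fix \<phi> :: "'x \<Rightarrow> complex" assume \<phi>: "\<phi> \<in> cdual"
  have "laplace_partial (\<lambda>t. \<phi> (u t - convolution a v t)) \<mu> = laplace_partial (\<lambda>t. \<phi> c * k t) \<mu>"
    by (rule laplace_partial_cong) (simp add: eq cdual_scaleC[OF \<phi>])
  moreover have "(laplace_partial (\<lambda>t. \<phi> c * k t) \<mu> \<longlongrightarrow> \<phi> c * laplace k \<mu>) at_top"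
    by (intro tendsto_laplace_partial_cmult tendsto_laplace k_ex \<mu>)
  ultimately have "(laplace_partial (\<lambda>t. \<phi> (u t - convolution a v t)) \<mu> \<longlongrightarrow> \<phi> c * laplace k \<mu>) at_top"
    by (simp only:)
  from tendsto_unique[OF trivial_limit_at_top_linorder this uniqueness_laplace[OF u v \<mu> \<phi>]]
  have "\<phi> c * laplace k \<mu> = \<phi> (lcs_laplace (\<lambda>t. u t - convolution a v t) \<mu>)" .
  then show "\<phi> (laplace k \<mu> *\<^sub>C c) = \<phi> (lcs_laplace (\<lambda>t. u t - convolution a v t) \<mu>)"
    by (simp add: cdual_scaleC[OF \<phi>] mult.commute)
qed

text \<open>The identity is assumed just off the zeros of the two transforms, the form in which (i)
  provides it; a progression avoiding these zeros is enough for Lerch.\<close>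

lemma uniqueness_inversion:
  fixes u v :: "real \<Rightarrow> 'x::seq_complete_lcs"
  assumes u: "continuous_on {0..} u" "\<And>p. ccseminorm p \<Longrightarrow> \<exists>C. \<forall>t\<ge>0. p (u t) \<le> C * exp (\<omega> * t)"
    and v: "continuous_on {0..} v" "\<And>p. ccseminorm p \<Longrightarrow> \<exists>C\<ge>0. \<forall>t\<ge>0. p (v t) \<le> C * exp (\<omega> * t)"
    and eq: "\<And>\<mu>. \<omega> < Re \<mu> \<Longrightarrow> laplace a \<mu> * laplace k \<mu> \<noteq> 0 \<Longrightarrow>
      laplace k \<mu> *\<^sub>C c = lcs_laplace (\<lambda>t. u t - convolution a v t) \<mu>" and t: "t \<ge> 0"
  shows "convolution a v t = u t - k t *\<^sub>C c"
proof (rule cdual_separates)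
  fix \<phi> :: "'x \<Rightarrow> complex" assume \<phi>: "\<phi> \<in> cdual"
  obtain s where s: "s > \<omega>" "\<And>n::nat. laplace a (of_real (s + n)) * laplace k (of_real (s + n)) \<noteq> 0"
    using progression by blast
  have cont: "continuous_on {0..} (\<lambda>t. \<phi> (u t - convolution a v t))"
    by (intro cdual_continuous_on_compose[OF \<phi>] continuous_intros u continuous_on_convolution[OF a v(1)])
  have "\<phi> (u t - convolution a v t) + (- \<phi> c) * k t = 0"
  proof (rule lerch_continuous[OF _ _ t])
    show "continuous_on {0..} (\<lambda>t. \<phi> (u t - convolution a v t) + (- \<phi> c) * k t)"
      by (intro continuous_intros cont k)
    fix n :: nat
    let ?\<mu> = "complex_of_real (s + real n)"
    have \<mu>: "\<omega> < Re ?\<mu>" using s(1) by simp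
    have "(laplace_partial (\<lambda>t. \<phi> (u t - convolution a v t) + (- \<phi> c) * k t) ?\<mu>
        \<longlongrightarrow> \<phi> (lcs_laplace (\<lambda>t. u t - convolution a v t) ?\<mu>) + (- \<phi> c) * laplace k ?\<mu>) at_top"
      by (intro tendsto_laplace_partial_add uniqueness_laplace[OF u v \<mu> \<phi>] tendsto_laplace_partial_cmult
          tendsto_laplace k_ex \<mu> locally_integrable_continuous cont continuous_intros k)
    then show "(laplace_partial (\<lambda>t. \<phi> (u t - convolution a v t) + (- \<phi> c) * k t) ?\<mu> \<longlongrightarrow> 0) at_top"
      unfolding eq[OF \<mu> s(2), symmetric] by (simp add: cdual_scaleC[OF \<phi>])
  qed
  then show "\<phi> (convolution a v t) = \<phi> (u t - k t *\<^sub>C c)"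
    by (simp add: cdual_diff[OF \<phi>] cdual_scaleC[OF \<phi>] algebra_simps)
qed

end

section \<open>From (P1) and equicontinuity to the three equivalences\<close>

theorem proposition2p1:
  fixes \<A> :: "('x::seq_complete_lcs \<times> 'x) set"
    and C\<^sub>1 :: "'y::seq_complete_lcs \<Rightarrow> 'x"
    and C\<^sub>2 :: "'x \<Rightarrow> 'x"
    and a k :: "real \<Rightarrow> complex"
    and R\<^sub>1 :: "real \<Rightarrow> 'y \<Rightarrow> 'x"
    and R\<^sub>2 :: "real \<Rightarrow> 'x \<Rightarrow> 'x"
    and \<omega> :: real
  assumes k: "continuous_on {0..} k" "\<exists>t\<ge>0. k t \<noteq> 0"
    and a: "locally_integrable a" "\<not> (AE t in lebesgue_on {0..}. a t = 0)"
    and P1: "P1 (\<lambda>t. complex_of_real (cmod (a t)))" "P1 k"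
    and \<A>: "MLO \<A>" "closed \<A>"
    and C: "C\<^sub>1 \<in> continuous_linear_ops" "C\<^sub>2 \<in> continuous_linear_ops"
    and R: "strongly_continuous_family R\<^sub>1" "strongly_continuous_family R\<^sub>2"
    and \<omega>: "ereal \<omega> \<ge> max 0 (max (laplace_abs (\<lambda>t. complex_of_real (cmod (a t)))) (laplace_abs k))"
    and equicontinuous:
      "equicontinuous_ops {(\<lambda>y. complex_of_real (exp (- \<omega> * t)) *\<^sub>C R\<^sub>1 t y) |t. t \<ge> 0}"
      "equicontinuous_ops {(\<lambda>x. complex_of_real (exp (- \<omega> * t)) *\<^sub>C R\<^sub>2 t x) |t. t \<ge> 0}"
  shows
    "(mild_existence_uniqueness_family a k C\<^sub>1 C\<^sub>2 R\<^sub>1 R\<^sub>2 (\<A>\<inverse>) \<longleftrightarrow>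
       (\<forall>\<mu>. Re \<mu> > \<omega> \<and> laplace a \<mu> * laplace k \<mu> \<noteq> 0 \<longrightarrow>
          range C\<^sub>1 \<subseteq> Range (scalar_minus (laplace a \<mu>) \<A>) \<and>
          cond_E a k C\<^sub>1 R\<^sub>1 \<A> \<mu> \<and> cond_U a k C\<^sub>2 R\<^sub>2 \<A> \<mu>)) \<and>
     (mild_existence_family a k C\<^sub>1 R\<^sub>1 (\<A>\<inverse>) \<longleftrightarrow>
       (\<forall>\<mu>. Re \<mu> > \<omega> \<and> laplace a \<mu> * laplace k \<mu> \<noteq> 0 \<longrightarrow>
          range C\<^sub>1 \<subseteq> Range (scalar_minus (laplace a \<mu>) \<A>) \<and>
          cond_E a k C\<^sub>1 R\<^sub>1 \<A> \<mu>)) \<and>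
     (mild_uniqueness_family a k C\<^sub>2 R\<^sub>2 (\<A>\<inverse>) \<longleftrightarrow>
       (\<forall>\<mu>. Re \<mu> > \<omega> \<longrightarrow> cond_U a k C\<^sub>2 R\<^sub>2 \<A> \<mu>))"
proof -
  have \<omega>': "laplace_abs (\<lambda>t. complex_of_real (cmod (a t))) \<le> ereal \<omega>" "laplace_abs k \<le> ereal \<omega>"
    using \<omega> by simp_all
  have abs_li: "locally_integrable (\<lambda>t. complex_of_real (cmod (a t)))" using P1(1) by (simp add: P1_def)
  interpret volterra_kernel a k \<omega>
  proof
    fix \<mu> assume \<mu>: "\<omega> < Re \<mu>"
    show "laplace_exists k \<mu>"
      by (rule laplace_exists_abs[OF locally_integrable_continuous[OF k(1)] \<omega>'(2) \<mu>])
    have "integrable (lebesgue_on {0..}) (\<lambda>t. exp (- (of_real (Re \<mu>) * of_real t)) * a t)"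
      by (rule integrable_laplace_abs[OF a(1) laplace_exists_abs[OF abs_li \<omega>'(1)]]) (simp add: \<mu>)
    \<comment> \<open>Integrability holds at the real point Re \<mu>; the remaining exponential
      factor is unimodular.\<close>
    then have "integrable (lebesgue_on {0..}) (\<lambda>t. exp (- (\<i> * of_real (Im \<mu>) * of_real t)) * (exp (- (of_real (Re \<mu>) * of_real t)) * a t))"
      by (rule integrable_bounded_mult[where C = 1])
        (auto intro!: measurable_lebesgue_on_continuous continuous_intros simp: norm_exp_mult_of_real)
    moreover have "exp (- (\<i> * of_real (Im \<mu>) * of_real t)) * (exp (- (of_real (Re \<mu>) * of_real t)) * a t)
        = lexp \<mu> t * a t" for t
    proof -
      have "- (\<mu> * of_real t) = - (\<i> * of_real (Im \<mu>) * of_real t) + - (of_real (Re \<mu>) * of_real t)"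
        by (subst complex_eq[of \<mu>]) (simp add: algebra_simps)
      then show ?thesis by (simp only: exp_add mult.assoc)
    qed
    ultimately show "integrable (lebesgue_on {0..}) (\<lambda>t. lexp \<mu> t * a t)" by simp
  qed (fact k a)+
  have R\<^sub>1_bound: "\<exists>C. \<forall>t\<ge>0. p (R\<^sub>1 t y) \<le> C * exp (\<omega> * t)" if "ccseminorm p" for p y
    using equicontinuous_orbit_bound[OF R(1) equicontinuous(1) that, of y] by metis
  have R\<^sub>2_bound: "\<exists>C\<ge>0. \<forall>t\<ge>0. p (R\<^sub>2 t y) \<le> C * exp (\<omega> * t)" if "ccseminorm p" for p y
    using equicontinuous_orbit_bound[OF R(2) equicontinuous(2) that, of y] by metis
  then have R\<^sub>2_bound': "\<exists>C. \<forall>t\<ge>0. p (R\<^sub>2 t y) \<le> C * exp (\<omega> * t)" if "ccseminorm p" for p y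
    using that by blast
  note R_cont = strongly_continuous_family_continuous_on[OF R(1)] strongly_continuous_family_continuous_on[OF R(2)]
  \<comment> \<open>(E) represents a nonzero multiple of \<open>C\<^sub>1 y\<close> in the range;
    dividing by the scalar stays in the graph, which is a linear subspace.\<close>
  have range: "range C\<^sub>1 \<subseteq> Range (scalar_minus (laplace a \<mu>) \<A>)"
    if nz: "laplace a \<mu> * laplace k \<mu> \<noteq> 0" and E: "cond_E a k C\<^sub>1 R\<^sub>1 \<A> \<mu>" for \<mu>
  proof (intro subsetI, elim rangeE)
    fix x y assume x: "x = C\<^sub>1 y"
    let ?d = "laplace a \<mu> * laplace k \<mu>"
    obtain z w where zw: "?d *\<^sub>C C\<^sub>1 y = laplace a \<mu> *\<^sub>C z - w" "(z, w) \<in> \<A>"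
      using E[unfolded cond_E_def, rule_format, of y] by (auto simp: scalar_minus_def)
    have "inverse ?d *\<^sub>C (z, w) \<in> \<A>" by (rule MLO_subspace(3)[OF \<A>(1) zw(2)])
    then have mem: "(inverse ?d *\<^sub>C z, inverse ?d *\<^sub>C w) \<in> \<A>" by (simp add: scaleC_prod_def)
    have "x = inverse ?d *\<^sub>C ?d *\<^sub>C C\<^sub>1 y"
      by (simp only: scaleC_scaleC left_inverse[OF nz] scaleC_one x)
    also have "\<dots> = laplace a \<mu> *\<^sub>C inverse ?d *\<^sub>C z - inverse ?d *\<^sub>C w"
      by (simp only: zw(1) complex_vector.scale_right_diff_distrib scaleC_scaleC mult.commute)
    finally have "(inverse ?d *\<^sub>C z, x) \<in> scalar_minus (laplace a \<mu>) \<A>"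
      using mem unfolding scalar_minus_def by blast
    then show "x \<in> Range (scalar_minus (laplace a \<mu>) \<A>)" by blast
  qed
  have "mild_existence_family a k C\<^sub>1 R\<^sub>1 (\<A>\<inverse>) \<longleftrightarrow>
      (\<forall>y. \<forall>t\<ge>0. (R\<^sub>1 t y - k t *\<^sub>C C\<^sub>1 y, convolution a (\<lambda>s. R\<^sub>1 s y) t) \<in> \<A>)"
    using R(1) by (auto simp: mild_existence_family_def)
  also have "\<dots> \<longleftrightarrow> (\<forall>y. \<forall>\<mu>. \<omega> < Re \<mu> \<and> laplace a \<mu> * laplace k \<mu> \<noteq> 0 \<longrightarrow>
      (laplace a \<mu> * laplace k \<mu>) *\<^sub>C C\<^sub>1 y \<in> scalar_minus (laplace a \<mu>) \<A> `` {lcs_laplace (\<lambda>t. k t *\<^sub>C C\<^sub>1 y - R\<^sub>1 t y) \<mu>})"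
    using existence_iff[OF \<A> R_cont(1) R\<^sub>1_bound] by (simp only:)
  also have "\<dots> \<longleftrightarrow> (\<forall>\<mu>. Re \<mu> > \<omega> \<and> laplace a \<mu> * laplace k \<mu> \<noteq> 0 \<longrightarrow> cond_E a k C\<^sub>1 R\<^sub>1 \<A> \<mu>)"
    unfolding cond_E_def by blast
  finally have existence: "mild_existence_family a k C\<^sub>1 R\<^sub>1 (\<A>\<inverse>) \<longleftrightarrow>
      (\<forall>\<mu>. Re \<mu> > \<omega> \<and> laplace a \<mu> * laplace k \<mu> \<noteq> 0 \<longrightarrow>
        range C\<^sub>1 \<subseteq> Range (scalar_minus (laplace a \<mu>) \<A>) \<and> cond_E a k C\<^sub>1 R\<^sub>1 \<A> \<mu>)"
    using range by blast
  have uniq_iff: "mild_uniqueness_family a k C\<^sub>2 R\<^sub>2 (\<A>\<inverse>) \<longleftrightarrow>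
      (\<forall>(y, x)\<in>\<A>. \<forall>t\<ge>0. convolution a (\<lambda>s. R\<^sub>2 s y) t = R\<^sub>2 t x - k t *\<^sub>C C\<^sub>2 x)"
    using R(2) by (auto simp: mild_uniqueness_family_def)
  have uniq_transform: "cond_U a k C\<^sub>2 R\<^sub>2 \<A> \<mu>" if "mild_uniqueness_family a k C\<^sub>2 R\<^sub>2 (\<A>\<inverse>)" "Re \<mu> > \<omega>" for \<mu>
    unfolding cond_U_def
  proof clarify
    fix y x assume "(y, x) \<in> \<A>"
    then have eq: "\<And>t. t \<ge> 0 \<Longrightarrow> convolution a (\<lambda>s. R\<^sub>2 s y) t = R\<^sub>2 t x - k t *\<^sub>C C\<^sub>2 x"
      using that(1) uniq_iff by blast
    show "laplace k \<mu> *\<^sub>C C\<^sub>2 x = lcs_laplace (\<lambda>t. R\<^sub>2 t x - convolution a (\<lambda>s. R\<^sub>2 s y) t) \<mu>"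
      by (rule uniqueness_transform[where u = "\<lambda>t. R\<^sub>2 t x" and v = "\<lambda>s. R\<^sub>2 s y",
            OF R_cont(2) R\<^sub>2_bound' R_cont(2) R\<^sub>2_bound eq that(2)])
  qed
  have uniq_inversion: "mild_uniqueness_family a k C\<^sub>2 R\<^sub>2 (\<A>\<inverse>)"
    if U: "\<And>\<mu>. Re \<mu> > \<omega> \<Longrightarrow> laplace a \<mu> * laplace k \<mu> \<noteq> 0 \<Longrightarrow> cond_U a k C\<^sub>2 R\<^sub>2 \<A> \<mu>"
    unfolding uniq_iff
  proof clarify
    fix y x and t :: real assume "(y, x) \<in> \<A>" and t: "0 \<le> t"
    then have eq: "laplace k \<mu> *\<^sub>C C\<^sub>2 x = lcs_laplace (\<lambda>t. R\<^sub>2 t x - convolution a (\<lambda>s. R\<^sub>2 s y) t) \<mu>"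
      if "\<omega> < Re \<mu>" "laplace a \<mu> * laplace k \<mu> \<noteq> 0" for \<mu>
      using U[OF that] by (auto simp: cond_U_def)
    show "convolution a (\<lambda>s. R\<^sub>2 s y) t = R\<^sub>2 t x - k t *\<^sub>C C\<^sub>2 x"
      by (rule uniqueness_inversion[where u = "\<lambda>t. R\<^sub>2 t x" and v = "\<lambda>s. R\<^sub>2 s y",
            OF R_cont(2) R\<^sub>2_bound' R_cont(2) R\<^sub>2_bound eq t])
  qed
  \<comment> \<open>(U) off the zeros yields the family, and the family yields (U) on the whole
    half-plane; hence the versions of (U) in (i) and (iii) agree.\<close>
  have uniqueness: "mild_uniqueness_family a k C\<^sub>2 R\<^sub>2 (\<A>\<inverse>) \<longleftrightarrow> (\<forall>\<mu>. Re \<mu> > \<omega> \<longrightarrow> cond_U a k C\<^sub>2 R\<^sub>2 \<A> \<mu>)"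
    and uniqueness_nz: "mild_uniqueness_family a k C\<^sub>2 R\<^sub>2 (\<A>\<inverse>) \<longleftrightarrow>
      (\<forall>\<mu>. Re \<mu> > \<omega> \<and> laplace a \<mu> * laplace k \<mu> \<noteq> 0 \<longrightarrow> cond_U a k C\<^sub>2 R\<^sub>2 \<A> \<mu>)"
    using uniq_transform uniq_inversion by blast+
  show ?thesis
    unfolding mild_existence_uniqueness_family_def
    using existence uniqueness uniqueness_nz by blast
qed

end
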